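(* Let $0<\alpha<\beta$ be fixed and let $\nu\ge\kappa\ge0$ be fixed integers. Let $K_n$ be the correlation kernel (defined in the context) of the squared singular values of the product $X_1X_2$ of the two coupled random matrices in the confluent case. Then $$\lim_{n\to\infty}\frac1{n(\beta^2-\alpha^2)}K_n\left(\frac{x}{n(\beta^2-\alpha^2)},\frac{y}{n(\beta^2-\alpha^2)}\right)=\left(\frac yx\right)^{\kappa/2}K_{\nu,\kappa}(y,x),$$ uniformly for $x,y$ in compact subsets of $(0,\infty)$, where $K_{\nu,\kappa}$ is the Meijer G-kernel $$K_{\nu_1,\nu_2}(x,y)=\int_0^1G^{1,0}_{0,3}\left({-\atop 0,-\nu_1,-\nu_2}\Big|ux\right)G^{2,0}_{0,3}\left({-\atop\nu_1,\nu_2,0}\Big|uy\right)du$$ with $\nu_1=\nu$, $\nu_2=\kappa$.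
   Context: **Kernel.** The matrix model is the probability measure proportional to $\exp(-\beta\,\mathrm{Tr}(X_1X_1^*+X_2^*X_2)+\mathrm{Tr}(\Omega X_1X_2+(\Omega X_1X_2)^* ))\,dX_1dX_2$ on pairs of complex matrices of sizes $L\times M$ and $M\times n$, with $M\ge L\ge n$, $\kappa=L-n$, $\nu=M-n$; the confluent case means all singular values of the $n\times L$ coupling matrix $\Omega$ equal $\alpha$. The squared singular values of $X_1X_2$ then have joint density on $(0,\infty)^n$ proportional to $$\det\big[x_k^{\frac{\kappa+j-1}2}I_{\kappa+j-1}(2\alpha\sqrt{x_k})\big]_{j,k=1}^n\det\big[x_k^{\frac{\nu-\kappa+j-1}2}K_{\nu-\kappa+j-1}(2\beta\sqrt{x_k})\big]_{j,k=1}^n,$$ where $I_\mu,K_\mu$ are the modified Bessel functions of the first and second kind. This is a determinantal point process with kernel $$K_n(x,y)=\sum_{k=0}^{n-1}\mathcal Q_k(x)\mathcal P_k(y),$$ where $\mathcal Q_k$ is in the linear span of $x^{\frac{\kappa+j}2}I_{\kappa+j}(2\alpha\sqrt x)$, $j=0,\dots,k$, $\mathcal P_k$ is in the linear span of $x^{\frac{\nu-\kappa+j}2}K_{\nu-\kappa+j}(2\beta\sqrt x)$, $j=0,\dots,k$, and $\int_0^\infty\mathcal Q_k(x)\mathcal P_j(x)\,dx=\delta_{j,k}$. **Meijer G-function.** $$G^{m,0}_{0,q}\left({-\atop b_1,\dots,b_q}\Big|\zeta\right)=\frac1{2\pi i}\int_L\frac{\prod_{j=1}^m\Gamma(b_j+u)}{\prod_{j=m+1}^q\Gamma(1-b_j-u)}\zeta^{-u}\,du,$$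 where the contour $L$ has all poles of $\Gamma(b_j+u)$, $j=1,\dots,m$, on its left; for $q\ge1$ one may take a loop starting and ending at $-\infty$ and encircling all these poles once in the positive direction.
   Formalization: The printed limit is false for K_n as defined (already at ν=κ=0 x and y are swapped); proved instead: the scaled K_n(x,y) tends to (x/y)^κ K_{ν,κ}(x,y), and the printed right side is the limit for the equivalent kernel (x/y)^{κ/2} K_n(y,x). *)

theory Defs
  imports "HOL-Complex_Analysis.Complex_Analysis"
begin

text \<open>
  Modified Bessel functions of real order \<open>\<mu>\<close> and real argument \<open>z > 0\<close>. The integral for the
  second kind converges for every real \<open>\<mu>\<close>, integer orders included.
\<close>

definition bessel_I :: "real \<Rightarrow> real \<Rightarrow> real" where
  "bessel_I \<mu> z = (\<Sum>m. (z / 2) powr (2 * real m + \<mu>) / (fact m * Gamma (\<mu> + real m + 1)))"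

definition bessel_K :: "real \<Rightarrow> real \<Rightarrow> real" where
  "bessel_K \<mu> z = (LBINT t:{0..}. exp (- z * cosh t) * cosh (\<mu> * t))"

definition weight_I :: "nat \<Rightarrow> real \<Rightarrow> nat \<Rightarrow> real \<Rightarrow> real" where
  "weight_I \<kappa> \<alpha> j x = x powr ((real \<kappa> + real j) / 2) * bessel_I (real \<kappa> + real j) (2 * \<alpha> * sqrt x)"

definition weight_K :: "nat \<Rightarrow> nat \<Rightarrow> real \<Rightarrow> nat \<Rightarrow> real \<Rightarrow> real" where
  "weight_K \<kappa> \<nu> \<beta> j x = x powr ((real \<nu> - real \<kappa> + real j) / 2)
      * bessel_K (real \<nu> - real \<kappa> + real j) (2 * \<beta> * sqrt x)"

text \<open>
  Linear spans are taken in the space of functions on the open half-line; values at \<open>x \<le> 0\<close> are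
  left arbitrary. The functions \<open>Q k\<close> and \<open>P k\<close> are determined only up to reciprocal scalar
  factors, which cancel in the kernel. Besides \<open>K x y\<close>, the kernel
  \<open>(x / y) powr a * K y x\<close> describes the same determinantal point process: transposition and
  conjugation by a positive function change none of the determinants \<open>det (K (x i) (x j))\<close>.
\<close>

definition biorthogonal_system ::
    "nat \<Rightarrow> nat \<Rightarrow> real \<Rightarrow> real \<Rightarrow> nat \<Rightarrow> (nat \<Rightarrow> real \<Rightarrow> real) \<Rightarrow> (nat \<Rightarrow> real \<Rightarrow> real) \<Rightarrow> bool" where
  "biorthogonal_system \<kappa> \<nu> \<alpha> \<beta> n Q P \<longleftrightarrow>
     (\<forall>k<n. \<exists>c :: nat \<Rightarrow> real. \<forall>x>0. Q k x = (\<Sum>j\<le>k. c j * weight_I \<kappa> \<alpha> j x)) \<and>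
     (\<forall>k<n. \<exists>c :: nat \<Rightarrow> real. \<forall>x>0. P k x = (\<Sum>j\<le>k. c j * weight_K \<kappa> \<nu> \<beta> j x)) \<and>
     (\<forall>k<n. \<forall>j<n. (LBINT x:{0<..}. Q k x * P j x) = (if j = k then 1 else 0))"

definition is_correlation_kernel ::
    "nat \<Rightarrow> nat \<Rightarrow> real \<Rightarrow> real \<Rightarrow> nat \<Rightarrow> (real \<Rightarrow> real \<Rightarrow> real) \<Rightarrow> bool" where
  "is_correlation_kernel \<kappa> \<nu> \<alpha> \<beta> n K \<longleftrightarrow>
     (\<exists>Q P. biorthogonal_system \<kappa> \<nu> \<alpha> \<beta> n Q P \<and>
            (\<forall>x>0. \<forall>y>0. K x y = (\<Sum>k<n. Q k x * P k y)))"

text \<open>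
  The Meijer function with \<open>n = p = 0\<close> and lower parameters \<open>bs\<close>; \<open>m\<close> of them go to the numerator.
  The contour is the loop with corners \<open>r \<plusminus> \<i> r\<close> and two horizontal ends going to \<open>-\<infinity>\<close>; it
  encircles all the points \<open>- (bs ! j) - l\<close> because \<open>r > cmod (bs ! j)\<close>. If it meets a pole of
  a Gamma function in the denominator, the conventions \<open>Gamma w = 0\<close> at a pole and \<open>z / 0 = 0\<close>
  give the correct value of the entire function \<open>1 / Gamma\<close>.
\<close>

definition meijer_integrand :: "nat \<Rightarrow> complex list \<Rightarrow> complex \<Rightarrow> complex \<Rightarrow> complex" where
  "meijer_integrand m bs \<zeta> u =
     (\<Prod>j<m. Gamma (bs ! j + u)) / (\<Prod>j\<in>{m..<length bs}. Gamma (1 - bs ! j - u)) * \<zeta> powr (- u)"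

definition truncated_loop :: "real \<Rightarrow> real \<Rightarrow> real \<Rightarrow> complex" where
  "truncated_loop r R =
     linepath (Complex (- R) (- r)) (Complex r (- r))
     +++ linepath (Complex r (- r)) (Complex r r)
     +++ linepath (Complex r r) (Complex (- R) r)"

definition meijer_G :: "nat \<Rightarrow> complex list \<Rightarrow> complex \<Rightarrow> complex" where
  "meijer_G m bs \<zeta> =
     1 / (2 * of_real pi * \<i>) *
       Lim at_top (\<lambda>R. contour_integral (truncated_loop (1 + (\<Sum>b\<leftarrow>bs. cmod b)) R)
                         (meijer_integrand m bs \<zeta>))"

definition meijer_kernel :: "nat \<Rightarrow> nat \<Rightarrow> real \<Rightarrow> real \<Rightarrow> complex" where
  "meijer_kernel \<nu>\<^sub>1 \<nu>\<^sub>2 x y =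
     (CLBINT u:{0..1}. meijer_G 1 [0, - of_nat \<nu>\<^sub>1, - of_nat \<nu>\<^sub>2] (of_real (u * x))
                     * meijer_G 2 [of_nat \<nu>\<^sub>1, of_nat \<nu>\<^sub>2, 0] (of_real (u * y)))"

end

theory Submission
  imports Defs "HOL-Real_Asymp.Real_Asymp" "HOL-Probability.Distributions" "Jordan_Normal_Form.Determinant"
begin

text \<open>
  By the moments of the weights, the Gram matrix is, up to a constant and diagonal factors, the Hankel
  matrix of the numbers \<open>(\<nu> + i + j)!\<close>. Hence the kernel is a sum over \<open>k < n\<close> of products of two
  Laguerre combinations, one of the \<open>I\<close>-Bessel and one of the \<open>K\<close>-Bessel weights. The first is a sum
  that converges term by term after rescaling. For the second, the obvious integral oscillates and has no
  integrable majorant; it is rewritten as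
  \<open>\<integral> Z^\<kappa> clif \<kappa> Z (Z + c)^(-\<nu>-1) (1 - p / (Z + c))^k dZ\<close>, to which dominated convergence applies.
  The sum over \<open>k = u n\<close> becomes the integral over \<open>u\<close>. The first limit factor is the residue series of its
  Meijer function. For the second, the loop is moved to a vertical line, where the
  Cahen-Mellin integral of \<open>exp (- z)\<close> and the Mellin transform of \<open>clif\<close> give
  \<open>\<integral> clif \<kappa> X X^(\<kappa>-\<nu>-1) exp (- z / X) dX\<close>. Everything is done along convergent sequences \<open>x m\<close>, \<open>y m\<close>,
  which yields uniformity on compact sets.
\<close>

text \<open>The orders \<kappa> + i and \<nu> - \<kappa> + j of the two weights add up to \<nu> + i
  + j, which makes the Gram matrix Hankel, with the moments of x^\<nu> exp (-x) as entries. The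
  kernel depends on the inverse of that matrix only, so Laguerre polynomials may replace whatever
  system is given. On the K side the factorial (\<nu> + j)! produced by
  \<open>macdonald_eq_clif\<close> cancels the one in the Laguerre coefficient; binomial
  coefficients remain and the sum closes to a k-th power. Its base 1 - p / (Z + c) lies between 1 -
  w and 1 with w = 1 - \<alpha>^2 / \<beta>^2, and this positivity removes the oscillation. For
  \<nu> = \<kappa> the limiting integrand still behaves like \<open>clif \<kappa> Z / Z\<close> at
  infinity, so boundedness of \<open>clif\<close> is not enough: a decay Z^(-1/4) is required, which
  is the reason for the energy estimates. With this rate, Mellin integrals of \<open>clif\<close>
  are dominated for 0 < Re s < 1/4; the midpoint 1/8 is used throughout and returns as u^(-1/8) in
  the final majorant.\<close>

subsection \<open>The Bessel-Clifford functions\<close>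

text \<open>
  For \<open>z > 0\<close> this is \<open>z powr (- a / 2) * J\<^sub>a (2 * sqrt z)\<close>; at negative arguments it gives the
  functions \<open>I\<^sub>a\<close>.
\<close>

definition clif :: "nat \<Rightarrow> real \<Rightarrow> real" where
  "clif a z = (\<Sum>m. (- z) ^ m / (fact m * fact (m + a)))"

lemma clif_term_le: "norm ((- z) ^ m / (fact m * fact (m + a)) :: real) \<le> \<bar>z\<bar> ^ m / fact m"
proof -
  have "1 \<le> (fact (m + a) :: real)" by (rule fact_ge_1)
  then have "(fact m :: real) * 1 \<le> fact m * fact (m + a)" by (intro mult_left_mono) auto
  then have "\<bar>z\<bar> ^ m / (fact m * fact (m + a)) \<le> \<bar>z\<bar> ^ m / fact m"
    by (intro divide_left_mono) auto
  then show ?thesis by (simp add: power_abs abs_mult)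
qed

lemma summable_exp_abs: "summable (\<lambda>m. \<bar>z :: real\<bar> ^ m / fact m)"
  using summable_exp_generic[of "\<bar>z\<bar>"] by (simp add: divide_inverse mult.commute)

lemma summable_clif: "summable (\<lambda>m. (- z :: real) ^ m / (fact m * fact (m + a)))"
  by (rule summable_comparison_test[OF _ summable_exp_abs[of z]]) (use clif_term_le in blast)

lemma clif_sums: "(\<lambda>m. (- z) ^ m / (fact m * fact (m + a))) sums clif a z"
  unfolding clif_def by (rule summable_sums[OF summable_clif])

lemma clif_0: "clif a 0 = 1 / fact a"
proof -
  have "(\<lambda>m. (- 0 :: real) ^ m / (fact m * fact (m + a))) = (\<lambda>m. if m = 0 then 1 / fact a else 0)"
    by auto
  then show ?thesis using clif_sums[of 0 a] sums_single[of 0 "\<lambda>_. 1 / fact a :: real"]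
    by (auto intro: sums_unique2)
qed

lemma abs_clif_le_exp: "\<bar>clif a z\<bar> \<le> exp \<bar>z\<bar>"
proof -
  have "(\<lambda>m. \<bar>z\<bar> ^ m / fact m) sums exp \<bar>z\<bar>"
    using exp_converges[of "\<bar>z\<bar>"] by (simp add: divide_inverse mult.commute)
  moreover have "norm (\<Sum>m. (- z) ^ m / (fact m * fact (m + a)) :: real) \<le> (\<Sum>m. \<bar>z\<bar> ^ m / fact m)"
    by (rule norm_suminf_le[OF clif_term_le summable_exp_abs])
  ultimately show ?thesis by (simp add: clif_def sums_iff)
qed

lemma DERIV_clif: "(clif a has_real_derivative - clif (Suc a) z) (at z)"
proof -
  define c :: "nat \<Rightarrow> nat \<Rightarrow> real" where "c b m = (- 1) ^ m / (fact m * fact (m + b))" for b m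
  have eq: "c b m * y ^ m = (- y) ^ m / (fact m * fact (m + b))" for b m y
    by (simp add: c_def flip: power_mult_distrib)
  have sm: "summable (\<lambda>m. c b m * y ^ m)" for b y
    unfolding eq by (rule summable_clif)
  have clif_c: "clif b = (\<lambda>y. \<Sum>m. c b m * y ^ m)" for b
    by (simp add: clif_def eq fun_eq_iff)
  have "diffs (c a) m * y ^ m = - (c (Suc a) m * y ^ m)" for m y
    by (simp add: diffs_def c_def divide_simps)
  then have "(\<Sum>m. diffs (c a) m * z ^ m) = - clif (Suc a) z"
    by (simp add: suminf_minus[OF sm] clif_c)
  then show ?thesis
    unfolding clif_c using termdiffs_strong_converges_everywhere[of "c a" z] sm by metis
qed

lemma DERIV_clif' [derivative_intros]:
  "(g has_real_derivative g') (at z within A) \<Longrightarrow>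
    ((\<lambda>x. clif a (g x)) has_real_derivative (- clif (Suc a) (g z) * g')) (at z within A)"
  by (rule DERIV_chain2[OF DERIV_clif])

lemma continuous_on_clif [continuous_intros]:
  "continuous_on A g \<Longrightarrow> continuous_on A (\<lambda>x. clif a (g x))"
  by (rule continuous_on_compose2[of UNIV "clif a"])
     (auto intro!: DERIV_atLeastAtMost_imp_continuous_on DERIV_continuous_on DERIV_clif)

lemma isCont_clif: "isCont (clif a) z"
  using DERIV_clif DERIV_isCont by blast

lemma borel_measurable_clif [measurable]: "clif a \<in> borel_measurable borel"
  by (intro borel_measurable_continuous_onI continuous_on_clif continuous_on_id)

section \<open>Contiguous relation, energy inequalities and decay of \<open>clif\<close>\<close>

lemma clif_contiguous: "z * clif (a + 2) z = real (a + 1) * clif (a + 1) z - clif a z"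
proof -
  define t where "t = (\<lambda>b m. (- z) ^ m / (fact m * fact (m + b)) :: real)"
  have s: "t b sums clif b z" for b unfolding t_def by (rule clif_sums)
  have eq: "real (a + 1) * t (a + 1) (Suc m) - t a (Suc m) = z * t (a + 2) m" for m
  proof -
    have f: "(fact (m + (a + 2)) :: real) = fact (Suc m + (a + 1))"
      "(fact (Suc m + (a + 1)) :: real) = real (Suc m + a + 1) * fact (Suc m + a)" 
      "(fact (Suc m) :: real) = real (Suc m) * fact m"
      by (simp_all del: of_nat_Suc)
    define F where "F = (fact (Suc m + a) :: real)"
    define G where "G = (fact m :: real)"
    have [simp]: "F \<noteq> 0" "G \<noteq> 0" by (auto simp: F_def G_def)
    show ?thesis
      unfolding t_def f F_def[symmetric] G_def[symmetric]
      by (simp add: divide_simps del: of_nat_Suc) (simp add: algebra_simps)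
  qed
  \<comment> \<open>The constant term of the right-hand side cancels; dropping it shifts the index
    by one and produces the factor z.\<close>
  have z0: "real (a + 1) * t (a + 1) 0 - t a 0 = 0"
    by (simp add: t_def divide_simps)
  define f where "f = (\<lambda>m. real (a + 1) * t (a + 1) m - t a m)"
  have "f sums (real (a + 1) * clif (a + 1) z - clif a z)"
    unfolding f_def by (intro sums_diff sums_mult s)
  moreover have "f 0 = 0" using z0 by (simp only: f_def)
  ultimately have "(\<lambda>m. f (Suc m)) sums (real (a + 1) * clif (a + 1) z - clif a z)"
    using sums_Suc_iff[of f] by auto
  then have "(\<lambda>m. z * t (a + 2) m) sums (real (a + 1) * clif (a + 1) z - clif a z)"
    by (simp only: f_def eq)
  moreover have "(\<lambda>m. z * t (a + 2) m) sums (z * clif (a + 2) z)" by (intro sums_mult s)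
  ultimately show ?thesis by (rule sums_unique2[symmetric])
qed

text \<open>The contiguous relation reduces the derivative of the left side to -(2 a + 1) times a
  square. Besides the bound 1 / a! for \<open>clif a\<close> this yields a decay for every positive
  index, through the second summand; only index 0 needs the finer energy of the next
  estimate.\<close>

lemma clif_energy:
  assumes "z \<ge> 0"
  shows "(clif a z)\<^sup>2 + z * (clif (Suc a) z)\<^sup>2 \<le> (1 / fact a)\<^sup>2"
proof -
  let ?E = "\<lambda>z. (clif a z)\<^sup>2 + z * (clif (Suc a) z)\<^sup>2"
  have "\<exists>y. (?E has_real_derivative y) (at x) \<and> y \<le> 0" if "x \<ge> 0" for x
  proof (intro exI conjI)
    have c: "x * clif (Suc (Suc a)) x = (real a + 1) * clif (Suc a) x - clif a x"
      using clif_contiguous[of x a] by (simp add: add.commute)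
    have "(?E has_real_derivative 2 * clif a x * - clif (Suc a) x
        + ((clif (Suc a) x)\<^sup>2 - 2 * clif (Suc a) x * (x * clif (Suc (Suc a)) x))) (at x)"
      by (rule derivative_eq_intros refl)+ (simp add: algebra_simps power2_eq_square)
    also have "2 * clif a x * - clif (Suc a) x
        + ((clif (Suc a) x)\<^sup>2 - 2 * clif (Suc a) x * (x * clif (Suc (Suc a)) x)) = - (2 * real a + 1) * (clif (Suc a) x)\<^sup>2"
      unfolding c by (simp add: algebra_simps power2_eq_square)
    finally show "(?E has_real_derivative - (2 * real a + 1) * (clif (Suc a) x)\<^sup>2) (at x)" .
    show "- (2 * real a + 1) * (clif (Suc a) x)\<^sup>2 \<le> 0"
      by (rule mult_nonpos_nonneg) auto
  qed
  then have "?E z \<le> ?E 0"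
    by (intro DERIV_nonpos_imp_nonincreasing[OF assms]) auto
  then show ?thesis by (simp add: clif_0)
qed

lemma abs_mult_le_sum_squares: "\<bar>x * y\<bar> \<le> x\<^sup>2 + y\<^sup>2" for x y :: real
proof -
  have "2 * (\<bar>x\<bar> * \<bar>y\<bar>) \<le> x\<^sup>2 + y\<^sup>2" using sum_squares_bound[of "\<bar>x\<bar>" "\<bar>y\<bar>"] by (simp add: mult.assoc)
  moreover have "0 \<le> \<bar>x\<bar> * \<bar>y\<bar>" by simp
  ultimately show ?thesis unfolding abs_mult by linarith
qed

text \<open>
  The decreasing quantity is, in the variable \<open>w = 2 * sqrt z\<close>, the energy
  \<open>u'\<^sup>2 + (1 + 1 / (4 w\<^sup>2)) u\<^sup>2\<close> of \<open>u = sqrt w * J\<^sub>0 w\<close>, up to a constant factor.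
\<close>

lemma clif_energy_0:
  assumes "z \<ge> 1"
  shows "sqrt z * (clif 0 z)\<^sup>2 \<le> 6"
proof -
  let ?E = "\<lambda>z. sqrt z * (z * (clif 1 z)\<^sup>2 + (clif 0 z)\<^sup>2 - clif 0 z * clif 1 z / 2)
    + (clif 0 z)\<^sup>2 / (8 * sqrt z)"
  have "\<exists>y. (?E has_real_derivative y) (at x) \<and> y \<le> 0" if "x \<ge> 1" for x
  proof (intro exI conjI)
    define r where "r = sqrt x"
    have r: "r > 0" "x = r * r" using that by (auto simp: r_def)
    define p q where "p = clif 0 x" and "q = clif 1 x"
    have dp: "(clif 0 has_real_derivative - q) (at x)"
      using DERIV_clif[of 0 x] by (simp add: q_def)
    have "x * clif 2 x = q - p"
      using clif_contiguous[of x 0] unfolding p_def q_def by (simp add: numeral_2_eq_2)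
    then have "clif 2 x = (q - p) / x"
      using that by (simp add: nonzero_eq_divide_eq mult.commute)
    then have dq: "(clif 1 has_real_derivative - ((q - p) / x)) (at x)"
      using DERIV_clif[of 1 x] by (simp add: numeral_2_eq_2)
    have ds: "(sqrt has_real_derivative 1 / (2 * r)) (at x)"
      using DERIV_real_sqrt[of x] that by (simp add: r_def field_simps)
    \<comment> \<open>Abstract f, g and s keep the derivative rules from producing
      \<open>clif 2\<close>; the derivatives prepared above, which involve p and q only, are
      inserted afterwards.\<close>
    have gen: "((\<lambda>z. s z * (z * (g z)\<^sup>2 + (f z)\<^sup>2 - f z * g z / 2) + (f z)\<^sup>2 / (8 * s z)) has_real_derivative
        (s' * (x * (g x)\<^sup>2 + (f x)\<^sup>2 - f x * g x / 2)
         + ((g x)\<^sup>2 + x * (2 * g x * g') + 2 * f x * f' - (f' * g x + g' * f x) / 2) * s x)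
        + (2 * f x * f' * (8 * s x) - (f x)\<^sup>2 * (8 * s')) / ((8 * s x) * (8 * s x))) (at x)"
      if "(f has_real_derivative f') (at x)" "(g has_real_derivative g') (at x)"
        "(s has_real_derivative s') (at x)" "s x \<noteq> 0" for f g s :: "real \<Rightarrow> real" and f' g' s'
      by (rule derivative_eq_intros that refl | (use that in simp; fail))+
         (simp add: algebra_simps power2_eq_square)
    have "(?E has_real_derivative
        (1 / (2 * r) * (x * q\<^sup>2 + p\<^sup>2 - p * q / 2)
         + (q\<^sup>2 + x * (2 * q * - ((q - p) / x)) + 2 * p * - q - (- q * q + - ((q - p) / x) * p) / 2) * r)
        + (2 * p * - q * (8 * r) - p\<^sup>2 * (8 * (1 / (2 * r)))) / ((8 * r) * (8 * r))) (at x)"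
      using gen[OF dp dq ds] r(1) unfolding p_def[symmetric] q_def[symmetric] r_def[symmetric] by simp
    also have "(1 / (2 * r) * (x * q\<^sup>2 + p\<^sup>2 - p * q / 2)
         + (q\<^sup>2 + x * (2 * q * - ((q - p) / x)) + 2 * p * - q - (- q * q + - ((q - p) / x) * p) / 2) * r)
        + (2 * p * - q * (8 * r) - p\<^sup>2 * (8 * (1 / (2 * r)))) / ((8 * r) * (8 * r))
      = - p\<^sup>2 / (16 * r * x)"
    proof -
  have [simp]: "r \<noteq> 0" using r by simp
  have 1: "x * (2 * q * - ((q - p) / x)) = - 2 * q * (q - p)" using r by simp
  have 2: "1 / (2 * r) * (x * q\<^sup>2 + p\<^sup>2 - p * q / 2) = r * q\<^sup>2/2 + (p\<^sup>2 - p * q/2) / (2 * r)"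
    using r by (simp add: divide_simps power2_eq_square)
  have 4: "(2 * p * - q * (8 * r) - p\<^sup>2 * (8 * (1 / (2 * r)))) / ((8 * r) * (8 * r)) = - p * q/ (4 * r) - p\<^sup>2/(16 * r * x)"
    using r by (simp add: divide_simps power2_eq_square)
  have 5: "(q\<^sup>2 + - 2 * q * (q - p) + 2 * p * - q - (- q * q + - ((q - p) / x) * p) / 2) * r
    = - q\<^sup>2 * r/2 + (q-p) * p / r / 2" 
     using r by (simp add: divide_simps power2_eq_square) (simp add: algebra_simps)
  show ?thesis unfolding 1 2 4 5 using r by (simp add: divide_simps power2_eq_square) (simp add: algebra_simps)
qed
    finally show "(?E has_real_derivative - (clif 0 x)\<^sup>2 / (16 * sqrt x * x)) (at x)"
      by (simp add: p_def r_def)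
  qed (use that in auto)
  then have "?E z \<le> ?E 1"
    by (intro DERIV_nonpos_imp_nonincreasing[OF assms]) auto
  also have "\<dots> \<le> 3"
  proof -
    have "(clif 0 1)\<^sup>2 + (clif 1 1)\<^sup>2 \<le> 1" using clif_energy[of 1 0] by simp
    moreover have "- (clif 0 1 * clif 1 1) \<le> ((clif 0 1)\<^sup>2 + (clif 1 1)\<^sup>2)"
      using abs_mult_le_sum_squares[of "clif 0 1" "clif 1 1"] by linarith
    moreover have "0 \<le> (clif 1 1)\<^sup>2" "0 \<le> (clif 0 1)\<^sup>2" by simp_all
    ultimately show ?thesis unfolding real_sqrt_one mult_1_left mult_1_right by linarith
  qed
  finally have le: "?E z \<le> 3" .
  \<comment> \<open>For z >= 1 the quadratic form in \<open>clif 0 z\<close> and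
    \<open>clif 1 z\<close> dominates half the square of the first; this turns the bound 3 of the
    energy into 6.\<close>
  have "(clif 0 z)\<^sup>2 / 2 \<le> z * (clif 1 z)\<^sup>2 + (clif 0 z)\<^sup>2 - clif 0 z * clif 1 z / 2"
  proof -
    have "1 * (clif 1 z)\<^sup>2 \<le> z * (clif 1 z)\<^sup>2" using assms by (intro mult_right_mono) auto
    moreover have "clif 0 z * clif 1 z \<le> (clif 0 z)\<^sup>2 + (clif 1 z)\<^sup>2"
      using abs_mult_le_sum_squares[of "clif 0 z" "clif 1 z"] by linarith
    moreover have "0 \<le> (clif 1 z)\<^sup>2" by simp
    ultimately show ?thesis by linarith
  qed
  then have "sqrt z * ((clif 0 z)\<^sup>2 / 2) \<le> sqrt z * (z * (clif 1 z)\<^sup>2 + (clif 0 z)\<^sup>2 - clif 0 z * clif 1 z / 2)"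
    using assms by (intro mult_left_mono) auto
  moreover have "0 \<le> (clif 0 z)\<^sup>2 / (8 * sqrt z)" using assms by simp
  ultimately show ?thesis using le by linarith
qed

lemma clif_abs_le_1: "z \<ge> 0 \<Longrightarrow> \<bar>clif a z\<bar> \<le> 1"
proof -
  assume z: "z \<ge> 0"
  have "(clif a z)\<^sup>2 \<le> (1 / fact a)\<^sup>2"
    using clif_energy[OF z, of a] z by (smt (verit) mult_nonneg_nonneg zero_le_power2)
  then have "\<bar>clif a z\<bar> \<le> 1 / fact a"
    by (metis abs_le_square_iff abs_of_nonneg fact_ge_zero zero_le_divide_1_iff)
  also have "\<dots> \<le> 1" by (simp add: fact_ge_1)
  finally show ?thesis .
qed

lemma clif_sq_decay:
  assumes "z \<ge> 1"
  shows "sqrt z * (clif a z)\<^sup>2 \<le> 6"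
proof (cases a)
  case 0
  then show ?thesis using clif_energy_0[OF assms] by simp
next
  case (Suc b)
  have "z * (clif (Suc b) z)\<^sup>2 \<le> (1 / fact b)\<^sup>2"
    using clif_energy[of z b] assms by (smt (verit) zero_le_power2)
  also have "\<dots> \<le> 1\<^sup>2" by (intro power_mono) (auto simp: fact_ge_1)
  finally have "z * (clif (Suc b) z)\<^sup>2 \<le> 1" by simp
  moreover have "sqrt z * (clif (Suc b) z)\<^sup>2 \<le> z * (clif (Suc b) z)\<^sup>2"
    using assms by (intro mult_right_mono) (auto simp: real_sqrt_le_iff intro!: real_le_lsqrt self_le_power)
  ultimately show ?thesis using Suc by simp
qed

text \<open>For z >= 1, sqrt (1 + z) <= 2 sqrt z gives 12 <= 4^2; for z < 1 the constant 4 more than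
  compensates the factor (1 + z)^(-1/4). The rate is that of J_0, hence the best one that holds for
  all indices a.\<close>

lemma clif_decay:
  assumes "z \<ge> 0"
  shows "\<bar>clif a z\<bar> \<le> 4 * (1 + z) powr (- 1 / 4)"
proof (cases "z \<ge> 1")
  case True
  have "\<bar>clif a z\<bar> ^ 2 * sqrt z \<le> 6" using clif_sq_decay[OF True, of a] by (simp add: mult.commute)
  moreover have "sqrt ((1 + z) / 2) \<le> sqrt z" using True by simp
  moreover have "sqrt ((1 + z) / 2) \<ge> sqrt (1 + z) / 2"
  proof -
    have "sqrt (1 + z) / 2 = sqrt ((1 + z) / 4)" by (simp add: real_sqrt_divide)
    also have "\<dots> \<le> sqrt ((1 + z) / 2)" using True by simp
    finally show ?thesis .
  qed
  ultimately have "\<bar>clif a z\<bar> ^ 2 * (sqrt (1 + z) / 2) \<le> 6"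
    by (smt (verit) mult_left_mono zero_le_power2)
  then have "\<bar>clif a z\<bar> ^ 2 * sqrt (1 + z) \<le> 16" by simp
  moreover have "sqrt (1 + z) = ((1 + z) powr (1 / 4)) ^ 2"
    using assms by (simp add: powr_half_sqrt[symmetric] powr_power[symmetric] powr_powr flip: powr_realpow)
  ultimately have "(\<bar>clif a z\<bar> * (1 + z) powr (1 / 4)) ^ 2 \<le> 4 ^ 2"
    by (simp add: power_mult_distrib)
  then have "\<bar>clif a z\<bar> * (1 + z) powr (1 / 4) \<le> 4"
    by (rule power2_le_imp_le) simp
  then show ?thesis using assms by (simp add: powr_minus field_simps)
next
  case False
  have "4 powr (- 1 / 4) \<le> (1 + z) powr (- 1 / 4)"
    using False assms by (intro powr_mono2') auto
  moreover have "1 / 4 \<le> (4 :: real) powr (- 1 / 4)"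
    using powr_mono[of "-1" "-1/4" "4::real"] by (simp add: powr_minus)
  ultimately show ?thesis using clif_abs_le_1[OF assms, of a] by linarith
qed

subsection \<open>Bounds for the Gamma function\<close>

text \<open>On the line Re z = 1/2 conjugation is z -> 1 - z, so the reflection formula evaluates
  the squared modulus exactly; the only loss is in the upper bound for the sine.\<close>

lemma norm_rGamma_half: "norm (rGamma (Complex (1 / 2) y)) \<le> exp (pi * \<bar>y\<bar> / 2) * rGamma (1 / 2)"
proof -
  define z where "z = Complex (1 / 2) y"
  have cz: "cnj z = 1 - z" by (simp add: z_def complex_eq_iff)
  have "norm (rGamma z) ^ 2 = norm (rGamma z) * norm (rGamma (1 - z))"
    by (metis cz cnj_rGamma complex_mod_cnj power2_eq_square)
  also have "\<dots> = norm (inverse (Gamma z * Gamma (1 - z)))"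
    by (simp add: rGamma_inverse_Gamma norm_mult norm_inverse)
  also have "\<dots> = norm (sin (of_real pi * z)) / pi"
    by (simp add: Gamma_reflection_complex norm_divide norm_inverse)
  also have "\<dots> \<le> exp (pi * \<bar>y\<bar>) / pi"
    using cmod_sin_le_exp[of 1 "of_real pi * z"] by (intro divide_right_mono) (auto simp: z_def abs_mult)
  also have "\<dots> = (exp (pi * \<bar>y\<bar> / 2) * rGamma (1 / 2)) ^ 2"
  proof -
    have "rGamma (1 / 2 :: real) ^ 2 = 1 / pi"

      by (simp add: rGamma_inverse_Gamma Gamma_one_half_real power_inverse inverse_eq_divide power_divide)
    moreover have "exp (pi * \<bar>y\<bar> / 2) ^ 2 = exp (pi * \<bar>y\<bar>)"
      using exp_double[of "pi * \<bar>y\<bar> / 2"] by simp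
    ultimately show ?thesis by (simp add: power_mult_distrib)
  qed
  finally show ?thesis unfolding z_def[symmetric]
    by (rule power2_le_imp_le) (auto simp: rGamma_inverse_Gamma)
qed

text \<open>Factor by factor: 1 + y^2 / (x + k)^2 decreases in x. The inequality is
  cross-multiplied, so that no division is involved.\<close>

lemma norm_pochhammer_le_half:
  assumes "x \<ge> 1 / 2"
  shows "norm (pochhammer (Complex x y) n) * pochhammer (1 / 2) n
    \<le> norm (pochhammer (Complex (1 / 2) y) n) * pochhammer x n"
proof -
  have "norm (Complex x y + of_nat k) * (1 / 2 + real k) \<le> norm (Complex (1 / 2) y + of_nat k) * (x + real k)"
    for k
  proof (rule power2_le_imp_le)
    have "(1 / 2 + real k)\<^sup>2 \<le> (x + real k)\<^sup>2" using assms by (intro power_mono) auto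
    then have "y\<^sup>2 * (1 / 2 + real k)\<^sup>2 \<le> y\<^sup>2 * (x + real k)\<^sup>2" by (intro mult_left_mono) auto
    then show "(norm (Complex x y + of_nat k) * (1 / 2 + real k))\<^sup>2
        \<le> (norm (Complex (1 / 2) y + of_nat k) * (x + real k))\<^sup>2"
      unfolding power_mult_distrib cmod_power2 by (simp add: distrib_right distrib_left mult.commute)
  qed (use assms in auto)
  then have "(\<Prod>k<n. norm (Complex x y + of_nat k) * (1 / 2 + real k))
      \<le> (\<Prod>k<n. norm (Complex (1 / 2) y + of_nat k) * (x + real k))"
    by (intro prod_mono) (auto intro!: mult_nonneg_nonneg)
  then show ?thesis
    by (simp add: pochhammer_prod prod.distrib prod_norm atLeast0LessThan)
qed

text \<open>In the limit of \<open>rGamma_series\<close> the Pochhammer comparison says that |rGamma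
  (x + i y)| / rGamma x is at most its value at x = 1/2, known from reflection. The powers of n
  cancel because the real parts of the exponents sum to x + 1/2 on both sides.\<close>

lemma norm_rGamma_le:
  assumes "Re z \<ge> 1 / 2"
  shows "norm (rGamma z) \<le> exp (pi * \<bar>Im z\<bar> / 2) * rGamma (Re z)"
proof -
  define x y where "x = Re z" and "y = Im z"
  have z: "z = Complex x y" by (simp add: x_def y_def)
  have lim: "(\<lambda>n. norm (rGamma_series (Complex x y) n) * rGamma_series (1 / 2) n)
      \<longlonglongrightarrow> norm (rGamma (Complex x y)) * rGamma (1 / 2)"
    "(\<lambda>n. norm (rGamma_series (Complex (1 / 2) y) n) * rGamma_series x n)
      \<longlonglongrightarrow> norm (rGamma (Complex (1 / 2) y)) * rGamma x"
    by (intro tendsto_intros)+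
  have "norm (rGamma_series (Complex x y) n) * rGamma_series (1 / 2) n
      \<le> norm (rGamma_series (Complex (1 / 2) y) n) * rGamma_series x n" for n
  proof -
    have e: "norm (rGamma_series (Complex u y) n) * rGamma_series v n
        = norm (pochhammer (Complex u y) (n + 1)) * pochhammer v (n + 1)
          / ((fact n * fact n) * exp ((u + v) * ln (real n)))" for u v
      by (simp add: rGamma_series_def norm_divide norm_mult exp_add distrib_right)
    have "norm (pochhammer (Complex x y) (n + 1)) * pochhammer (1 / 2) (n + 1)
        / ((fact n * fact n) * exp ((x + 1 / 2) * ln (real n)))
      \<le> norm (pochhammer (Complex (1 / 2) y) (n + 1)) * pochhammer x (n + 1)
        / ((fact n * fact n) * exp ((x + 1 / 2) * ln (real n)))"
      using assms by (intro divide_right_mono norm_pochhammer_le_half) (auto simp: x_def)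
    then show ?thesis
      unfolding e by (simp add: add.commute)
  qed
  then have "norm (rGamma (Complex x y)) * rGamma (1 / 2) \<le> norm (rGamma (Complex (1 / 2) y)) * rGamma x"
    by (intro LIMSEQ_le[OF lim]) auto
  also have "\<dots> \<le> exp (pi * \<bar>y\<bar> / 2) * rGamma (1 / 2) * rGamma x"
    using assms by (intro mult_right_mono norm_rGamma_half)
      (auto simp: x_def rGamma_inverse_Gamma intro!: Gamma_real_nonneg)
  finally have "norm (rGamma z) * rGamma (1 / 2) \<le> (exp (pi * \<bar>y\<bar> / 2) * rGamma x) * rGamma (1 / 2)"
    by (simp add: z mult_ac)
  moreover have "rGamma (1 / 2) > (0 :: real)"
    by (simp add: rGamma_inverse_Gamma Gamma_one_half_real)
  ultimately show ?thesis by (simp add: x_def y_def)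
qed

text \<open>Only the part of the Gamma integral beyond A is kept. As A is free, Gamma outgrows every
  exponential, and this is where the free rate D in \<open>rGamma_bound\<close> comes from.\<close>

lemma Gamma_real_ge:
  assumes "A > 0" "x \<ge> (1 :: real)"
  shows "A powr (x - 1) * exp (- A) \<le> Gamma x"
proof -
  have "((\<lambda>t. A powr (x - 1) * exp (- 1 * t)) has_integral A powr (x - 1) * (exp (- 1 * A) / 1)) {A..}"
    by (intro has_integral_mult_right has_integral_exp_minus_to_infinity) simp
  then have "((\<lambda>t. if t \<in> {A..} then A powr (x - 1) * exp (- 1 * t) else 0)
      has_integral A powr (x - 1) * (exp (- 1 * A) / 1)) {0..}"
    using assms by (subst has_integral_restrict) auto
  moreover have "((\<lambda>t. t powr (x - 1) / exp t) has_integral Gamma x) {0..}"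
    using assms by (intro Gamma_integral_real) auto
  ultimately have "A powr (x - 1) * (exp (- 1 * A) / 1) \<le> Gamma x"
    by (rule has_integral_le)
       (use assms in \<open>auto simp: exp_minus inverse_eq_divide intro!: divide_right_mono powr_mono2\<close>)
  then show ?thesis by simp
qed

lemma power_le_fact_exp: "(t :: real) \<ge> 0 \<Longrightarrow> t ^ N \<le> fact N * exp t"
proof -
  assume t: "t \<ge> 0"
  have "(\<Sum>n\<in>{N}. t ^ n /\<^sub>R fact n) \<le> (\<Sum>n. t ^ n /\<^sub>R fact n)"
    using t by (intro sum_le_suminf summable_exp_generic) auto
  then show ?thesis by (simp add: exp_def field_simps)
qed

lemma norm_pochhammer_le: "norm (pochhammer (z :: complex) n) \<le> (norm z + real n) ^ n"
proof -
  have "norm (pochhammer z n) = (\<Prod>k<n. norm (z + of_nat k))"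
    by (simp add: pochhammer_prod prod_norm atLeast0LessThan)
  also have "\<dots> \<le> (\<Prod>k<n. norm z + real n)"
    by (intro prod_mono) (auto intro!: order_trans[OF norm_triangle_ineq])
  finally show ?thesis by simp
qed

text \<open>
  The constant 2 could be any number above \<open>pi / 2\<close>; three such factors must lose against
  \<open>exp (- 2 * pi * \<bar>Im z\<bar>)\<close>, so it has to be below \<open>2 * pi / 3\<close>.
\<close>

lemma rGamma_bound:
  fixes D r :: real
  obtains C where "C > 0" "\<And>z. Re z \<ge> - r \<Longrightarrow> norm (rGamma z) \<le> C * exp (- D * Re z + 2 * \<bar>Im z\<bar>)"
proof -
  define N where "N = nat \<lceil>\<bar>r\<bar> + 1\<rceil>"
  have N: "real N \<ge> \<bar>r\<bar> + 1" unfolding N_def by linarith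
  \<comment> \<open>The room between exp (pi |y| / 2) and exp (2 |y|); the dependence on |y| of the
    Pochhammer factor that comes from shifting z by N is absorbed here.\<close>
  define e :: real where "e = 2 - pi / 2"
  have e: "0 < e" "e \<le> 1" unfolding e_def using pi_less_4 pi_gt3 by auto
  \<comment> \<open>One more than D: the surplus exp (-x) cancels the factor exp x that the estimate
    of the Pochhammer factor costs.\<close>
  define A where "A = exp (D + 1)"
  define C1 where "C1 = fact N * (1 / e) ^ N * exp (2 * real N)"
  define C where "C = C1 * (exp A * exp (- (D + 1) * (real N - 1))) * exp (2 * \<bar>r\<bar>)"
  have "C > 0" unfolding C_def C1_def using e by simp
  moreover have "norm (rGamma z) \<le> C * exp (- D * Re z + 2 * \<bar>Im z\<bar>)" if z: "Re z \<ge> - r" for z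
  proof -
    define x y where "x = Re z" and "y = Im z"
    have zn: "norm z + real N \<le> x + \<bar>y\<bar> + 2 * \<bar>r\<bar> + real N"
      using cmod_le[of z] z by (simp add: x_def y_def)
    have n0: "0 \<le> norm z + real N" by simp
    have "norm (pochhammer z N) \<le> (norm z + real N) ^ N" by (rule norm_pochhammer_le)
    also have "\<dots> = (1 / e) ^ N * (e * (norm z + real N)) ^ N"
      using e by (simp add: power_mult_distrib power_divide)
    also have "\<dots> \<le> (1 / e) ^ N * (fact N * exp (e * (norm z + real N)))"
      using e by (intro mult_left_mono power_le_fact_exp) auto
    also have "\<dots> \<le> (1 / e) ^ N * (fact N * exp (x + e * \<bar>y\<bar> + 2 * \<bar>r\<bar> + 2 * real N))"
    proof -
      have "e * (norm z + real N) \<le> e * (x + \<bar>y\<bar> + 2 * \<bar>r\<bar> + real N)"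
        using e zn by (intro mult_left_mono) auto
      also have "\<dots> = e * (x + 2 * \<bar>r\<bar> + real N) + e * \<bar>y\<bar>" by (simp add: algebra_simps)
      also have "e * (x + 2 * \<bar>r\<bar> + real N) \<le> 1 * (x + 2 * \<bar>r\<bar> + real N)"
        using e z by (intro mult_right_mono) (auto simp: x_def)
      finally show ?thesis using e by (intro mult_left_mono) auto
    qed
    also have "\<dots> = C1 * exp (2 * \<bar>r\<bar>) * exp (x + e * \<bar>y\<bar>)"
      by (simp add: C1_def exp_add mult_ac)
    finally have p: "norm (pochhammer z N) \<le> C1 * exp (2 * \<bar>r\<bar>) * exp (x + e * \<bar>y\<bar>)" .
    have xN: "x + real N \<ge> 1" using z N by (auto simp: x_def)
    have "A powr (x + real N - 1) * exp (- A) \<le> Gamma (x + real N)"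
      using xN by (intro Gamma_real_ge) (auto simp: A_def)
    then have "inverse (Gamma (x + real N)) \<le> inverse (A powr (x + real N - 1) * exp (- A))"
      by (rule le_imp_inverse_le) (auto simp: A_def)
    also have "\<dots> = exp A * exp (- (D + 1) * (real N - 1)) * exp (- (D + 1) * x)"
      by (simp add: A_def powr_def exp_minus[symmetric] mult_exp_exp algebra_simps)
    finally have g: "rGamma (x + real N) \<le> exp A * exp (- (D + 1) * (real N - 1)) * exp (- (D + 1) * x)"
      by (simp add: rGamma_inverse_Gamma)
    have g0: "rGamma (x + real N) \<ge> 0" using xN by (simp add: rGamma_inverse_Gamma Gamma_real_nonneg)
    have "norm (rGamma z) = norm (pochhammer z N) * norm (rGamma (z + of_nat N))"
      by (metis pochhammer_rGamma norm_mult)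
    also have "norm (rGamma (z + of_nat N)) \<le> exp (pi * \<bar>y\<bar> / 2) * rGamma (x + real N)"
      using norm_rGamma_le[of "z + of_nat N"] xN by (simp add: x_def y_def)
    also have "\<dots> \<le> exp (pi * \<bar>y\<bar> / 2) * (exp A * exp (- (D + 1) * (real N - 1)) * exp (- (D + 1) * x))"
      by (intro mult_left_mono g) auto
    also have "norm (pochhammer z N) * \<dots> \<le> (C1 * exp (2 * \<bar>r\<bar>) * exp (x + e * \<bar>y\<bar>)) * \<dots>"
      by (intro mult_right_mono p) auto
    also have "\<dots> = C * (exp (x + e * \<bar>y\<bar>) * exp (pi * \<bar>y\<bar> / 2) * exp (- (D + 1) * x))"
      by (simp add: C_def mult_ac)
    also have "exp (x + e * \<bar>y\<bar>) * exp (pi * \<bar>y\<bar> / 2) * exp (- (D + 1) * x) = exp (- D * x + 2 * \<bar>y\<bar>)"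
      unfolding mult_exp_exp by (rule arg_cong[where f = exp]) (simp add: e_def algebra_simps)
    finally show ?thesis by (simp add: x_def y_def mult_left_mono)
  qed
  ultimately show thesis by (rule that)
qed

section \<open>Lower bounds for the sine, and Gamma by reflection\<close>

lemma norm_sin_ge_sinh: "norm (sin z) \<ge> (exp \<bar>Im z\<bar> - exp (- \<bar>Im z\<bar>)) / 2"
proof (rule power2_le_imp_le)
  have "((exp \<bar>Im z\<bar> - exp (- \<bar>Im z\<bar>)) / 2)\<^sup>2 = (exp (2 * Im z) + inverse (exp (2 * Im z)) - 2) / 4"
  proof -
    have "((exp t - exp (- t)) / 2)\<^sup>2 = (exp (2 * t) + inverse (exp (2 * t)) - 2) / 4" for t :: real
      unfolding exp_double exp_minus by (simp add: field_simps power2_eq_square)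
    from this[of "\<bar>Im z\<bar>"] show ?thesis
      by (cases "Im z \<ge> 0") (simp_all add: exp_minus)
  qed
  also have "\<dots> \<le> (norm (sin z))\<^sup>2"
    unfolding norm_sin_squared using cos_le_one[of "2 * Re z"] by (intro divide_right_mono) auto
  finally show "((exp \<bar>Im z\<bar> - exp (- \<bar>Im z\<bar>)) / 2)\<^sup>2 \<le> (norm (sin z))\<^sup>2" .
qed simp

lemma norm_sin_pi_ge:
  assumes "\<bar>Im z\<bar> \<ge> 1"
  shows "norm (sin (of_real pi * z)) \<ge> exp (pi * \<bar>Im z\<bar>) / 4"
proof -
  define t where "t = pi * \<bar>Im z\<bar>"
  have "t \<ge> 1 * 1" unfolding t_def using assms pi_gt3 by (intro mult_mono) auto
  then have t: "exp t \<ge> 2" using exp_ge_add_one_self[of t] by linarith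
  have "exp (- t) \<le> exp t / 2"
  proof -
    have "exp (- t) \<le> 1" using \<open>t \<ge> 1 * 1\<close> by simp
    then show ?thesis using t by linarith
  qed
  then show ?thesis
    using norm_sin_ge_sinh[of "of_real pi * z"] by (simp add: t_def abs_mult)
qed

text \<open>Midway between two poles of Gamma, |sin (pi z)| equals cosh (pi Im z). The left side of
  the closed contour will be placed there.\<close>

lemma norm_sin_pi_half_int:
  assumes "Re z = - (real N + 1 / 2)"
  shows "norm (sin (of_real pi * z)) \<ge> 1"
proof (rule power2_le_imp_le)
  have "cos (2 * (pi * Re z)) = - 1"
  proof -
    have "cos (2 * (pi * Re z)) = cos (pi + real N * (2 * pi))"
      unfolding assms by (subst cos_minus[symmetric]) (simp add: algebra_simps)
    also have "\<dots> = - 1"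
      using cos_2npi[of N] sin_2npi[of N] by (simp add: cos_add mult_ac)
    finally show ?thesis .
  qed
  moreover have "exp s + inverse (exp s) \<ge> (2 :: real)" for s
    by (smt (verit) exp_minus exp_ge_add_one_self)
  ultimately show "1\<^sup>2 \<le> (norm (sin (of_real pi * z)))\<^sup>2"
    unfolding norm_sin_squared by simp
qed simp

lemma Gamma_reflect:
  assumes "sin (of_real pi * z) \<noteq> (0 :: complex)"
  shows "Gamma z = of_real pi / sin (of_real pi * z) * rGamma (1 - z)"
proof -
  have *: "Gamma z * Gamma (1 - z) = of_real pi / sin (of_real pi * z)"
    by (rule Gamma_reflection_complex)
  then have "Gamma (1 - z) \<noteq> 0" using assms by auto
  then show ?thesis
    by (simp flip: * add: rGamma_inverse_Gamma)
qed

text \<open>Reflection maps the left half-plane to a right one, so the free rate of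
  \<open>rGamma_bound\<close> becomes arbitrarily fast decay of Gamma to the left. Away from the
  real axis 1 / sin contributes exp (-pi |Im z|), which leaves the rate pi - 2; close to the axis
  the condition on the sine keeps z away from the poles.\<close>

lemma Gamma_bound:
  fixes D r :: real
  obtains C where "C > 0"
    "\<And>z. Re z \<le> r \<Longrightarrow> \<bar>Im z\<bar> \<ge> 1 \<Longrightarrow> norm (Gamma z) \<le> C * exp (D * Re z - (pi - 2) * \<bar>Im z\<bar>)"
    "\<And>z. Re z \<le> r \<Longrightarrow> norm (sin (of_real pi * z)) \<ge> 1 \<Longrightarrow> norm (Gamma z) \<le> C * exp (D * Re z + 2 * \<bar>Im z\<bar>)"
proof -
  obtain C where C: "C > 0" "\<And>z. Re z \<ge> - (r - 1) \<Longrightarrow> norm (rGamma z) \<le> C * exp (- D * Re z + 2 * \<bar>Im z\<bar>)"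
    by (rule rGamma_bound) blast
  define C' where "C' = 4 * pi * C * exp (- D)"
  have rG: "norm (rGamma (1 - z)) \<le> C * exp (- D) * exp (D * Re z + 2 * \<bar>Im z\<bar>)" if "Re z \<le> r" for z
    using C(2)[of "1 - z"] that by (simp add: mult.assoc mult_exp_exp algebra_simps)
  show thesis
  proof
    show "C' > 0" using C by (simp add: C'_def)
  next
    fix z assume z: "Re z \<le> r" "\<bar>Im z\<bar> \<ge> 1"
    have s: "norm (sin (of_real pi * z)) \<ge> exp (pi * \<bar>Im z\<bar>) / 4" using z by (intro norm_sin_pi_ge)
    then have "sin (of_real pi * z) \<noteq> 0" by (smt (verit) exp_gt_zero norm_zero divide_pos_pos)
    then have "norm (Gamma z) = pi / norm (sin (of_real pi * z)) * norm (rGamma (1 - z))"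
      by (simp add: Gamma_reflect norm_mult norm_divide)
    also have "\<dots> \<le> pi / (exp (pi * \<bar>Im z\<bar>) / 4) * (C * exp (- D) * exp (D * Re z + 2 * \<bar>Im z\<bar>))"
      using s z by (intro mult_mono rG divide_left_mono mult_pos_pos) 
        (auto intro: less_le_trans[rotated])
    also have "\<dots> = C' * (exp (D * Re z + 2 * \<bar>Im z\<bar>) / exp (pi * \<bar>Im z\<bar>))"
      by (simp add: C'_def)
    also have "exp (D * Re z + 2 * \<bar>Im z\<bar>) / exp (pi * \<bar>Im z\<bar>) = exp (D * Re z - (pi - 2) * \<bar>Im z\<bar>)"
      by (simp flip: exp_diff add: algebra_simps)
    finally show "norm (Gamma z) \<le> C' * exp (D * Re z - (pi - 2) * \<bar>Im z\<bar>)" .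
  next
    fix z assume z: "Re z \<le> r" "norm (sin (of_real pi * z)) \<ge> 1"
    then have "sin (of_real pi * z) \<noteq> 0" by auto
    then have "norm (Gamma z) = pi / norm (sin (of_real pi * z)) * norm (rGamma (1 - z))"
      by (simp add: Gamma_reflect norm_mult norm_divide)
    also have "\<dots> \<le> pi / 1 * (C * exp (- D) * exp (D * Re z + 2 * \<bar>Im z\<bar>))"
      using z by (intro mult_mono rG divide_left_mono) auto
    \<comment> \<open>The factor 4 is given away so that both estimates share one constant.\<close>
    also have "\<dots> \<le> 4 * (pi / 1 * (C * exp (- D) * exp (D * Re z + 2 * \<bar>Im z\<bar>)))"
    proof -
      have "0 \<le> pi / 1 * (C * exp (- D) * exp (D * Re z + 2 * \<bar>Im z\<bar>))" using C by simp
      then show ?thesis by linarith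
    qed
    finally show "norm (Gamma z) \<le> C' * exp (D * Re z + 2 * \<bar>Im z\<bar>)"
      by (simp add: C'_def mult_ac)
  qed
qed

subsection \<open>Integrals over truncated loops\<close>

text \<open>The plane cut along the ray from c to minus infinity. The poles lie on the cut, the
  loops and vertical lines in use avoid it, and being star-shaped about c + 1 it admits
  primitives.\<close>

definition slit :: "real \<Rightarrow> complex set" where
  "slit c = {z. Im z \<noteq> 0 \<or> Re z > c}"

lemma open_slit: "open (slit c)"
proof -
  have "open ({z. Im z < 0} \<union> {z. Im z > 0} \<union> {z. Re z > c})"
    by (intro open_Un open_halfspace_Im_lt open_halfspace_Im_gt open_halfspace_Re_gt)
  moreover have "{z. Im z < 0} \<union> {z. Im z > 0} \<union> {z. Re z > c} = slit c" by (auto simp: slit_def)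
  ultimately show ?thesis by simp
qed

lemma starlike_slit: "starlike (slit c)"
  unfolding starlike_def
proof (intro bexI ballI subsetI)
  show "of_real (c + 1) \<in> slit c" by (simp add: slit_def)
  fix z w assume z: "z \<in> slit c" and "w \<in> closed_segment (of_real (c + 1)) z"
  then obtain u where u: "0 \<le> u" "u \<le> 1" "w = (1 - u) *\<^sub>R of_real (c + 1) + u *\<^sub>R z"
    by (auto simp: closed_segment_def)
  have im: "Im w = u * Im z" and re: "Re w - c = (1 - u) + u * (Re z - c)"
    by (simp_all add: u(3) algebra_simps)
  show "w \<in> slit c"
  proof (cases "Im w = 0")
    case True
    then have "u = 0 \<or> Re z > c" using im z by (auto simp: slit_def)
    then have "Re w - c > 0"
    proof
      assume "Re z > c"
      then show ?thesis unfolding re using u(1,2)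
        by (cases "u = 1") (auto intro: add_pos_nonneg)
    qed (simp add: re)
    then show ?thesis by (simp add: slit_def)
  qed (simp add: slit_def)
qed

text \<open>
  With a primitive, integrals over the loop and over the line depend on the end points only, and
  deforming one into the other amounts to comparing values of the primitive near infinity.
\<close>

lemma slit_primitive:
  assumes "f holomorphic_on slit c"
  obtains F where "\<And>z. z \<in> slit c \<Longrightarrow> (F has_field_derivative f z) (at z)"
proof -
  have "\<exists>F. \<forall>z\<in>slit c. (F has_field_derivative f z) (at z)"
    by (rule holomorphic_starlike_primitive[where k = "{}"])
       (use assms in \<open>auto simp: open_slit starlike_slit holomorphic_on_imp_continuous_on
          holomorphic_on_imp_differentiable_at\<close>)
  then show thesis using that by blast
qed

lemma valid_path_truncated_loop [simp]: "valid_path (truncated_loop r R)"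
  by (simp add: truncated_loop_def valid_path_join)

lemma closed_segment_Complex:
  "z \<in> closed_segment (Complex a y) (Complex b y) \<Longrightarrow> Im z = y \<and> Re z \<in> closed_segment a b"
  "z \<in> closed_segment (Complex x a) (Complex x b) \<Longrightarrow> Re z = x \<and> Im z \<in> closed_segment a b"
  unfolding closed_segment_def by (force simp: left_diff_distrib)+

lemma path_image_truncated_loop:
  "path_image (truncated_loop r R) \<subseteq> {z. Im z = r \<or> Im z = - r \<or> Re z = r}"
  unfolding truncated_loop_def
  by (auto simp: path_image_join dest!: closed_segment_Complex)

lemma truncated_loop_integral:
  assumes "\<And>z. z \<in> slit c \<Longrightarrow> (F has_field_derivative f z) (at z)" "r > 0" "r > c"
  shows "contour_integral (truncated_loop r R) f = F (Complex (- R) r) - F (Complex (- R) (- r))"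
proof -
  have "path_image (truncated_loop r R) \<subseteq> slit c"
    using path_image_truncated_loop[of r R] assms(2,3) by (force simp: slit_def)
  then have "(f has_contour_integral F (pathfinish (truncated_loop r R)) - F (pathstart (truncated_loop r R)))
      (truncated_loop r R)"
    by (intro contour_integral_primitive[where S = "slit c"])
       (auto intro: has_field_derivative_at_within assms(1))
  then show ?thesis
    by (simp add: contour_integral_unique truncated_loop_def)
qed

lemma integrable_exp_abs: "e > 0 \<Longrightarrow> integrable lborel (\<lambda>t :: real. exp (- e * \<bar>t\<bar>))"
proof -
  assume e: "e > 0"
  have 1: "set_integrable lborel {0..} (\<lambda>t. exp (- e * t))"
  proof -
    have "(\<lambda>t. exp (- e * t)) absolutely_integrable_on {0..}"
      using has_integral_exp_minus_to_infinity[OF e, of 0]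
      by (intro nonnegative_absolutely_integrable_1) (auto simp: integrable_on_def)
    then show ?thesis unfolding set_integrable_def by (subst (asm) integrable_completion) auto
  qed
  have 2: "integrable lborel (\<lambda>t. indicator {0..} t *\<^sub>R exp (- e * t) + indicator {0..} (- t) *\<^sub>R exp (- e * (- t)))"
    using 1 lborel_integrable_real_affine[OF 1[unfolded set_integrable_def], of "-1" 0]
    by (intro Bochner_Integration.integrable_add) (auto simp: set_integrable_def)
  show ?thesis
    by (rule Bochner_Integration.integrable_bound[OF 2]) (auto simp: indicator_def)
qed

lemma continuous_on_vertical_line:
  assumes "f holomorphic_on slit c" "c < \<sigma>"
  shows "continuous_on A (\<lambda>t. f (Complex \<sigma> t))"
proof -
  have "continuous_on (slit c) f" using assms(1) by (rule holomorphic_on_imp_continuous_on)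
  moreover have "continuous_on A (\<lambda>t. Complex \<sigma> t)"
    unfolding Complex_eq by (intro continuous_intros)
  ultimately show ?thesis
    by (rule continuous_on_compose2) (use assms(2) in \<open>auto simp: slit_def\<close>)
qed

lemma integrable_vertical_line:
  assumes hol: "f holomorphic_on slit c" and c: "c < \<sigma>" and e: "e > 0"
    and bound: "\<And>t. \<bar>t\<bar> \<ge> 1 \<Longrightarrow> norm (f (Complex \<sigma> t)) \<le> C * exp (- e * \<bar>t\<bar>)"
  shows "integrable lborel (\<lambda>t. f (Complex \<sigma> t))"
proof -
  have "bounded ((\<lambda>t. f (Complex \<sigma> t)) ` {-1..1})"
    by (intro compact_imp_bounded compact_continuous_image continuous_on_vertical_line[OF hol c]) auto
  then obtain B where B: "\<And>t. \<bar>t\<bar> \<le> 1 \<Longrightarrow> norm (f (Complex \<sigma> t)) \<le> B"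
    unfolding bounded_iff by (force simp: abs_le_iff)
  define M where "M = \<bar>C\<bar> + \<bar>B\<bar> * exp e"
  have le: "norm (f (Complex \<sigma> t)) \<le> M * exp (- e * \<bar>t\<bar>)" for t
  proof (cases "\<bar>t\<bar> \<ge> 1")
    case True
    have "C * exp (- e * \<bar>t\<bar>) \<le> M * exp (- e * \<bar>t\<bar>)"
      by (intro mult_right_mono) (auto simp: M_def intro: order_trans[OF abs_ge_self])
    then show ?thesis using bound[OF True] by linarith
  next
    case False
    have "1 \<le> exp (e * (1 - \<bar>t\<bar>))" using False e by simp
    then have "\<bar>B\<bar> * 1 \<le> \<bar>B\<bar> * exp (e * (1 - \<bar>t\<bar>))" by (intro mult_left_mono) auto
    also have "\<dots> = (\<bar>B\<bar> * exp e) * exp (- e * \<bar>t\<bar>)"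
      by (simp add: mult.assoc mult_exp_exp algebra_simps)
    also have "\<dots> \<le> M * exp (- e * \<bar>t\<bar>)" by (intro mult_right_mono) (auto simp: M_def)
    finally show ?thesis using B[of t] False by simp
  qed
  show ?thesis
  proof (rule Bochner_Integration.integrable_bound[OF integrable_mult_right[OF integrable_exp_abs[OF e], of M]])
    show "(\<lambda>t. f (Complex \<sigma> t)) \<in> borel_measurable lborel"
      using continuous_on_vertical_line[OF hol c, of UNIV] by (simp add: borel_measurable_continuous_onI)
    show "AE t in lborel. norm (f (Complex \<sigma> t)) \<le> norm (M * exp (- e * \<bar>t\<bar>))"
      using le by (intro AE_I2) (auto intro: order_trans[OF _ abs_ge_self])
  qed
qed

lemma vertical_line_integral_limit:
  assumes F: "\<And>z. z \<in> slit c \<Longrightarrow> (F has_field_derivative f z) (at z)" and c: "c < \<sigma>"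
    and int: "integrable lborel (\<lambda>t. f (Complex \<sigma> t))"
  shows "((\<lambda>R. F (Complex \<sigma> R) - F (Complex \<sigma> (- R))) \<longlongrightarrow> \<i> * (LBINT t. f (Complex \<sigma> t))) at_top"
proof -
  have FT: "\<i> * (LBINT t:{-R..R}. f (Complex \<sigma> t)) = F (Complex \<sigma> R) - F (Complex \<sigma> (- R))" if "R \<ge> 0" for R
  proof -
    have "((\<lambda>t. F (Complex \<sigma> t)) has_vector_derivative \<i> * f (Complex \<sigma> t)) (at t within {-R..R})" for t
    proof -
      have "((\<lambda>t. Complex \<sigma> t) has_vector_derivative \<i>) (at t within {-R..R})"
        unfolding Complex_eq by (auto intro!: derivative_eq_intros)
      moreover have "(F has_field_derivative f (Complex \<sigma> t)) (at (Complex \<sigma> t))"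
        by (rule F) (use c in \<open>simp add: slit_def\<close>)
      ultimately have "((F \<circ> (\<lambda>t. Complex \<sigma> t)) has_vector_derivative \<i> * f (Complex \<sigma> t)) (at t within {-R..R})"
        by (rule field_vector_diff_chain_within[OF _ has_field_derivative_at_within])
      then show ?thesis by (simp add: o_def)
    qed
    then have "((\<lambda>t. \<i> * f (Complex \<sigma> t)) has_integral F (Complex \<sigma> R) - F (Complex \<sigma> (- R))) {-R..R}"
      using that by (intro fundamental_theorem_of_calculus) auto
    moreover have "set_integrable lborel {-R..R} (\<lambda>t. \<i> * f (Complex \<sigma> t))"
      using int by (intro set_integrable_mult_right) (auto simp: set_integrable_def intro!: integrable_mult_indicator)
    ultimately have "(LBINT t:{-R..R}. \<i> * f (Complex \<sigma> t)) = F (Complex \<sigma> R) - F (Complex \<sigma> (- R))"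
      by (simp only: set_borel_integral_eq_integral(2) integral_unique)
    then show ?thesis by simp
  qed
  have "((\<lambda>R. LBINT t:{-R..R}. f (Complex \<sigma> t)) \<longlongrightarrow> (LBINT t. f (Complex \<sigma> t))) at_top"
    unfolding set_lebesgue_integral_def
  proof (rule integral_dominated_convergence_at_top[where w = "\<lambda>t. norm (f (Complex \<sigma> t))"])
    show "AE t in lborel. ((\<lambda>R. indicat_real {-R..R} t *\<^sub>R f (Complex \<sigma> t)) \<longlongrightarrow> f (Complex \<sigma> t)) at_top"
    proof (intro AE_I2 tendsto_eventually)
      fix t :: real
      show "\<forall>\<^sub>F R in at_top. indicat_real {-R..R} t *\<^sub>R f (Complex \<sigma> t) = f (Complex \<sigma> t)"
        using eventually_ge_at_top[of "\<bar>t\<bar>"] by eventually_elim (auto simp: indicator_def)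
    qed
  qed (use int in \<open>auto simp: indicator_def intro!: always_eventually borel_measurable_scaleR\<close>)
  then have "((\<lambda>R. \<i> * (LBINT t:{-R..R}. f (Complex \<sigma> t))) \<longlongrightarrow> \<i> * (LBINT t. f (Complex \<sigma> t))) at_top"
    by (intro tendsto_intros)
  then show ?thesis
    by (rule Lim_transform_eventually)
       (use eventually_ge_at_top[of 0] in \<open>eventually_elim, simp add: FT\<close>)
qed

lemma segment_bound:
  assumes "\<And>z. z \<in> slit c \<Longrightarrow> (F has_field_derivative f z) (at z)"
    and "closed_segment a b \<subseteq> slit c" "\<And>z. z \<in> closed_segment a b \<Longrightarrow> norm (f z) \<le> B"
  shows "norm (F a - F b) \<le> B * norm (a - b)"
  by (rule field_differentiable_bound[of "closed_segment a b"])
     (use assms in \<open>auto intro: has_field_derivative_at_within\<close>)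

text \<open>In terms of the primitive, the end points -R + i r and -R - i r of the loop have to be
  compared with those of the line, \<sigma> + i R and \<sigma> - i R. Each pair is joined by a
  vertical segment of length at most R, where f is O(exp (-R)), and a horizontal one at height R,
  where f is O(exp (-e R)).\<close>

lemma loop_integral_eq_vertical_line:
  assumes hol: "f holomorphic_on slit c" and c: "c < \<sigma>" "\<sigma> \<le> r" "r \<ge> 1" and e: "e > 0"
    and bound: "\<And>z. Re z \<le> r \<Longrightarrow> \<bar>Im z\<bar> \<ge> 1 \<Longrightarrow> norm (f z) \<le> C * exp (Re z - e * \<bar>Im z\<bar>)"
  shows "integrable lborel (\<lambda>t. f (Complex \<sigma> t))"
    and "((\<lambda>R. contour_integral (truncated_loop r R) f) \<longlongrightarrow> \<i> * (LBINT t. f (Complex \<sigma> t))) at_top"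
proof -
  obtain F where F: "\<And>z. z \<in> slit c \<Longrightarrow> (F has_field_derivative f z) (at z)"
    using slit_primitive[OF hol] by blast
  show int: "integrable lborel (\<lambda>t. f (Complex \<sigma> t))"
  proof (rule integrable_vertical_line[OF hol c(1) e, where C = "C * exp \<sigma>"])
    fix t :: real assume "\<bar>t\<bar> \<ge> 1"
    then show "norm (f (Complex \<sigma> t)) \<le> C * exp \<sigma> * exp (- e * \<bar>t\<bar>)"
      using bound[of "Complex \<sigma> t"] c by (simp add: mult.assoc mult_exp_exp)
  qed
  have C0: "C \<ge> 0"
    using bound[of "Complex 0 1"] c by (smt (verit) complex.sel exp_gt_zero norm_ge_zero zero_le_mult_iff)
  define E where "E = (\<lambda>R :: real. C * exp (- R) * R + C * exp (r - e * R) * (R + \<bar>\<sigma>\<bar>))"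
  have E: "(E \<longlongrightarrow> 0) at_top"
  proof -
    define A where "A = \<bar>\<sigma>\<bar>"
    have "((\<lambda>R. exp (- R) * R) \<longlongrightarrow> (0 :: real)) at_top" by real_asymp
    moreover have "((\<lambda>R. exp (r - e * R) * (R + A)) \<longlongrightarrow> 0) at_top" using e by real_asymp
    ultimately have "((\<lambda>R. C * (exp (- R) * R) + C * (exp (r - e * R) * (R + A))) \<longlongrightarrow> C * 0 + C * 0) at_top"
      by (intro tendsto_intros)
    then show ?thesis by (simp add: E_def A_def mult.assoc)
  qed
  \<comment> \<open>The sign s selects the half-plane; the two summands of \<open>E R\<close> belong
    to the vertical and to the horizontal segment.\<close>
  have quarter: "norm (F (Complex (- R) (s * r)) - F (Complex \<sigma> (s * R))) \<le> E R"
    if R: "R \<ge> r" and s: "s = 1 \<or> s = - 1" for R s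
  proof -
    have "norm (F (Complex (- R) (s * r)) - F (Complex (- R) (s * R)))
        \<le> (C * exp (- R)) * norm (Complex (- R) (s * r) - Complex (- R) (s * R))"
    proof (rule segment_bound[of c F f, OF F])
      have *: "Re z = - R \<and> \<bar>Im z\<bar> \<ge> r" if "z \<in> closed_segment (Complex (- R) (s * r)) (Complex (- R) (s * R))" for z
        using closed_segment_Complex(2)[OF that] s R c by (auto simp: closed_segment_eq_real_ivl split: if_splits)
      then show "closed_segment (Complex (- R) (s * r)) (Complex (- R) (s * R)) \<subseteq> slit c"
        using c by (force simp: slit_def)
      fix z assume z: "z \<in> closed_segment (Complex (- R) (s * r)) (Complex (- R) (s * R))"
      have "norm (f z) \<le> C * exp (Re z - e * \<bar>Im z\<bar>)" using *[OF z] c R by (intro bound) auto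
      also have "\<dots> \<le> C * exp (- R)" using *[OF z] C0 e by (intro mult_left_mono) auto
      finally show "norm (f z) \<le> C * exp (- R)" .
    qed auto
    also have "norm (Complex (- R) (s * r) - Complex (- R) (s * R)) \<le> R"
      using s R c by (auto simp: cmod_def)
    finally have 1: "norm (F (Complex (- R) (s * r)) - F (Complex (- R) (s * R))) \<le> C * exp (- R) * R"
      using C0 by (simp add: mult_left_mono)
    have "norm (F (Complex (- R) (s * R)) - F (Complex \<sigma> (s * R)))
        \<le> (C * exp (r - e * R)) * norm (Complex (- R) (s * R) - Complex \<sigma> (s * R))"
    proof (rule segment_bound[of c F f, OF F])
      have *: "Re z \<le> r \<and> \<bar>Im z\<bar> = R" if "z \<in> closed_segment (Complex (- R) (s * R)) (Complex \<sigma> (s * R))" for z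
        using closed_segment_Complex(1)[OF that] s R c by (auto simp: closed_segment_eq_real_ivl split: if_splits)
      then show "closed_segment (Complex (- R) (s * R)) (Complex \<sigma> (s * R)) \<subseteq> slit c"
        using c R by (force simp: slit_def)
      fix z assume z: "z \<in> closed_segment (Complex (- R) (s * R)) (Complex \<sigma> (s * R))"
      have "norm (f z) \<le> C * exp (Re z - e * \<bar>Im z\<bar>)" using *[OF z] c R by (intro bound) auto
      also have "\<dots> \<le> C * exp (r - e * R)" using *[OF z] C0 e by (intro mult_left_mono) auto
      finally show "norm (f z) \<le> C * exp (r - e * R)" .
    qed auto
    also have "norm (Complex (- R) (s * R) - Complex \<sigma> (s * R)) \<le> norm (- R - \<sigma>) + norm (s * R - s * R)"
      by (rule order_trans[OF cmod_le]) auto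
    also have "\<dots> \<le> R + \<bar>\<sigma>\<bar>" using R c by simp
    finally have 2: "norm (F (Complex (- R) (s * R)) - F (Complex \<sigma> (s * R))) \<le> C * exp (r - e * R) * (R + \<bar>\<sigma>\<bar>)"
      using C0 by (simp add: mult_left_mono)
    show ?thesis
      unfolding E_def by (rule norm_diff_triangle_le[OF 1 2])
  qed
  show "((\<lambda>R. contour_integral (truncated_loop r R) f) \<longlongrightarrow> \<i> * (LBINT t. f (Complex \<sigma> t))) at_top"
  proof (rule Lim_transform2[OF vertical_line_integral_limit[of c F f \<sigma>, OF F c(1) int]])
    have ev: "\<forall>\<^sub>F R in at_top. norm ((F (Complex \<sigma> R) - F (Complex \<sigma> (- R))) - contour_integral (truncated_loop r R) f) \<le> 2 * E R"
      using eventually_ge_at_top[of r]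
    proof eventually_elim
      case (elim R)
      have "(F (Complex \<sigma> R) - F (Complex \<sigma> (- R))) - contour_integral (truncated_loop r R) f
          = (F (Complex (- R) (- r)) - F (Complex \<sigma> (- R))) - (F (Complex (- R) r) - F (Complex \<sigma> R))"
        using truncated_loop_integral[of c F f r R, OF F] c by simp
      also have "norm \<dots> \<le> E R + E R"
        using quarter[OF elim, of 1] quarter[OF elim, of "-1"]
        by (intro order_trans[OF norm_triangle_ineq4]) auto
      finally show ?case by simp
    qed
    show "((\<lambda>R. (F (Complex \<sigma> R) - F (Complex \<sigma> (- R))) - contour_integral (truncated_loop r R) f) \<longlongrightarrow> 0) at_top"
      by (rule Lim_null_comparison[OF ev]) (use tendsto_mult_right_zero[OF E] in auto)
  qed
qed

section \<open>Loop integrals of Gamma times an entire function as residue series\<close>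

lemma Gamma_holomorphic_slit:
  assumes "c + a \<ge> 0"
  shows "(\<lambda>z. Gamma (of_real a + z)) holomorphic_on slit c"
proof (rule holomorphic_intros)
  show "(\<lambda>z. of_real a + z) holomorphic_on slit c" by (intro holomorphic_intros)
  fix z assume z: "z \<in> slit c"
  show "of_real a + z \<notin> \<int>\<^sub>\<le>\<^sub>0"
  proof
    assume "of_real a + z \<in> \<int>\<^sub>\<le>\<^sub>0"
    then obtain n where "of_real a + z = - of_nat n" by (auto elim!: nonpos_Ints_cases')
    then have "Im z = 0" "a + Re z = - real n" by (auto simp: complex_eq_iff)
    then show False using z assms by (auto simp: slit_def)
  qed
qed

lemma residue_Gamma_mult:
  assumes "E holomorphic_on UNIV"
  shows "residue (\<lambda>z. Gamma z * E z) (- of_nat n) = (- 1) ^ n / fact n * E (- of_nat n)"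
proof (rule residue_simple'[where s = "ball (- of_nat n) 1"])
  show "(\<lambda>z. Gamma z * E z) holomorphic_on ball (- of_nat n) 1 - {- of_nat n}"
  proof (intro holomorphic_on_mult holomorphic_Gamma equals0I)
    fix z :: complex assume "z \<in> (ball (- of_nat n) 1 - {- of_nat n}) \<inter> \<int>\<^sub>\<le>\<^sub>0"
    then have z: "z \<in> ball (- of_nat n) 1 - {- of_nat n}" "z \<in> \<int>\<^sub>\<le>\<^sub>0" by auto
    show False
    proof -
      from z(2) obtain m where m: "z = - of_nat m" by (auto elim!: nonpos_Ints_cases')
      have "dist z (- of_nat n) = norm (of_int (int n - int m) :: complex)"
        by (simp add: m dist_norm)
      also have "\<dots> = \<bar>real_of_int (int n - int m)\<bar>" by (rule norm_of_int)
      finally have "\<bar>real_of_int (int n - int m)\<bar> < 1" using z by (simp add: dist_commute)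
      then have "n = m" by linarith
      then show False using z m by simp
    qed
  qed (use assms in \<open>auto intro: holomorphic_on_subset\<close>)
  have "(E \<longlongrightarrow> E (- of_nat n)) (at (- of_nat n))"
    using assms by (metis UNIV_I continuous_on_eq_continuous_at holomorphic_on_imp_continuous_on isCont_def open_UNIV)
  then have "((\<lambda>z. Gamma z * (z + of_nat n) * E z) \<longlongrightarrow> (- 1) ^ n / fact n * E (- of_nat n)) (at (- of_nat n))"
    by (intro tendsto_mult Gamma_residues)
  then show "((\<lambda>z. Gamma z * E z * (z - - of_nat n)) \<longlongrightarrow> (- 1) ^ n / fact n * E (- of_nat n)) (at (- of_nat n))"
    by (simp add: mult_ac)
qed auto

lemma rectpath_Gamma_residues:
  fixes N :: nat
  assumes hol: "E holomorphic_on UNIV" and r: "r > 0"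
  defines "a \<equiv> Complex (- (real N + 1 / 2)) (- r)" and "b \<equiv> Complex r r"
  shows "contour_integral (rectpath a b) (\<lambda>z. Gamma z * E z)
    = 2 * of_real pi * \<i> * (\<Sum>n\<le>N. (- 1) ^ n / fact n * E (- of_nat n))"
proof -
  define pts where "pts = (\<lambda>n :: nat. - of_nat n :: complex) ` {..N}"
  \<comment> \<open>This half-plane excludes the pole -(N + 1), so \<open>pts\<close> contains all
    singularities in it.\<close>
  define S where "S = {z. Re z > - (real N + 1)}"
  have ab: "Re a \<le> Re b" "Im a \<le> Im b" using r by (simp_all add: a_def b_def)
  have sub: "cbox a b \<subseteq> S" by (auto simp: S_def a_def in_cbox_complex_iff)
  have pts_box: "p \<in> box a b" if p: "p \<in> pts" for p
  proof -
    from p obtain n where "n \<le> N" "p = - of_nat n" by (auto simp: pts_def)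
    then show ?thesis using r by (simp add: a_def b_def in_box_complex_iff)
  qed
  have "contour_integral (rectpath a b) (\<lambda>z. Gamma z * E z)
      = 2 * pi * \<i> * (\<Sum>p\<in>pts. winding_number (rectpath a b) p * residue (\<lambda>z. Gamma z * E z) p)"
  proof (rule Residue_theorem[where S = S])
    show "open S" unfolding S_def by (rule open_halfspace_Re_gt)
    show "connected S" unfolding S_def by (intro convex_connected convex_halfspace_Re_gt)
    show "finite pts" by (simp add: pts_def)
    show "path_image (rectpath a b) \<subseteq> S - pts"
    proof -
      have "path_image (rectpath a b) \<subseteq> S" using path_image_rectpath_subset_cbox[OF ab] sub by blast
      moreover have "path_image (rectpath a b) \<inter> box a b = {}"
        by (subst path_image_rectpath_cbox_minus_box[OF ab]) auto
      ultimately show ?thesis using pts_box by blast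
    qed
    show "\<forall>z. z \<notin> S \<longrightarrow> winding_number (rectpath a b) z = 0"
      using sub ab by (blast intro: winding_number_rectpath_outside)
    show "(\<lambda>z. Gamma z * E z) holomorphic_on S - pts"
    proof (intro holomorphic_on_mult holomorphic_Gamma equals0I)
      fix z assume "z \<in> (S - pts) \<inter> \<int>\<^sub>\<le>\<^sub>0"
      then have z: "z \<in> S - pts" and zi: "z \<in> \<int>\<^sub>\<le>\<^sub>0" by auto
      show False
      proof -
        from zi obtain m where m: "z = - of_nat m" by (auto elim!: nonpos_Ints_cases')
        with z have "m \<le> N" by (auto simp: S_def)
        then show False using z m by (auto simp: pts_def)
      qed
    qed (use hol in \<open>auto intro: holomorphic_on_subset\<close>)
  qed auto
  also have "(\<Sum>p\<in>pts. winding_number (rectpath a b) p * residue (\<lambda>z. Gamma z * E z) p)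
      = (\<Sum>p\<in>pts. residue (\<lambda>z. Gamma z * E z) p)"
    by (intro sum.cong refl) (simp add: winding_number_rectpath pts_box)
  also have "\<dots> = (\<Sum>n\<le>N. residue (\<lambda>z. Gamma z * E z) (- of_nat n))"
    unfolding pts_def by (subst sum.reindex) (auto simp: inj_on_def)
  finally show ?thesis by (simp add: residue_Gamma_mult[OF hol])
qed

text \<open>To the left Gamma decays faster than E can grow. The truncation R is replaced by the
  half-integer T = N + 1/2, where a vertical side with |sin (pi z)| >= 1 closes the loop to a
  rectangle. The rectangle gives a partial sum of the series, and all errors are O(exp
  (-R)).\<close>

lemma loop_integral_Gamma_residues:
  assumes hol: "E holomorphic_on UNIV" and r: "r \<ge> 1"
    and bound: "\<And>z. Re z \<le> r \<Longrightarrow> \<bar>Im z\<bar> \<le> r \<Longrightarrow> norm (E z) \<le> B * exp (b * \<bar>Re z\<bar>)"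
    and sums: "(\<lambda>n. (- 1) ^ n / fact n * E (- of_nat n)) sums s"
  shows "((\<lambda>R. contour_integral (truncated_loop r R) (\<lambda>z. Gamma z * E z)) \<longlongrightarrow> 2 * of_real pi * \<i> * s) at_top"
proof -
  define f where "f = (\<lambda>z. Gamma z * E z)"
  have holf: "f holomorphic_on slit 0"
    unfolding f_def using Gamma_holomorphic_slit[of 0 0] hol
    by (intro holomorphic_on_mult) (auto intro: holomorphic_on_subset)
  obtain F where F: "\<And>z. z \<in> slit 0 \<Longrightarrow> (F has_field_derivative f z) (at z)"
    using slit_primitive[OF holf] by blast
  obtain C where C: "C > 0"
    "\<And>z. Re z \<le> r \<Longrightarrow> norm (sin (of_real pi * z)) \<ge> 1 \<Longrightarrow> norm (Gamma z) \<le> C * exp ((1 + b) * Re z + 2 * \<bar>Im z\<bar>)"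
    using Gamma_bound[of r "1 + b"] by metis
  define M where "M = C * \<bar>B\<bar> * exp (2 * r)"
  \<comment> \<open>The rate 1 + b in the bound for Gamma defeats the growth exp (b |Re z|) of E and
    leaves exp (Re z), because |Re z| = - Re z here.\<close>
  have fb: "norm (f z) \<le> M * exp (Re z)"
    if z: "Re z \<le> 0" "\<bar>Im z\<bar> \<le> r" "norm (sin (of_real pi * z)) \<ge> 1" for z
  proof -
    have "norm (f z) = norm (Gamma z) * norm (E z)" by (simp add: f_def norm_mult)
    also have "\<dots> \<le> (C * exp ((1 + b) * Re z + 2 * r)) * (\<bar>B\<bar> * exp (b * \<bar>Re z\<bar>))"
    proof (intro mult_mono)
      have "norm (Gamma z) \<le> C * exp ((1 + b) * Re z + 2 * \<bar>Im z\<bar>)" using z r by (intro C(2)) auto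
      also have "\<dots> \<le> C * exp ((1 + b) * Re z + 2 * r)" using z C(1) by (intro mult_left_mono) auto
      finally show "norm (Gamma z) \<le> C * exp ((1 + b) * Re z + 2 * r)" .
      have "norm (E z) \<le> B * exp (b * \<bar>Re z\<bar>)" using z r by (intro bound) auto
      also have "\<dots> \<le> \<bar>B\<bar> * exp (b * \<bar>Re z\<bar>)" by (intro mult_right_mono) auto
      finally show "norm (E z) \<le> \<bar>B\<bar> * exp (b * \<bar>Re z\<bar>)" .
    qed (use C(1) in auto)
    also have "\<dots> = (C * \<bar>B\<bar>) * (exp ((1 + b) * Re z + 2 * r) * exp (b * \<bar>Re z\<bar>))" by (simp add: mult_ac)
    also have "exp ((1 + b) * Re z + 2 * r) * exp (b * \<bar>Re z\<bar>) = exp (2 * r) * exp (Re z)"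
      unfolding mult_exp_exp using z(1) by (intro arg_cong[where f = exp]) (simp add: algebra_simps)
    finally show ?thesis by (simp add: M_def mult_ac)
  qed
  have M0: "M \<ge> 0" using C by (simp add: M_def)
  have sin1: "norm (sin (of_real pi * z)) \<ge> 1" if "\<bar>Im z\<bar> = r" for z
  proof -
    have "pi * \<bar>Im z\<bar> \<ge> 3 * 1" using that r pi_gt3 by (intro mult_mono) auto
    then have "exp (pi * \<bar>Im z\<bar>) \<ge> 4" using exp_ge_add_one_self[of "pi * \<bar>Im z\<bar>"] by linarith
    then show ?thesis using norm_sin_pi_ge[of z] that r by linarith
  qed
  have close: "norm (contour_integral (truncated_loop r R) f
      - 2 * of_real pi * \<i> * (\<Sum>n\<le>nat \<lfloor>R\<rfloor>. (- 1) ^ n / fact n * E (- of_nat n))) \<le> (2 + 2 * r) * M * exp (1 - R)"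
    if R: "R \<ge> 1" for R
  proof -
    define N where "N = nat \<lfloor>R\<rfloor>"
    define T where "T = real N + 1 / 2"
    have N: "real N \<le> R" "R < real N + 1" unfolding N_def using R by linarith+
    \<comment> \<open>R and T differ by less than 1, and the whole segment between the two ends has
      real part at most 1 - R.\<close>
    have shift: "norm (F (Complex (- R) y) - F (Complex (- T) y)) \<le> M * exp (1 - R)" if y: "\<bar>y\<bar> = r" for y
    proof -
      have "norm (F (Complex (- R) y) - F (Complex (- T) y)) \<le> (M * exp (1 - R)) * norm (Complex (- R) y - Complex (- T) y)"
      proof (rule segment_bound[of 0 F f, OF F])
        have *: "Im z = y \<and> Re z \<le> 1 - R \<and> Re z \<le> 0" if "z \<in> closed_segment (Complex (- R) y) (Complex (- T) y)" for z
          using closed_segment_Complex(1)[OF that] N by (auto simp: closed_segment_eq_real_ivl T_def split: if_splits)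
        show "closed_segment (Complex (- R) y) (Complex (- T) y) \<subseteq> slit 0"
          using * y r by (force simp: slit_def)
        fix z assume "z \<in> closed_segment (Complex (- R) y) (Complex (- T) y)"
        note z = *[OF this]
        have "norm (f z) \<le> M * exp (Re z)" using z y by (intro fb sin1) auto
        also have "\<dots> \<le> M * exp (1 - R)" using z M0 by (intro mult_left_mono) auto
        finally show "norm (f z) \<le> M * exp (1 - R)" .
      qed auto
      also have "norm (Complex (- R) y - Complex (- T) y) \<le> 1"
        using N by (simp add: cmod_def T_def)
      finally show ?thesis using M0 by (simp add: mult_left_mono)
    qed
    define a where "a = Complex (- T) (- r)"
    define d where "d = Complex (- T) r"
    have left: "norm (contour_integral (linepath d a) f) \<le> M * exp (1 - R) * (2 * r)"
      and left_int: "f contour_integrable_on linepath d a"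
    proof -
      have *: "Re z = - T \<and> \<bar>Im z\<bar> \<le> r" if "z \<in> closed_segment d a" for z
        using closed_segment_Complex(2)[of z "- T" r "- r"] that r
        by (auto simp: closed_segment_eq_real_ivl d_def a_def split: if_splits)
      have half: "norm (sin (of_real pi * z)) \<ge> 1" if "Re z = - T" for z
        using that by (intro norm_sin_pi_half_int[of z N]) (simp add: T_def)
      have cont: "continuous_on (closed_segment d a) f"
        unfolding f_def
      proof (intro continuous_on_mult continuous_on_Gamma equals0I)
        fix z assume "z \<in> closed_segment d a \<inter> \<int>\<^sub>\<le>\<^sub>0"
        then have z: "z \<in> closed_segment d a" and zi: "z \<in> \<int>\<^sub>\<le>\<^sub>0" by auto
        show False
        proof -
          from zi obtain n where n: "z = - of_nat n" by (auto elim!: nonpos_Ints_cases')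
          have "sin (of_real pi * z) = - of_real (sin (real n * pi))"
            by (simp add: n sin_of_real[symmetric] mult.commute del: sin_npi sin_npi2)
          then show False using half[of z] *[OF z] by simp
        qed
      qed (use hol in \<open>auto intro: continuous_on_subset holomorphic_on_imp_continuous_on\<close>)
      show int: "f contour_integrable_on linepath d a"
        by (rule contour_integrable_continuous_linepath[OF cont])
      have "norm (contour_integral (linepath d a) f) \<le> (M * exp (1 - R)) * norm (a - d)"
      proof (rule contour_integral_bound_linepath[OF int])
        fix z assume z: "z \<in> closed_segment d a"
        have "norm (f z) \<le> M * exp (Re z)" using *[OF z] half by (intro fb) (auto simp: T_def)
        also have "\<dots> \<le> M * exp (1 - R)" using *[OF z] N M0 by (intro mult_left_mono) (auto simp: T_def)
        finally show "norm (f z) \<le> M * exp (1 - R)" .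
      qed (use M0 in auto)
      also have "a - d = (- (2 * r)) *\<^sub>R \<i>" by (simp add: a_def d_def complex_eq_iff)
      also have "norm \<dots> = 2 * r" using r by (simp only: norm_scaleR) simp
      finally show "norm (contour_integral (linepath d a) f) \<le> M * exp (1 - R) * (2 * r)" .
    qed
    have rect: "rectpath a (Complex r r) = linepath a (Complex r (- r)) +++ linepath (Complex r (- r)) (Complex r r)
        +++ linepath (Complex r r) d +++ linepath d a"
      by (simp add: rectpath_def a_def d_def Let_def)
    have loop: "truncated_loop r T = linepath a (Complex r (- r)) +++ linepath (Complex r (- r)) (Complex r r)
        +++ linepath (Complex r r) d"
      by (simp add: truncated_loop_def a_def d_def)
    have cint: "f contour_integrable_on linepath u v" if "closed_segment u v \<subseteq> slit 0" for u v
      using that holf by (intro contour_integrable_continuous_linepath)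
        (auto intro: continuous_on_subset holomorphic_on_imp_continuous_on)
    have "closed_segment a (Complex r (- r)) \<subseteq> slit 0" "closed_segment (Complex r (- r)) (Complex r r) \<subseteq> slit 0"
      "closed_segment (Complex r r) d \<subseteq> slit 0"
      using r by (auto simp: a_def d_def slit_def dest!: closed_segment_Complex)
    note ci = this[THEN cint] left_int
    have "contour_integral (rectpath a (Complex r r)) f
        = contour_integral (truncated_loop r T) f + contour_integral (linepath d a) f"
      unfolding rect loop using ci
      by (simp add: contour_integrable_joinI valid_path_join)
    moreover have "contour_integral (rectpath a (Complex r r)) f
        = 2 * of_real pi * \<i> * (\<Sum>n\<le>N. (- 1) ^ n / fact n * E (- of_nat n))"
      using rectpath_Gamma_residues[OF hol, of r N] r by (simp add: a_def T_def f_def)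
    moreover have "contour_integral (truncated_loop r R) f - contour_integral (truncated_loop r T) f
        = (F (Complex (- R) r) - F (Complex (- T) r)) - (F (Complex (- R) (- r)) - F (Complex (- T) (- r)))"
      using truncated_loop_integral[of 0 F f r, OF F] r by simp
    ultimately have "contour_integral (truncated_loop r R) f
        - 2 * of_real pi * \<i> * (\<Sum>n\<le>N. (- 1) ^ n / fact n * E (- of_nat n))
      = ((F (Complex (- R) r) - F (Complex (- T) r)) - (F (Complex (- R) (- r)) - F (Complex (- T) (- r))))
        - contour_integral (linepath d a) f"
      by (simp add: algebra_simps)
    also have "norm \<dots> \<le> M * exp (1 - R) + M * exp (1 - R) + M * exp (1 - R) * (2 * r)"
      using shift[of r] shift[of "- r"] left r
        norm_triangle_ineq4[of "F (Complex (- R) r) - F (Complex (- T) r)" "F (Complex (- R) (- r)) - F (Complex (- T) (- r))"]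
        norm_triangle_ineq4[of "(F (Complex (- R) r) - F (Complex (- T) r)) - (F (Complex (- R) (- r)) - F (Complex (- T) (- r)))"
          "contour_integral (linepath d a) f"] by simp
    also have "\<dots> = (2 + 2 * r) * M * exp (1 - R)" by (simp add: algebra_simps)
    finally show ?thesis by (simp add: N_def)
  qed
  have "((\<lambda>R :: real. 2 * of_real pi * \<i> * (\<Sum>n\<le>nat \<lfloor>R\<rfloor>. (- 1) ^ n / fact n * E (- of_nat n))) \<longlongrightarrow> 2 * of_real pi * \<i> * s) at_top"
  proof (intro tendsto_mult tendsto_const)
    have fl: "filterlim (\<lambda>R :: real. nat \<lfloor>R\<rfloor>) at_top at_top"
      by (rule filterlim_compose[OF filterlim_nat_sequentially filterlim_floor_sequentially])
    show "((\<lambda>R :: real. \<Sum>n\<le>nat \<lfloor>R\<rfloor>. (- 1) ^ n / fact n * E (- of_nat n)) \<longlongrightarrow> s) at_top"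
      by (rule filterlim_compose[OF sums[unfolded sums_def_le] fl])
  qed
  then show ?thesis
    unfolding f_def[symmetric]
  proof (rule Lim_transform2)
    have "((\<lambda>R. (2 + 2 * r) * M * exp (1 - R)) \<longlongrightarrow> (2 + 2 * r) * M * 0) at_top"
      by (intro tendsto_mult tendsto_const) real_asymp
    then have "((\<lambda>R. (2 + 2 * r) * M * exp (1 - R)) \<longlongrightarrow> 0) at_top" by (simp only: mult_zero_right)
    moreover have "\<forall>\<^sub>F R in at_top. norm (2 * of_real pi * \<i> * (\<Sum>n\<le>nat \<lfloor>R\<rfloor>. (- 1) ^ n / fact n * E (- of_nat n))
        - contour_integral (truncated_loop r R) f) \<le> (2 + 2 * r) * M * exp (1 - R)"
      using eventually_ge_at_top[of 1]
      by eventually_elim (subst norm_minus_commute, rule close)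
    ultimately show "((\<lambda>R :: real. 2 * of_real pi * \<i> * (\<Sum>n\<le>nat \<lfloor>R\<rfloor>. (- 1) ^ n / fact n * E (- of_nat n))
        - contour_integral (truncated_loop r R) f) \<longlongrightarrow> 0) at_top"
      by (rule Lim_null_comparison[rotated])
  qed
qed

subsection \<open>Loop integrals of Gamma quotients\<close>

lemma norm_of_real_powr_exp: "z > 0 \<Longrightarrow> norm (of_real z powr w :: complex) = exp (Re w * ln z)"
  by (simp add: powr_def Ln_of_real)

lemma holomorphic_of_real_powr: "z > 0 \<Longrightarrow> (\<lambda>u. of_real z powr (- u) :: complex) holomorphic_on A"
  by (auto simp: powr_def intro!: holomorphic_intros)

text \<open>The loop integral of Gamma u * z powr (-u) is evaluated twice: its residues form the
  exponential series of -z, and the loop can be moved to the line Re u = \<sigma>. Taking r = max 1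
  \<sigma> admits every positive abscissa.\<close>

lemma Cahen_Mellin:
  fixes z \<sigma> :: real
  assumes z: "z > 0" and \<sigma>: "\<sigma> > 0"
  shows "integrable lborel (\<lambda>t. Gamma (Complex \<sigma> t) * of_real z powr (- Complex \<sigma> t))"
    and "(LBINT t. Gamma (Complex \<sigma> t) * of_real z powr (- Complex \<sigma> t)) = 2 * of_real pi * exp (- of_real z)"
proof -
  define r where "r = max 1 \<sigma>"
  define E where "E = (\<lambda>u :: complex. of_real z powr (- u) :: complex)"
  define f where "f = (\<lambda>u. Gamma u * E u)"
  have holE: "E holomorphic_on A" for A unfolding E_def by (rule holomorphic_of_real_powr[OF z])
  have hol: "f holomorphic_on slit 0"
    unfolding f_def using Gamma_holomorphic_slit[of 0 0] holE by (intro holomorphic_on_mult) auto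
  have nE: "norm (E u) = exp (- ln z * Re u)" for u
    using z by (simp add: E_def norm_of_real_powr_exp)
  obtain C where C: "C > 0"
    "\<And>u. Re u \<le> r \<Longrightarrow> \<bar>Im u\<bar> \<ge> 1 \<Longrightarrow> norm (Gamma u) \<le> C * exp ((1 + ln z) * Re u - (pi - 2) * \<bar>Im u\<bar>)"
    using Gamma_bound[of r "1 + ln z"] by metis
  have bound: "norm (f u) \<le> C * exp (Re u - (pi - 2) * \<bar>Im u\<bar>)" if u: "Re u \<le> r" "\<bar>Im u\<bar> \<ge> 1" for u
  proof -
    have "norm (f u) \<le> C * exp ((1 + ln z) * Re u - (pi - 2) * \<bar>Im u\<bar>) * exp (- ln z * Re u)"
      unfolding f_def norm_mult nE by (intro mult_right_mono C(2) u) auto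
    also have "\<dots> = C * exp (Re u - (pi - 2) * \<bar>Im u\<bar>)"
      unfolding mult.assoc mult_exp_exp by (simp add: algebra_simps)
    finally show ?thesis .
  qed
  have c: "0 < \<sigma>" "\<sigma> \<le> r" "r \<ge> 1" "pi - 2 > 0" using \<sigma> pi_gt3 by (auto simp: r_def)
  note line = loop_integral_eq_vertical_line[OF hol c bound]
  show "integrable lborel (\<lambda>t. Gamma (Complex \<sigma> t) * of_real z powr (- Complex \<sigma> t))"
    using line(1) by (simp add: f_def E_def)
  have sums: "(\<lambda>n. (- 1) ^ n / fact n * E (- of_nat n)) sums exp (- of_real z)"
  proof -
    have "(- 1) ^ n / fact n * E (- of_nat n) = (- of_real z) ^ n /\<^sub>R fact n" for n
      using z by (simp add: E_def powr_nat' scaleR_conv_of_real divide_inverse power_minus[of "of_real z"] mult_ac)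
    then show ?thesis using exp_converges[of "- of_real z :: complex"] by simp
  qed
  have "((\<lambda>R. contour_integral (truncated_loop r R) f) \<longlongrightarrow> 2 * of_real pi * \<i> * exp (- of_real z)) at_top"
    unfolding f_def
  proof (rule loop_integral_Gamma_residues[OF holE c(3)])
    fix u
    have "- ln z * Re u \<le> \<bar>ln z\<bar> * \<bar>Re u\<bar>"
      by (metis abs_ge_self abs_mult abs_minus_cancel)
    then show "norm (E u) \<le> 1 * exp (\<bar>ln z\<bar> * \<bar>Re u\<bar>)" by (simp add: nE)
  qed (rule sums)
  from tendsto_unique[OF _ this line(2)]
  have "2 * of_real pi * \<i> * exp (- of_real z) = \<i> * (LBINT t. f (Complex \<sigma> t))" by simp
  then have "\<i> * (LBINT t. f (Complex \<sigma> t)) = \<i> * (2 * of_real pi * exp (- of_real z))" by (simp add: mult_ac)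
  then have "(LBINT t. f (Complex \<sigma> t)) = 2 * of_real pi * exp (- of_real z)"
    by (subst (asm) mult_cancel_left) simp
  then show "(LBINT t. Gamma (Complex \<sigma> t) * of_real z powr (- Complex \<sigma> t)) = 2 * of_real pi * exp (- of_real z)"
    by (simp add: f_def E_def)
qed

lemma meijer_G_eqI:
  assumes "((\<lambda>R. contour_integral (truncated_loop (1 + (\<Sum>b\<leftarrow>bs. cmod b)) R) (meijer_integrand m bs \<zeta>))
    \<longlongrightarrow> 2 * of_real pi * \<i> * s) at_top"
  shows "meijer_G m bs \<zeta> = s"
  unfolding meijer_G_def tendsto_Lim[OF trivial_limit_at_top_linorder assms] by simp

text \<open>This is the hypergeometric function 0F2 (; \<nu> + 1, \<kappa> + 1; -z) divided by
  \<nu>! \<kappa>!; it will be the value of the first Meijer function.\<close>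

definition hyp03 :: "nat \<Rightarrow> nat \<Rightarrow> real \<Rightarrow> real" where
  "hyp03 \<nu> \<kappa> z = (\<Sum>m. (- z) ^ m / (fact m * fact (m + \<nu>) * fact (m + \<kappa>)))"

lemma hyp03_term_le: "norm ((- z) ^ m / (fact m * fact (m + \<nu>) * fact (m + \<kappa>)) :: real) \<le> \<bar>z\<bar> ^ m / fact m"
proof -
  have "1 \<le> (fact (m + \<nu>) * fact (m + \<kappa>) :: real)"
    using mult_mono[OF fact_ge_1[of "m + \<nu>"] fact_ge_1[of "m + \<kappa>"]] by simp
  then have "(fact m :: real) * 1 \<le> fact m * (fact (m + \<nu>) * fact (m + \<kappa>))" by (intro mult_left_mono) auto
  then have "\<bar>z\<bar> ^ m / (fact m * fact (m + \<nu>) * fact (m + \<kappa>)) \<le> \<bar>z\<bar> ^ m / fact m"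
    by (intro divide_left_mono) (auto simp: mult_ac)
  then show ?thesis by (simp add: power_abs abs_mult)
qed

lemma hyp03_sums: "(\<lambda>m. (- z) ^ m / (fact m * fact (m + \<nu>) * fact (m + \<kappa>))) sums hyp03 \<nu> \<kappa> z"
  unfolding hyp03_def
  by (rule summable_sums[OF summable_comparison_test[OF _ summable_exp_abs[of z]]]) (use hyp03_term_le in blast)

text \<open>Apart from Gamma u the integrand is entire, so only the simple poles 0, -1, -2, ...
  contribute. On the part of the strip |Im u| <= r with Re u <= r the reciprocal Gamma factors are
  bounded, and the power of z alone determines the growth rate.\<close>

lemma meijer_G_1_eq_hyp03:
  fixes z :: real
  assumes z: "z > 0"
  shows "meijer_G 1 [0, - of_nat \<nu>, - of_nat \<kappa>] (of_real z) = of_real (hyp03 \<nu> \<kappa> z)"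
proof (rule meijer_G_eqI)
  define r where "r = 1 + real \<nu> + real \<kappa>"
  define E where "E = (\<lambda>u :: complex. rGamma (1 + of_nat \<nu> - u) * rGamma (1 + of_nat \<kappa> - u) * of_real z powr (- u))"
  have "meijer_integrand 1 [0, - of_nat \<nu>, - of_nat \<kappa>] (of_real z) = (\<lambda>u. Gamma u * E u)"
  proof
    fix u
    have "{1..<length [0, - of_nat \<nu>, - of_nat \<kappa> :: complex]} = {1, 2}" by auto
    then show "meijer_integrand 1 [0, - of_nat \<nu>, - of_nat \<kappa>] (of_real z) u = Gamma u * E u"
      by (simp add: meijer_integrand_def E_def rGamma_inverse_Gamma divide_inverse mult_ac)
  qed
  moreover have "1 + (\<Sum>b\<leftarrow>[0, - of_nat \<nu>, - of_nat \<kappa>]. cmod b) = r" by (simp add: r_def)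
  moreover have "((\<lambda>R. contour_integral (truncated_loop r R) (\<lambda>u. Gamma u * E u))
      \<longlongrightarrow> 2 * of_real pi * \<i> * of_real (hyp03 \<nu> \<kappa> z)) at_top"
  proof -
    obtain C where C: "C > 0" "\<And>u. Re u \<ge> - r \<Longrightarrow> norm (rGamma u) \<le> C * exp (- 0 * Re u + 2 * \<bar>Im u\<bar>)"
      using rGamma_bound[of r 0] by metis
    show ?thesis
    proof (rule loop_integral_Gamma_residues)
      show "E holomorphic_on UNIV"
        unfolding E_def using z
        by (intro holomorphic_on_mult holomorphic_rGamma' holomorphic_of_real_powr holomorphic_intros)
      show "r \<ge> 1" by (simp add: r_def)
      fix u assume u: "Re u \<le> r" "\<bar>Im u\<bar> \<le> r"
      have rG: "norm (rGamma (1 + of_nat k - u)) \<le> C * exp (2 * r)" for k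
      proof -
        have "norm (rGamma (1 + of_nat k - u)) \<le> C * exp (- 0 * Re (1 + of_nat k - u) + 2 * \<bar>Im (1 + of_nat k - u)\<bar>)"
          using u by (intro C(2)) simp
        also have "\<dots> \<le> C * exp (2 * r)" using u C(1) by (intro mult_left_mono) auto
        finally show ?thesis .
      qed
      have "- ln z * Re u \<le> \<bar>ln z\<bar> * \<bar>Re u\<bar>"
        by (metis abs_ge_self abs_mult abs_minus_cancel)
      then have "norm (of_real z powr (- u) :: complex) \<le> exp (\<bar>ln z\<bar> * \<bar>Re u\<bar>)"
        using z by (simp add: norm_of_real_powr_exp mult.commute)
      then show "norm (E u) \<le> (C * exp (2 * r) * (C * exp (2 * r))) * exp (\<bar>ln z\<bar> * \<bar>Re u\<bar>)"
        unfolding E_def norm_mult using C(1) by (intro mult_mono rG mult_nonneg_nonneg) auto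
    next
      have "(- 1) ^ n / fact n * E (- of_nat n) = of_real ((- z) ^ n / (fact n * fact (n + \<nu>) * fact (n + \<kappa>)))" for n
      proof -
        have g: "rGamma (1 + of_nat k + of_nat n :: complex) = 1 / fact (n + k)" for k
          using Gamma_fact[of "n + k", where 'a = complex]
          by (simp add: rGamma_inverse_Gamma inverse_eq_divide add_ac)
        show ?thesis
          using z by (simp add: E_def g powr_nat' power_minus[of "of_real z"])
      qed
      then show "(\<lambda>n. (- 1) ^ n / fact n * E (- of_nat n)) sums of_real (hyp03 \<nu> \<kappa> z)"
        using sums_of_real[OF hyp03_sums[of z \<nu> \<kappa>], where 'a = complex] by simp
    qed
  qed
  ultimately show "((\<lambda>R. contour_integral (truncated_loop (1 + (\<Sum>b\<leftarrow>[0, - of_nat \<nu>, - of_nat \<kappa>]. cmod b)) R)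
      (meijer_integrand 1 [0, - of_nat \<nu>, - of_nat \<kappa>] (of_real z))) \<longlongrightarrow> 2 * of_real pi * \<i> * of_real (hyp03 \<nu> \<kappa> z)) at_top"
    by (simp only:)
qed

text \<open>The two Gamma factors decay like exp (-2 (pi - 2) |Im u|) and the reciprocal one costs
  exp (2 |Im u|), so the net rate 2 pi - 6 is positive. As \<kappa> <= \<nu>, all poles have real
  part at most -\<kappa>; the line may therefore stand left of 0, as the Mellin transform of
  \<open>clif\<close> will require.\<close>

lemma meijer_G_2_eq_vertical_line:
  fixes z :: real
  assumes z: "z > 0" and \<sigma>: "- real \<kappa> < \<sigma>" "\<sigma> \<le> 1" and le: "\<kappa> \<le> \<nu>"
  shows "meijer_G 2 [of_nat \<nu>, of_nat \<kappa>, 0] (of_real z) = 1 / (2 * of_real pi) *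
    (LBINT t. Gamma (of_nat \<nu> + Complex \<sigma> t) * Gamma (of_nat \<kappa> + Complex \<sigma> t) * rGamma (1 - Complex \<sigma> t)
      * of_real z powr (- Complex \<sigma> t))"
proof (rule meijer_G_eqI)
  define r where "r = 1 + real \<nu> + real \<kappa>"
  define f where "f = (\<lambda>u :: complex. Gamma (of_nat \<nu> + u) * Gamma (of_nat \<kappa> + u) * rGamma (1 - u) * of_real z powr (- u))"
  have "meijer_integrand 2 [of_nat \<nu>, of_nat \<kappa>, 0] (of_real z) = f"
  proof
    fix u
    have "{2..<length [of_nat \<nu>, of_nat \<kappa>, 0 :: complex]} = {2}" "{..<2 :: nat} = {0, 1}" by auto
    then show "meijer_integrand 2 [of_nat \<nu>, of_nat \<kappa>, 0] (of_real z) u = f u"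
      by (simp add: meijer_integrand_def f_def rGamma_inverse_Gamma divide_inverse mult_ac)
  qed
  moreover have "1 + (\<Sum>b\<leftarrow>[of_nat \<nu>, of_nat \<kappa>, 0]. cmod b) = r" by (simp add: r_def)
  moreover have "((\<lambda>R. contour_integral (truncated_loop r R) f) \<longlongrightarrow> \<i> * (LBINT t. f (Complex \<sigma> t))) at_top"
  proof -
    have hol: "f holomorphic_on slit (- real \<kappa>)"
      unfolding f_def using z Gamma_holomorphic_slit[of "- real \<kappa>" "real \<kappa>"] Gamma_holomorphic_slit[of "- real \<kappa>" "real \<nu>"] le
      by (intro holomorphic_on_mult holomorphic_rGamma' holomorphic_of_real_powr holomorphic_on_diff
          holomorphic_on_const holomorphic_on_ident) simp_all
    \<comment> \<open>The bound is applied at u + \<nu> and u + \<kappa>, whose real parts stay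
      below 2 r.\<close>
    obtain C where C: "C > 0"
      "\<And>u. Re u \<le> 2 * r \<Longrightarrow> \<bar>Im u\<bar> \<ge> 1 \<Longrightarrow> norm (Gamma u) \<le> C * exp (0 * Re u - (pi - 2) * \<bar>Im u\<bar>)"
      using Gamma_bound[of "2 * r" 0] by metis
    \<comment> \<open>The rate 1 + ln z offsets the power of z and leaves the factor exp (Re u) that
      moving the loop requires.\<close>
    obtain C' where C': "C' > 0"
      "\<And>u. Re u \<ge> - r \<Longrightarrow> norm (rGamma u) \<le> C' * exp (- (1 + ln z) * Re u + 2 * \<bar>Im u\<bar>)"
      using rGamma_bound[of r "1 + ln z"] by metis
    have bound: "norm (f u) \<le> (C * C * (C' * exp (- (1 + ln z)))) * exp (Re u - (2 * pi - 6) * \<bar>Im u\<bar>)"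
      if u: "Re u \<le> r" "\<bar>Im u\<bar> \<ge> 1" for u
    proof -
      have G: "norm (Gamma (of_nat k + u)) \<le> C * exp (- (pi - 2) * \<bar>Im u\<bar>)" if "k \<le> \<nu>" for k
        using C(2)[of "of_nat k + u"] u that by (simp add: r_def algebra_simps)
      have "norm (rGamma (1 - u)) \<le> C' * exp (- (1 + ln z) * Re (1 - u) + 2 * \<bar>Im (1 - u)\<bar>)"
        using u by (intro C'(2)) simp
      also have "\<dots> = C' * exp (- (1 + ln z)) * exp ((1 + ln z) * Re u + 2 * \<bar>Im u\<bar>)"
        unfolding mult.assoc mult_exp_exp by (simp add: algebra_simps)
      finally have rG: "norm (rGamma (1 - u)) \<le> C' * exp (- (1 + ln z)) * exp ((1 + ln z) * Re u + 2 * \<bar>Im u\<bar>)" .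
      have "norm (f u) \<le> (C * exp (- (pi - 2) * \<bar>Im u\<bar>)) * (C * exp (- (pi - 2) * \<bar>Im u\<bar>))
          * (C' * exp (- (1 + ln z)) * exp ((1 + ln z) * Re u + 2 * \<bar>Im u\<bar>)) * exp (- ln z * Re u)"
        unfolding f_def norm_mult using z C(1) C'(1) le
        by (intro mult_mono G rG mult_nonneg_nonneg) (auto simp: norm_of_real_powr_exp mult.commute)
      also have "\<dots> = (C * C * (C' * exp (- (1 + ln z)))) * (exp (- (pi - 2) * \<bar>Im u\<bar>) * exp (- (pi - 2) * \<bar>Im u\<bar>)
          * exp ((1 + ln z) * Re u + 2 * \<bar>Im u\<bar>) * exp (- ln z * Re u))"
        by (simp add: mult_ac)
      also have "exp (- (pi - 2) * \<bar>Im u\<bar>) * exp (- (pi - 2) * \<bar>Im u\<bar>) * exp ((1 + ln z) * Re u + 2 * \<bar>Im u\<bar>) * exp (- ln z * Re u)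
          = exp (Re u - (2 * pi - 6) * \<bar>Im u\<bar>)"
        unfolding mult_exp_exp by (simp add: algebra_simps)
      finally show ?thesis .
    qed
    show ?thesis
      by (rule loop_integral_eq_vertical_line(2)[OF hol _ _ _ _ bound]) (use \<sigma> pi_gt3 in \<open>auto simp: r_def\<close>)
  qed
  moreover have "\<i> * (LBINT t. f (Complex \<sigma> t)) = 2 * of_real pi * \<i> * (1 / (2 * of_real pi) * (LBINT t. f (Complex \<sigma> t)))"
    by simp
  ultimately show "((\<lambda>R. contour_integral (truncated_loop (1 + (\<Sum>b\<leftarrow>[of_nat \<nu>, of_nat \<kappa>, 0]. cmod b)) R)
      (meijer_integrand 2 [of_nat \<nu>, of_nat \<kappa>, 0] (of_real z))) \<longlongrightarrow>
      2 * of_real pi * \<i> * (1 / (2 * of_real pi) *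
        (LBINT t. Gamma (of_nat \<nu> + Complex \<sigma> t) * Gamma (of_nat \<kappa> + Complex \<sigma> t) * rGamma (1 - Complex \<sigma> t)
      * of_real z powr (- Complex \<sigma> t)))) at_top"
    by (simp only: f_def)
qed

subsection \<open>Integration over the half-line\<close>

text \<open>A measure rather than a set integral, so that Fubini and dominated convergence apply
  without indicator functions.\<close>

definition half_line :: "real measure" where
  "half_line = restrict_space lborel {0<..}"

lemma space_half_line [simp]: "space half_line = {0<..}"
  by (simp add: half_line_def space_restrict_space)

lemma measurable_half_line_ident [measurable]: "(\<lambda>x. x) \<in> borel_measurable half_line"
  unfolding half_line_def by (rule measurable_restrict_space1) simp

lemma measurable_half_lineI: "f \<in> borel_measurable borel \<Longrightarrow> f \<in> borel_measurable half_line"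
  unfolding half_line_def by (rule measurable_restrict_space1) simp

lemma measurable_fst_half_line [measurable]: "fst \<in> borel_measurable (half_line \<Otimes>\<^sub>M M)"
  using measurable_compose[OF measurable_fst measurable_half_line_ident] by simp

lemma measurable_snd_half_line [measurable]: "snd \<in> borel_measurable (M \<Otimes>\<^sub>M half_line)"
  using measurable_compose[OF measurable_snd measurable_half_line_ident] by simp

lemma integrable_half_line_iff: "integrable half_line f \<longleftrightarrow> set_integrable lborel {0<..} f"
  for f :: "real \<Rightarrow> 'a :: {banach, second_countable_topology}"
  by (simp add: half_line_def integrable_restrict_space set_integrable_def)

lemma integral_half_line: "integral\<^sup>L half_line f = (LBINT x:{0<..}. f x)"
  for f :: "real \<Rightarrow> 'a :: {banach, second_countable_topology}"
  by (simp add: half_line_def integral_restrict_space set_lebesgue_integral_def)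

lemma AE_half_lineI: "(\<And>x. x > 0 \<Longrightarrow> P x) \<Longrightarrow> AE x in half_line. P x"
  by (rule AE_I2) simp

lemma sigma_finite_half_line: "sigma_finite_measure half_line"
  unfolding half_line_def
  by (rule sigma_finite_measure_restrict_space) (auto intro: lborel.sigma_finite_measure_axioms)

interpretation hl: sigma_finite_measure half_line by (rule sigma_finite_half_line)
interpretation hl_hl: pair_sigma_finite half_line half_line ..
interpretation hl_lborel: pair_sigma_finite half_line lborel ..

lemma integrable_half_line_bound:
  fixes f :: "real \<Rightarrow> 'a :: {banach, second_countable_topology}" and g :: "real \<Rightarrow> real"
  assumes "integrable half_line g" "f \<in> borel_measurable half_line" "\<And>x. x > 0 \<Longrightarrow> norm (f x) \<le> g x"
  shows "integrable half_line f"
  using assms by (intro Bochner_Integration.integrable_bound[OF assms(1,2)] AE_half_lineI)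
    (auto intro: order_trans[OF _ abs_ge_self])

lemma half_line_cong:
  fixes f g :: "real \<Rightarrow> 'a :: {banach, second_countable_topology}"
  assumes "\<And>x. x > 0 \<Longrightarrow> f x = g x"
  shows "integrable half_line f \<longleftrightarrow> integrable half_line g" "integral\<^sup>L half_line f = integral\<^sup>L half_line g"
  using assms by (auto intro!: Bochner_Integration.integrable_cong Bochner_Integration.integral_cong)

lemma half_line_absolutely_integrable:
  fixes f :: "real \<Rightarrow> 'a :: euclidean_space"
  assumes [measurable]: "f \<in> borel_measurable borel"
  shows "integrable half_line f \<longleftrightarrow> f absolutely_integrable_on {0<..}"
    and "integrable half_line f \<Longrightarrow> integral\<^sup>L half_line f = integral {0<..} f"
  by (auto simp: integrable_half_line_iff integral_half_line set_integrable_def integrable_completion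
      set_borel_integral_eq_integral)

lemma half_line_scale:
  fixes f :: "real \<Rightarrow> 'a :: {banach, second_countable_topology}"
  assumes "l > 0"
  shows "integrable half_line (\<lambda>t. f (l * t)) \<longleftrightarrow> integrable half_line f"
    and "integral\<^sup>L half_line f = l *\<^sub>R integral\<^sup>L half_line (\<lambda>t. f (l * t))"
proof -
  have ind: "indicator {0<..} (l * t) = (indicator {0<..} t :: real)" for t
    using assms by (auto simp: indicator_def zero_less_mult_iff)
  show "integrable half_line (\<lambda>t. f (l * t)) \<longleftrightarrow> integrable half_line f"
    using lborel_integrable_real_affine_iff[of l "\<lambda>t. indicator {0<..} t *\<^sub>R f t" 0] assms
    by (simp add: integrable_half_line_iff set_integrable_def ind)
  show "integral\<^sup>L half_line f = l *\<^sub>R integral\<^sup>L half_line (\<lambda>t. f (l * t))"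
    using lborel_integral_real_affine[of l "\<lambda>t. indicator {0<..} t *\<^sub>R f t" 0] assms
    by (simp add: integral_half_line set_lebesgue_integral_def ind)
qed

lemma half_line_inverse_real:
  fixes f :: "real \<Rightarrow> real"
  assumes [measurable]: "f \<in> borel_measurable borel"
  shows "integrable half_line (\<lambda>t. f (1 / t) / t\<^sup>2) \<longleftrightarrow> integrable half_line f"
    and "integral\<^sup>L half_line (\<lambda>t. f (1 / t) / t\<^sup>2) = integral\<^sup>L half_line f"
proof -
  have img: "(\<lambda>t :: real. 1 / t) ` {0<..} = {0<..}"
  proof (intro equalityI subsetI)
    fix x :: real assume "x \<in> {0<..}"
    then show "x \<in> (\<lambda>t :: real. 1 / t) ` {0<..}" by (intro image_eqI[of _ _ "1 / x"]) auto
  qed auto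
  have *: "(\<lambda>t. f (1 / t) / t\<^sup>2) absolutely_integrable_on {0<..} \<and> integral {0<..} (\<lambda>t. f (1 / t) / t\<^sup>2) = b
      \<longleftrightarrow> f absolutely_integrable_on {0<..} \<and> integral {0<..} f = b" for b
  proof -
    have "(\<lambda>t. \<bar>- 1 / t\<^sup>2\<bar> * f (1 / t)) absolutely_integrable_on {0<..} \<and> integral {0<..} (\<lambda>t. \<bar>- 1 / t\<^sup>2\<bar> * f (1 / t)) = b
      \<longleftrightarrow> f absolutely_integrable_on ((\<lambda>t. 1 / t) ` {0<..}) \<and> integral ((\<lambda>t. 1 / t) ` {0<..}) f = b"
    proof (rule has_absolute_integral_change_of_variables_1')
      fix x :: real assume "x \<in> {0<..}"
      then show "((\<lambda>t. 1 / t) has_real_derivative - 1 / x\<^sup>2) (at x within {0<..})"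
        by (auto intro!: derivative_eq_intros simp: power2_eq_square)
    qed (auto simp: inj_on_def)
    then show ?thesis unfolding img by simp
  qed
  have m: "(\<lambda>t. f (1 / t) / t\<^sup>2) \<in> borel_measurable borel" by measurable
  note hi = half_line_absolutely_integrable[OF m] half_line_absolutely_integrable[OF assms]
  show iff: "integrable half_line (\<lambda>t. f (1 / t) / t\<^sup>2) \<longleftrightarrow> integrable half_line f"
    using * hi by blast
  show "integral\<^sup>L half_line (\<lambda>t. f (1 / t) / t\<^sup>2) = integral\<^sup>L half_line f"
  proof (cases "integrable half_line f")
    case True
    then show ?thesis using * hi iff by metis
  next
    \<comment> \<open>Both integrals are then 0, the default value for functions that are not
      integrable.\<close>
    case False
    then show ?thesis using iff by (simp add: not_integrable_integral_eq)
  qed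
qed

lemma half_line_inverse:
  fixes f :: "real \<Rightarrow> complex"
  assumes [measurable]: "f \<in> borel_measurable borel" and int: "integrable half_line f"
  shows "integrable half_line (\<lambda>t. f (1 / t) / of_real (t\<^sup>2))"
    and "integral\<^sup>L half_line (\<lambda>t. f (1 / t) / of_real (t\<^sup>2)) = integral\<^sup>L half_line f"
proof -
  have R: "integrable half_line (\<lambda>t. Re (f (1 / t)) / t\<^sup>2)" "integrable half_line (\<lambda>t. Im (f (1 / t)) / t\<^sup>2)"
    using half_line_inverse_real(1)[of "\<lambda>t. Re (f t)"] half_line_inverse_real(1)[of "\<lambda>t. Im (f t)"] int by auto
  then have "integrable half_line (\<lambda>t. of_real (Re (f (1 / t)) / t\<^sup>2) + \<i> * of_real (Im (f (1 / t)) / t\<^sup>2))"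
    by (intro Bochner_Integration.integrable_add integrable_mult_right integrable_of_real)
  also have "(\<lambda>t. of_real (Re (f (1 / t)) / t\<^sup>2) + \<i> * of_real (Im (f (1 / t)) / t\<^sup>2)) = (\<lambda>t. f (1 / t) / of_real (t\<^sup>2))"
    by (auto simp: complex_eq_iff fun_eq_iff Re_divide_of_real Im_divide_of_real simp del: of_real_power)
  finally show int': "integrable half_line (\<lambda>t. f (1 / t) / of_real (t\<^sup>2))" .
  show "integral\<^sup>L half_line (\<lambda>t. f (1 / t) / of_real (t\<^sup>2)) = integral\<^sup>L half_line f"
  proof (rule complex_eqI)
    have "Re (integral\<^sup>L half_line (\<lambda>t. f (1 / t) / of_real (t\<^sup>2))) = (\<integral>t. Re (f (1 / t) / of_real (t\<^sup>2)) \<partial>half_line)"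
      by (rule integral_Re[OF int', symmetric])
    also have "\<dots> = (\<integral>t. Re (f (1 / t)) / t\<^sup>2 \<partial>half_line)" by (simp only: Re_divide_of_real)
    also have "\<dots> = (\<integral>t. Re (f t) \<partial>half_line)" by (rule half_line_inverse_real(2)) measurable
    also have "\<dots> = Re (integral\<^sup>L half_line f)" by (rule integral_Re[OF int])
    finally show "Re (integral\<^sup>L half_line (\<lambda>t. f (1 / t) / of_real (t\<^sup>2))) = Re (integral\<^sup>L half_line f)" .
    have "Im (integral\<^sup>L half_line (\<lambda>t. f (1 / t) / of_real (t\<^sup>2))) = (\<integral>t. Im (f (1 / t) / of_real (t\<^sup>2)) \<partial>half_line)"
      by (rule integral_Im[OF int', symmetric])
    also have "\<dots> = (\<integral>t. Im (f (1 / t)) / t\<^sup>2 \<partial>half_line)" by (simp only: Im_divide_of_real)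
    also have "\<dots> = (\<integral>t. Im (f t) \<partial>half_line)" by (rule half_line_inverse_real(2)) measurable
    also have "\<dots> = Im (integral\<^sup>L half_line f)" by (rule integral_Im[OF int])
    finally show "Im (integral\<^sup>L half_line (\<lambda>t. f (1 / t) / of_real (t\<^sup>2))) = Im (integral\<^sup>L half_line f)" .
  qed
qed

section \<open>Gamma and Laplace integrals on the half-line\<close>

lemma has_bochner_integral_Gamma:
  assumes s: "Re s > 0" and l: "l > 0"
  shows "has_bochner_integral half_line (\<lambda>t. of_real t powr (s - 1) * of_real (exp (- l * t)))
    (Gamma s * of_real l powr (- s))"
proof -
  define f where "f = (\<lambda>t. of_real t powr (s - 1) / of_real (exp t) :: complex)"
  have m: "f \<in> borel_measurable borel" unfolding f_def by measurable
  have i: "integrable half_line f"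
    using half_line_absolutely_integrable(1)[OF m] absolutely_integrable_Gamma_integral'[OF s] by (simp add: f_def)
  have v: "integral\<^sup>L half_line f = Gamma s"
    unfolding half_line_absolutely_integrable(2)[OF m i] unfolding f_def
    by (rule integral_unique[OF Gamma_integral_complex'[OF s]])
  have eq: "f (l * t) = of_real l powr (s - 1) * (of_real t powr (s - 1) * of_real (exp (- l * t)))" if "t > 0" for t
    using that l by (simp add: f_def powr_times_real exp_minus divide_inverse)
  have i2: "integrable half_line (\<lambda>t. of_real l powr (s - 1) * (of_real t powr (s - 1) * of_real (exp (- l * t))))"
    using half_line_scale(1)[OF l, of f] i half_line_cong(1)[OF eq] by simp
  then have i3: "integrable half_line (\<lambda>t. of_real t powr (s - 1) * of_real (exp (- l * t)))"
    using l integrable_mult_right[OF i2, of "inverse (of_real l powr (s - 1))"] by (simp flip: mult.assoc)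
  have "Gamma s = l *\<^sub>R integral\<^sup>L half_line (\<lambda>t. of_real l powr (s - 1) * (of_real t powr (s - 1) * of_real (exp (- l * t))))"
    using half_line_scale(2)[OF l, of f] v half_line_cong(2)[OF eq] by simp
  also have "\<dots> = (of_real l * of_real l powr (s - 1)) * integral\<^sup>L half_line (\<lambda>t. of_real t powr (s - 1) * of_real (exp (- l * t)))"
    by (simp add: scaleR_conv_of_real)
  also have "of_real l * of_real l powr (s - 1) = (of_real l powr s :: complex)"
    using l by (simp add: powr_diff)
  finally have G: "Gamma s = of_real l powr s * integral\<^sup>L half_line (\<lambda>t. of_real t powr (s - 1) * of_real (exp (- l * t)))" .
  have "integral\<^sup>L half_line (\<lambda>t. of_real t powr (s - 1) * of_real (exp (- l * t))) = Gamma s * of_real l powr (- s)"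
    unfolding G powr_minus using l by simp
  then show ?thesis using i3 by (simp add: has_bochner_integral_iff)
qed

lemma has_bochner_integral_power_exp:
  assumes l: "l > 0"
  shows "has_bochner_integral half_line (\<lambda>x. x ^ n * exp (- l * x)) (fact n / l ^ (n + 1))"
proof -
  \<comment> \<open>\<open>erlang_density 0 l\<close> is the exponential density, whose n-th moment
    is n! / l^n.\<close>
  have nn: "(\<integral>\<^sup>+ x. ennreal (erlang_density 0 l x * x ^ n) \<partial>lborel) = ennreal (fact n / l ^ n)"
    using nn_integral_erlang_ith_moment[OF l, of 0 n] by simp
  have "has_bochner_integral lborel (\<lambda>x. erlang_density 0 l x * x ^ n) (fact n / l ^ n)"
    using l by (intro has_bochner_integral_nn_integral nn) (auto simp: erlang_density_def)
  then have h: "has_bochner_integral lborel (\<lambda>x. 1 / l * (erlang_density 0 l x * x ^ n)) (1 / l * (fact n / l ^ n))"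
    by (rule has_bochner_integral_mult_right)
  have ae: "AE x in lborel. x \<noteq> (0 :: real)" by (rule AE_lborel_singleton)
  have "has_bochner_integral lborel (\<lambda>x. indicator {0<..} x *\<^sub>R (x ^ n * exp (- l * x))) (1 / l * (fact n / l ^ n))"
    by (rule has_bochner_integralI_AE[OF h])
       (use l ae in \<open>auto simp: erlang_density_def indicator_def elim!: eventually_mono\<close>)
  then show ?thesis
    by (simp add: has_bochner_integral_iff half_line_def integrable_restrict_space integral_restrict_space)
qed

text \<open>For c > 0 this is, up to a constant, the Laplace transform of x^(b/2) J_b (2 sqrt (c
  x)). Term by term the moment (m + b)! cancels the same factorial in \<open>clif\<close>, and an
  exponential series remains. It is applied with c of both signs, a negative c giving the I-Bessel
  weights.\<close>

lemma clif_Laplace: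
  assumes l: "l > 0"
  shows "has_bochner_integral half_line (\<lambda>x. x ^ b * clif b (c * x) * exp (- l * x)) (exp (- c / l) / l ^ (b + 1))"
proof -
  define a where "a = (\<lambda>m. (- c) ^ m / (fact m * fact (m + b)))"
  define f where "f = (\<lambda>m x. a m * (x ^ (m + b) * exp (- l * x)))"
  have hb: "has_bochner_integral half_line (f m) (a m * (fact (m + b) / l ^ (m + b + 1)))" for m
    unfolding f_def by (intro has_bochner_integral_mult_right has_bochner_integral_power_exp l)
  have val: "a m * (fact (m + b) / l ^ (m + b + 1)) = (- c / l) ^ m / fact m * (1 / l ^ (b + 1))" for m
    using l unfolding a_def power_divide by (simp add: power_add)
  have hbn: "has_bochner_integral half_line (\<lambda>x. norm (f m x)) ((\<bar>c\<bar> / l) ^ m / fact m * (1 / l ^ (b + 1)))" for m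
  proof -
    have "has_bochner_integral half_line (\<lambda>x. \<bar>a m\<bar> * (x ^ (m + b) * exp (- l * x))) (\<bar>a m\<bar> * (fact (m + b) / l ^ (m + b + 1)))"
      by (intro has_bochner_integral_mult_right has_bochner_integral_power_exp l)
    also have "\<bar>a m\<bar> * (fact (m + b) / l ^ (m + b + 1)) = (\<bar>c\<bar> / l) ^ m / fact m * (1 / l ^ (b + 1))"
      using l unfolding a_def power_divide by (simp add: power_add abs_mult power_abs)
    finally have h: "has_bochner_integral half_line (\<lambda>x. \<bar>a m\<bar> * (x ^ (m + b) * exp (- l * x)))
        ((\<bar>c\<bar> / l) ^ m / fact m * (1 / l ^ (b + 1)))" .
    have "norm (f m x) = \<bar>a m\<bar> * (x ^ (m + b) * exp (- l * x))" if "x > 0" for x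
      using that by (simp add: f_def abs_mult)
    then show ?thesis
      using h half_line_cong[of "\<lambda>x. norm (f m x)" "\<lambda>x. \<bar>a m\<bar> * (x ^ (m + b) * exp (- l * x))"]
      unfolding has_bochner_integral_iff by simp
  qed
  have es: "(\<lambda>m. y ^ m / fact m * k) sums (exp y * k)" for y k :: real
    using sums_mult2[OF exp_converges[of y], of k] by (simp add: divide_inverse mult_ac)
  have fs: "(\<lambda>m. f m x) sums (x ^ b * clif b (c * x) * exp (- l * x))" for x
  proof -
    have "(\<lambda>m. x ^ b * ((- (c * x)) ^ m / (fact m * fact (m + b))) * exp (- l * x)) sums (x ^ b * clif b (c * x) * exp (- l * x))"
      by (intro sums_mult sums_mult2 clif_sums)
    also have "(\<lambda>m. x ^ b * ((- (c * x)) ^ m / (fact m * fact (m + b))) * exp (- l * x)) = (\<lambda>m. f m x)"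
      by (simp add: f_def a_def fun_eq_iff power_add power_mult_distrib power_minus[of "_ * _"] power_minus[of c] mult_ac)
    finally show ?thesis .
  qed
  have abs_sum: "summable (\<lambda>m. norm (f m x))" if "x > 0" for x
  proof (rule summable_comparison_test[OF _ summable_mult2[OF summable_exp_abs[of "c * x"], of "x ^ b"]], intro exI allI impI)
    fix m
    have "norm (f m x) = norm ((- (c * x)) ^ m / (fact m * fact (m + b)) :: real) * (x ^ b * exp (- l * x))"
      using that by (simp add: f_def a_def power_add power_mult_distrib abs_mult power_abs mult_ac)
    also have "\<dots> \<le> (\<bar>c * x\<bar> ^ m / fact m) * (x ^ b * 1)"
      using that l by (intro mult_mono clif_term_le) auto
    finally show "norm (norm (f m x)) \<le> \<bar>c * x\<bar> ^ m / fact m * x ^ b" by simp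
  qed
  have i: "integrable half_line (f m)" "(\<integral>x. norm (f m x) \<partial>half_line) = (\<bar>c\<bar> / l) ^ m / fact m * (1 / l ^ (b + 1))"
    "integral\<^sup>L half_line (f m) = (- c / l) ^ m / fact m * (1 / l ^ (b + 1))" for m
    using hb[of m] hbn[of m] val[of m] by (simp_all only: has_bochner_integral_iff)
  have sn: "summable (\<lambda>m. \<integral>x. norm (f m x) \<partial>half_line)"
    unfolding i(2) using es[of "\<bar>c\<bar> / l" "1 / l ^ (b + 1)"] by (rule sums_summable)
  have si: "(\<lambda>x. \<Sum>m. f m x) = (\<lambda>x. x ^ b * clif b (c * x) * exp (- l * x))"
    using fs by (simp add: fun_eq_iff sums_iff)
  have "integrable half_line (\<lambda>x. \<Sum>m. f m x)"
    by (rule integrable_suminf[OF i(1) AE_half_lineI[OF abs_sum] sn])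
  moreover have "(\<lambda>m. integral\<^sup>L half_line (f m)) sums (\<integral>x. (\<Sum>m. f m x) \<partial>half_line)"
    by (rule sums_integral[OF i(1) AE_half_lineI[OF abs_sum] sn])
  then have "(\<integral>x. (\<Sum>m. f m x) \<partial>half_line) = exp (- c / l) * (1 / l ^ (b + 1))"
    unfolding i(3) using es by (rule sums_unique2)
  ultimately show ?thesis by (simp add: si has_bochner_integral_iff)
qed

text \<open>
  The factor \<open>(1 + X) powr (- 1 / 4)\<close> is the decay of \<open>clif\<close>; the other one is \<open>X powr (s - 1)\<close> on the
  line \<open>s = 1 / 8\<close> of all Mellin integrals below.
\<close>

definition dominant :: "real \<Rightarrow> real" where
  "dominant X = X powr (- 7 / 8) * (1 + X) powr (- 1 / 4)"

lemma dominant_nonneg: "dominant X \<ge> 0"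
  by (simp add: dominant_def)

lemma measurable_dominant [measurable]: "dominant \<in> borel_measurable borel"
  unfolding dominant_def by measurable

lemma integrable_dominant: "integrable half_line dominant"
proof -
  have i1: "integrable lborel (\<lambda>x :: real. indicator {0<..1} x *\<^sub>R (x powr (- 7 / 8)))"
  proof -
    have "(\<lambda>x :: real. x powr (- 7 / 8)) absolutely_integrable_on {0<..1}"
      by (intro nonnegative_absolutely_integrable_1 integrable_on_powr_from_0') auto
    then show ?thesis unfolding set_integrable_def by (subst (asm) integrable_completion) auto
  qed
  have i2: "integrable lborel (\<lambda>x :: real. indicator {1..} x *\<^sub>R (x powr (- 9 / 8)))"
  proof -
    have "(\<lambda>x :: real. x powr (- 9 / 8)) absolutely_integrable_on {1..}"
      using has_integral_powr_to_inf[of "- 9 / 8" 1]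
      by (intro nonnegative_absolutely_integrable_1) (auto simp: integrable_on_def)
    then show ?thesis unfolding set_integrable_def by (subst (asm) integrable_completion) auto
  qed
  show ?thesis
    unfolding integrable_half_line_iff set_integrable_def
  proof (rule Bochner_Integration.integrable_bound[OF Bochner_Integration.integrable_add[OF i1 i2]], simp, intro AE_I2)
    fix x :: real
    have a: "dominant x \<le> x powr (- 7 / 8)" if "x > 0"
    proof -
      have "(1 + x) powr (- 1 / 4) \<le> 1 powr (- 1 / 4)" using that by (intro powr_mono2') auto
      then show ?thesis by (simp add: dominant_def mult_left_le)
    qed
    have b: "dominant x \<le> x powr (- 9 / 8)" if "x > 0"
    proof -
      have "dominant x \<le> x powr (- 7 / 8) * x powr (- 1 / 4)"
        unfolding dominant_def using that by (intro mult_left_mono powr_mono2') auto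
      then show ?thesis by (simp flip: powr_add)
    qed
    show "norm (indicator {0<..} x *\<^sub>R dominant x)
        \<le> norm (indicator {0<..1} x *\<^sub>R (x powr (- 7 / 8)) + indicator {1..} x *\<^sub>R (x powr (- 9 / 8)))"
      using a b dominant_nonneg[of x] by (auto simp: indicator_def intro: order_trans[OF _ add_increasing])
  qed
qed

subsection \<open>Integral representations\<close>

lemma abs_clif_le_dominant:
  assumes "X > 0"
  shows "\<bar>clif \<kappa> X\<bar> * X powr (- 7 / 8) \<le> 4 * dominant X"
  using mult_right_mono[OF clif_decay[of X \<kappa>], of "X powr (- 7 / 8)"] assms
  by (simp add: dominant_def mult_ac)

lemma clif_nonneg: "z \<le> 0 \<Longrightarrow> clif a z \<ge> 0"
  unfolding clif_def by (intro suminf_nonneg summable_clif) auto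

text \<open>A common scheme for two integrals of \<open>clif\<close>: the other factor is written as
  the Laplace transform of some w, and the Z-integral is done first by \<open>clif_Laplace\<close>.
  Hypothesis \<open>wn\<close> bounds the absolute inner integral so that, multiplied by |clif|, it
  is below a multiple of \<open>dominant\<close>; this gives absolute convergence. The weight w is
  complex because the Mellin transform needs complex powers.\<close>

lemma clif_Laplace_swap:
  fixes w :: "real \<Rightarrow> complex"
  assumes [measurable]: "w \<in> borel_measurable borel"
    and wint: "\<And>Z. Z > 0 \<Longrightarrow> integrable half_line (\<lambda>l. w l * of_real (exp (- Z * l)))"
    and wn: "\<And>Z. Z > 0 \<Longrightarrow> Z ^ \<kappa> * (\<integral>l. norm (w l * of_real (exp (- Z * l))) \<partial>half_line) \<le> C * Z powr (- 7 / 8)"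
  shows "integrable half_line (\<lambda>Z. of_real (Z ^ \<kappa> * clif \<kappa> Z) * (\<integral>l. w l * of_real (exp (- Z * l)) \<partial>half_line))"
    and "(\<integral>Z. of_real (Z ^ \<kappa> * clif \<kappa> Z) * (\<integral>l. w l * of_real (exp (- Z * l)) \<partial>half_line) \<partial>half_line)
      = (\<integral>l. w l * of_real (exp (- 1 / l) / l ^ (\<kappa> + 1)) \<partial>half_line)"
proof -
  define f where "f = (\<lambda>Z l. of_real (Z ^ \<kappa> * clif \<kappa> Z) * (w l * of_real (exp (- Z * l))))"
  have f_meas [measurable]: "case_prod f \<in> borel_measurable (half_line \<Otimes>\<^sub>M half_line)"
    unfolding f_def case_prod_unfold by measurable
  have int: "integrable (half_line \<Otimes>\<^sub>M half_line) (case_prod f)"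
  proof (rule hl_hl.Fubini_integrable[OF f_meas])
    show "AE Z in half_line. integrable half_line (\<lambda>l. case_prod f (Z, l))"
      unfolding f_def case_prod_conv by (intro AE_half_lineI integrable_mult_right wint)
    show "integrable half_line (\<lambda>Z. \<integral>l. norm (case_prod f (Z, l)) \<partial>half_line)"
    proof (rule integrable_half_line_bound[OF integrable_mult_right[OF integrable_dominant, of "C * 4"]])
      fix Z :: real assume Z: "Z > 0"
      have "norm (\<integral>l. norm (case_prod f (Z, l)) \<partial>half_line)
          = \<bar>clif \<kappa> Z\<bar> * (Z ^ \<kappa> * (\<integral>l. norm (w l * of_real (exp (- Z * l))) \<partial>half_line))"
        using Z by (simp add: f_def norm_mult norm_power integral_nonneg_AE abs_mult mult.assoc)
      also have "\<dots> \<le> \<bar>clif \<kappa> Z\<bar> * (C * Z powr (- 7 / 8))" by (intro mult_left_mono wn Z) auto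
      also have "\<dots> = C * (\<bar>clif \<kappa> Z\<bar> * Z powr (- 7 / 8))" by simp
      also have "\<dots> \<le> C * (4 * dominant Z)"
      proof -
        have "0 \<le> Z ^ \<kappa> * (\<integral>l. norm (w l * of_real (exp (- Z * l))) \<partial>half_line)"
          using Z by (intro mult_nonneg_nonneg integral_nonneg_AE) auto
        then have "0 \<le> C * Z powr (- 7 / 8)" using wn[OF Z] by linarith
        then have "0 \<le> C" using Z by (simp add: zero_le_mult_iff)
        then show ?thesis using abs_clif_le_dominant[OF Z] by (intro mult_left_mono) auto
      qed
      finally show "norm (\<integral>l. norm (case_prod f (Z, l)) \<partial>half_line) \<le> C * 4 * dominant Z" by simp
    qed measurable
  qed
  have inner: "(\<integral>l. f Z l \<partial>half_line) = of_real (Z ^ \<kappa> * clif \<kappa> Z) * (\<integral>l. w l * of_real (exp (- Z * l)) \<partial>half_line)" for Z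
    by (simp add: f_def)
  show "integrable half_line (\<lambda>Z. of_real (Z ^ \<kappa> * clif \<kappa> Z) * (\<integral>l. w l * of_real (exp (- Z * l)) \<partial>half_line))"
    using hl_hl.integrable_fst[OF int] by (simp add: inner)
  have outer: "(\<integral>Z. f Z l \<partial>half_line) = w l * of_real (exp (- 1 / l) / l ^ (\<kappa> + 1))" if "l > 0" for l
  proof -
    have "f Z l = w l * of_real (Z ^ \<kappa> * clif \<kappa> (1 * Z) * exp (- l * Z))" for Z
      by (simp add: f_def mult_ac)
    then have "(\<integral>Z. f Z l \<partial>half_line) = w l * (\<integral>Z. of_real (Z ^ \<kappa> * clif \<kappa> (1 * Z) * exp (- l * Z)) \<partial>half_line)"
      by (simp only: integral_mult_right_zero)
    also have "(\<integral>Z. of_real (Z ^ \<kappa> * clif \<kappa> (1 * Z) * exp (- l * Z)) \<partial>half_line)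
        = (of_real (exp (- 1 / l) / l ^ (\<kappa> + 1)) :: complex)"
      using clif_Laplace[OF that, of \<kappa> 1] unfolding has_bochner_integral_iff
      by (simp only: integral_complex_of_real)
    finally show ?thesis .
  qed
  have "(\<integral>l. (\<integral>Z. f Z l \<partial>half_line) \<partial>half_line) = (\<integral>Z. (\<integral>l. f Z l \<partial>half_line) \<partial>half_line)"
    by (rule hl_hl.Fubini_integral[OF int])
  with half_line_cong(2)[OF outer] show "(\<integral>Z. of_real (Z ^ \<kappa> * clif \<kappa> Z) * (\<integral>l. w l * of_real (exp (- Z * l)) \<partial>half_line) \<partial>half_line)
      = (\<integral>l. w l * of_real (exp (- 1 / l) / l ^ (\<kappa> + 1)) \<partial>half_line)"
    unfolding inner by (simp only:)
qed

text \<open>Equals 2 c^(a/2) K_a (2 sqrt c) for c > 0. The factor is written p^a / p because p^(a -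
  1) would be wrong for a = 0 under truncated subtraction.\<close>

definition macdonald :: "nat \<Rightarrow> real \<Rightarrow> real" where
  "macdonald a c = (\<integral>p. p ^ a / p * exp (- p - c / p) \<partial>half_line)"

lemma integrable_macdonald:
  assumes c: "c > 0"
  shows "integrable half_line (\<lambda>p. p ^ a / p * exp (- p - c / p))"
proof (rule integrable_half_line_bound)
  show "integrable half_line (\<lambda>p. 1 / c * (p ^ a * exp (- 1 * p)))"
    using has_bochner_integral_power_exp[of 1 a] by (intro integrable_mult_right) (auto simp: has_bochner_integral_iff)
  fix p :: real assume p: "p > 0"
  \<comment> \<open>The resulting bound exp (-c / p) <= p / c cancels the factor 1 / p at the
    origin, which matters for a = 0.\<close>
  have "c / p \<le> exp (c / p)" using exp_ge_add_one_self[of "c / p"] by linarith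
  then have "exp (- (c / p)) \<le> p / c"
    using p c by (simp add: exp_minus field_simps)
  then have "p ^ a / p * (exp (- p) * exp (- (c / p))) \<le> p ^ a / p * (exp (- p) * (p / c))"
    using p by (intro mult_left_mono) auto
  moreover have "norm (p ^ a / p * exp (- p - c / p)) = p ^ a / p * (exp (- p) * exp (- (c / p)))"
    using p by (simp add: mult_exp_exp abs_mult)
  moreover have "p ^ a / p * (exp (- p) * (p / c)) = 1 / c * (p ^ a * exp (- 1 * p))"
    using p by simp
  ultimately show "norm (p ^ a / p * exp (- p - c / p)) \<le> 1 / c * (p ^ a * exp (- 1 * p))"
    by linarith
qed (measurable)

text \<open>The substitution p = sqrt c * exp t turns the exponent into -2 sqrt c cosh t on the
  whole line; folding t onto -t makes 2 cosh (a t) out of exp (a t).\<close>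

lemma bessel_K_eq_macdonald:
  assumes c: "c > 0"
  shows "bessel_K (real a) (2 * sqrt c) = c powr (- real a / 2) / 2 * macdonald a c"
proof -
  define f where "f = (\<lambda>p :: real. p ^ a / p * exp (- p - c / p))"
  define h where "h = (\<lambda>t. exp (- (2 * sqrt c) * cosh t) * exp (real a * t) * sqrt c ^ a)"
  have img: "(\<lambda>t. sqrt c * exp t) ` UNIV = {0<..}"
  proof (intro equalityI subsetI)
    fix x :: real assume "x \<in> {0<..}"
    then show "x \<in> (\<lambda>t. sqrt c * exp t) ` UNIV" using c
      by (intro image_eqI[of _ _ "ln (x / sqrt c)"]) auto
  qed (use c in auto)
  have fg: "\<bar>sqrt c * exp t\<bar> * f (sqrt c * exp t) = h t" for t
  proof -
    have "c / (sqrt c * exp t) = sqrt c * exp (- t)"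
      using c by (simp add: exp_minus field_simps)
    moreover have "(sqrt c * exp t) ^ a = sqrt c ^ a * exp (real a * t)"
      by (simp add: power_mult_distrib exp_of_nat_mult)
    ultimately have "\<bar>sqrt c * exp t\<bar> * f (sqrt c * exp t) = sqrt c ^ a * exp (real a * t) * exp (- (sqrt c * exp t) - sqrt c * exp (- t))"
      using c by (simp add: f_def abs_mult)
    also have "- (sqrt c * exp t) - sqrt c * exp (- t) = - (2 * sqrt c) * cosh t"
      by (simp add: cosh_def algebra_simps)
    finally show ?thesis by (simp add: h_def mult_ac)
  qed
  have fm: "f \<in> borel_measurable borel" unfolding f_def by measurable
  have hm: "h \<in> borel_measurable borel"
    unfolding h_def by (intro borel_measurable_continuous_onI continuous_intros)
  have fi: "f absolutely_integrable_on {0<..}" "integral {0<..} f = macdonald a c"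
    using integrable_macdonald[OF c, of a] half_line_absolutely_integrable[OF fm]
    by (auto simp: f_def macdonald_def)
  have hi: "h absolutely_integrable_on UNIV \<and> integral UNIV h = macdonald a c"
  proof -
    have "(\<lambda>t. \<bar>sqrt c * exp t\<bar> * f (sqrt c * exp t)) absolutely_integrable_on UNIV \<and>
        integral UNIV (\<lambda>t. \<bar>sqrt c * exp t\<bar> * f (sqrt c * exp t)) = macdonald a c
      \<longleftrightarrow> f absolutely_integrable_on ((\<lambda>t. sqrt c * exp t) ` UNIV) \<and> integral ((\<lambda>t. sqrt c * exp t) ` UNIV) f = macdonald a c"
      by (rule has_absolute_integral_change_of_variables_1')
         (use c in \<open>auto intro!: derivative_eq_intros simp: inj_on_def\<close>)
    then show ?thesis using fi by (simp add: img fg)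
  qed
  have h_int: "integrable lborel h"
    using hi hm by (simp add: set_integrable_def integrable_completion)
  have h_val: "(LBINT t. h t) = macdonald a c"
    using hi set_borel_integral_eq_integral(2)[of UNIV h] h_int
    by (simp add: set_integrable_def set_lebesgue_integral_def)
  have i1: "integrable lborel (\<lambda>t. indicator {0..} t *\<^sub>R h t)" "integrable lborel (\<lambda>t. indicator {..<0} t *\<^sub>R h t)"
    by (rule integrable_mult_indicator[OF _ h_int], simp)+
  have i2: "integrable lborel (\<lambda>t. indicator {..<0} (- t) *\<^sub>R h (- t))"
    using lborel_integrable_real_affine[OF i1(2), of "-1" 0] by simp
  have "macdonald a c = (LBINT t. indicator {0..} t *\<^sub>R h t + indicator {..<0} t *\<^sub>R h t)"
    unfolding h_val[symmetric] by (intro Bochner_Integration.integral_cong) (auto simp: indicator_def)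
  also have "\<dots> = (LBINT t. indicator {0..} t *\<^sub>R h t) + (LBINT t. indicator {..<0} t *\<^sub>R h t)"
    by (rule Bochner_Integration.integral_add[OF i1])
  also have "(LBINT t. indicator {..<0} t *\<^sub>R h t) = (LBINT t. indicator {..<0} (- t) *\<^sub>R h (- t))"
    using lborel_integral_real_affine[of "-1" "\<lambda>t. indicator {..<0} t *\<^sub>R h t" 0] by simp
  also have "(LBINT t. indicator {0..} t *\<^sub>R h t) + \<dots> = (LBINT t. indicator {0..} t *\<^sub>R h t + indicator {..<0} (- t) *\<^sub>R h (- t))"
    by (rule Bochner_Integration.integral_add[OF i1(1) i2, symmetric])
  also have "\<dots> = (LBINT t. (2 * sqrt c ^ a) * (indicator {0..} t *\<^sub>R (exp (- (2 * sqrt c) * cosh t) * cosh (real a * t))))"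
  proof (rule integral_cong_AE)
    \<comment> \<open>At t = 0 the folded integrand is h 0, whereas the right-hand side is 2 h
      0.\<close>
    have "AE t in lborel. t \<noteq> (0 :: real)" by (rule AE_lborel_singleton)
    then show "AE t in lborel. indicator {0..} t *\<^sub>R h t + indicator {..<0} (- t) *\<^sub>R h (- t)
        = (2 * sqrt c ^ a) * (indicator {0..} t *\<^sub>R (exp (- (2 * sqrt c) * cosh t) * cosh (real a * t)))"
    proof eventually_elim
      case (elim t)
      have "h t + h (- t) = (2 * sqrt c ^ a) * (exp (- (2 * sqrt c) * cosh t) * cosh (real a * t))"
      proof -
        have "h t + h (- t) = exp (- (2 * sqrt c) * cosh t) * (exp (real a * t) + exp (- (real a * t))) * sqrt c ^ a"
          by (simp add: h_def algebra_simps)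
        also have "exp (real a * t) + exp (- (real a * t)) = 2 * cosh (real a * t)" by (simp add: cosh_def)
        finally show ?thesis by simp
      qed
      then show ?case using elim by (auto simp: indicator_def)
    qed
    have "(\<lambda>t. exp (- (2 * sqrt c) * cosh t) * cosh (real a * t)) \<in> borel_measurable borel"
      by (intro borel_measurable_continuous_onI continuous_intros)
    then have cm: "(\<lambda>t. exp (- (2 * sqrt c) * cosh t) * cosh (real a * t)) \<in> borel_measurable lborel" by simp
    show "(\<lambda>t. 2 * sqrt c ^ a * (indicat_real {0..} t *\<^sub>R (exp (- (2 * sqrt c) * cosh t) * cosh (real a * t)))) \<in> borel_measurable lborel"
      by (intro borel_measurable_times[OF borel_measurable_const] borel_measurable_scaleR borel_measurable_indicator cm) simp_all
  qed (use i1(1) i2 in auto)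
  also have "\<dots> = (2 * sqrt c ^ a) * bessel_K (real a) (2 * sqrt c)"
    by (simp add: bessel_K_def set_lebesgue_integral_def)
  finally have "macdonald a c = (2 * sqrt c ^ a) * bessel_K (real a) (2 * sqrt c)" .
  moreover have "sqrt c ^ a = c powr (real a / 2)"
    using c by (simp add: powr_half_sqrt[symmetric] powr_powr flip: powr_realpow)
  ultimately show ?thesis using c by (simp add: powr_minus field_simps)
qed

text \<open>A form of the Hankel-Sonine integral for K_a: the power of 1 / (Z + c) is a Gamma
  integral over l, the Z-integral is \<open>clif_Laplace\<close>, and p = c l gives back
  \<open>macdonald\<close>. The index \<kappa> is free; for the order a = \<nu> - \<kappa> + j of
  the weights it makes the prefactor (\<nu> + j)!, exactly the factorial in the Laguerre
  coefficients.\<close>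

lemma macdonald_eq_clif:
  assumes c: "c > 0"
  shows "integrable half_line (\<lambda>Z. Z ^ \<kappa> * clif \<kappa> Z / (Z + c) ^ (a + \<kappa> + 1))"
    and "macdonald a c = fact (a + \<kappa>) * c ^ a * (\<integral>Z. Z ^ \<kappa> * clif \<kappa> Z / (Z + c) ^ (a + \<kappa> + 1) \<partial>half_line)"
proof -
  define w where "w = (\<lambda>l. of_real (l ^ (a + \<kappa>) * exp (- c * l)) :: complex)"
  define g where "g = (\<lambda>Z. Z ^ \<kappa> * clif \<kappa> Z / (Z + c) ^ (a + \<kappa> + 1))"
  have [measurable]: "w \<in> borel_measurable borel" unfolding w_def by measurable
  have weq: "w l * of_real (exp (- Z * l)) = of_real (l ^ (a + \<kappa>) * exp (- (Z + c) * l))" for Z l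
    by (simp add: w_def mult_exp_exp algebra_simps flip: of_real_mult)
  have hb: "has_bochner_integral half_line (\<lambda>l. l ^ (a + \<kappa>) * exp (- (Z + c) * l)) (fact (a + \<kappa>) / (Z + c) ^ (a + \<kappa> + 1))"
    if "Z > 0" for Z using that c by (intro has_bochner_integral_power_exp) auto
  have iw: "integrable half_line (\<lambda>l. w l * of_real (exp (- Z * l)))"
    and vw: "(\<integral>l. w l * of_real (exp (- Z * l)) \<partial>half_line) = of_real (fact (a + \<kappa>) / (Z + c) ^ (a + \<kappa> + 1))"
    if "Z > 0" for Z
    unfolding weq using hb[OF that] by (auto simp only: has_bochner_integral_iff integral_complex_of_real intro!: integrable_of_real)
  have bound: "Z ^ \<kappa> * (\<integral>l. norm (w l * of_real (exp (- Z * l))) \<partial>half_line)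
      \<le> (fact (a + \<kappa>) * (1 / c) ^ a * (1 + 1 / c)) * Z powr (- 7 / 8)" if Z: "Z > 0" for Z
  proof -
    have "(\<integral>l. norm (w l * of_real (exp (- Z * l))) \<partial>half_line) = (\<integral>l. l ^ (a + \<kappa>) * exp (- (Z + c) * l) \<partial>half_line)"
      unfolding weq by (rule half_line_cong(2)) (simp add: abs_mult norm_mult norm_power)
    also have "\<dots> = fact (a + \<kappa>) / (Z + c) ^ (a + \<kappa> + 1)" using hb[OF Z] by (simp only: has_bochner_integral_iff)
    finally have "Z ^ \<kappa> * (\<integral>l. norm (w l * of_real (exp (- Z * l))) \<partial>half_line)
        = fact (a + \<kappa>) * ((Z / (Z + c)) ^ \<kappa> * ((1 / (Z + c)) ^ a * (1 / (Z + c))))"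
      by (simp add: power_add power_divide mult_ac)
    also have "\<dots> \<le> fact (a + \<kappa>) * (1 * ((1 / c) ^ a * ((1 + 1 / c) * Z powr (- 7 / 8))))"
    proof (intro mult_left_mono mult_mono power_mono power_le_one)
      \<comment> \<open>Split at Z = 1: the left side is at most 1 below and at most Z above; the
        summands 1 / c and 1 of the constant serve these two cases.\<close>
      have "Z powr (7 / 8) \<le> (1 + 1 / c) * (Z + c)"
      proof (cases "Z \<le> 1")
        case True
        then have "Z powr (7 / 8) \<le> 1" using Z powr_mono2[of "7/8" Z 1] by simp
        also have "1 \<le> 1 / c * (Z + c)" using Z c by (simp add: field_simps)
        also have "\<dots> \<le> (1 + 1 / c) * (Z + c)" using Z c by (intro mult_right_mono) auto
        finally show ?thesis .
      next
        case False
        then have "Z powr (7 / 8) \<le> 1 * (Z + c)" using powr_mono[of "7/8" 1 Z] c by simp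
        also have "\<dots> \<le> (1 + 1 / c) * (Z + c)" using Z c by (intro mult_right_mono) auto
        finally show ?thesis .
      qed
      then show "1 / (Z + c) \<le> (1 + 1 / c) * Z powr (- 7 / 8)"
        using Z c by (simp add: powr_minus field_simps)
    qed (use Z c in \<open>auto simp: frac_le\<close>)
    finally show ?thesis by (simp add: mult_ac)
  qed
  note swap = clif_Laplace_swap[of w \<kappa>, OF _ iw bound]
  have eqg: "of_real (Z ^ \<kappa> * clif \<kappa> Z) * (\<integral>l. w l * of_real (exp (- Z * l)) \<partial>half_line) = of_real (fact (a + \<kappa>) * g Z)"
    if "Z > 0" for Z
    using vw[OF that] by (simp add: g_def)
  have "integrable half_line (\<lambda>Z. of_real (fact (a + \<kappa>) * g Z) :: complex)"
    using swap(1) half_line_cong(1)[OF eqg] by simp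
  then have "integrable half_line (\<lambda>Z. 1 / fact (a + \<kappa>) * (fact (a + \<kappa>) * g Z))"
    unfolding complex_of_real_integrable_eq by (rule integrable_mult_right)
  then show "integrable half_line g" by simp
  have "complex_of_real (fact (a + \<kappa>) * (\<integral>Z. g Z \<partial>half_line)) = (\<integral>Z. of_real (fact (a + \<kappa>) * g Z) \<partial>half_line)"
    by (simp only: integral_complex_of_real integral_mult_right_zero)
  also have "\<dots> = (\<integral>l. w l * of_real (exp (- 1 / l) / l ^ (\<kappa> + 1)) \<partial>half_line)"
    using swap(2) half_line_cong(2)[OF eqg] by simp
  also have "\<dots> = (\<integral>l. of_real (l ^ a / l * exp (- c * l - 1 / l)) \<partial>half_line)"
  proof (rule half_line_cong(2))
    fix l :: real assume l: "l > 0"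
    have e: "exp (- c * l - 1 / l) = exp (- c * l) * exp (- 1 / l)" by (simp add: mult_exp_exp)
    show "w l * of_real (exp (- 1 / l) / l ^ (\<kappa> + 1)) = of_real (l ^ a / l * exp (- c * l - 1 / l))"
      unfolding w_def e of_real_mult[symmetric] of_real_eq_iff using l by (simp add: power_add)
  qed
  finally have 1: "fact (a + \<kappa>) * (\<integral>Z. g Z \<partial>half_line) = (\<integral>l. l ^ a / l * exp (- c * l - 1 / l) \<partial>half_line)"
    by (simp only: integral_complex_of_real of_real_eq_iff)
  have "macdonald a c = c *\<^sub>R (\<integral>l. (c * l) ^ a / (c * l) * exp (- (c * l) - c / (c * l)) \<partial>half_line)"
    unfolding macdonald_def by (rule half_line_scale(2)[OF c])
  also have "(\<integral>l. (c * l) ^ a / (c * l) * exp (- (c * l) - c / (c * l)) \<partial>half_line)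
      = (\<integral>l. (c ^ a / c) * (l ^ a / l * exp (- c * l - 1 / l)) \<partial>half_line)"
    using c by (intro half_line_cong(2)) (simp add: power_mult_distrib)
  also have "c *\<^sub>R \<dots> = c ^ a * (\<integral>l. l ^ a / l * exp (- c * l - 1 / l) \<partial>half_line)"
    unfolding integral_mult_right_zero using c by simp
  finally show "macdonald a c = fact (a + \<kappa>) * c ^ a * (\<integral>Z. g Z \<partial>half_line)"
    unfolding 1[symmetric] by simp
qed

text \<open>With the integral for \<open>macdonald\<close> inserted, the x-integral is
  \<open>clif_Laplace\<close> at rate \<beta>^2 / t, and \<alpha> < \<beta> makes the remaining
  t-integral a convergent Gamma integral. Since \<open>clif\<close> is nonnegative at negative
  arguments, the same computation supplies the absolute integrability for Fubini.\<close>

lemma clif_macdonald_integral: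
  assumes a: "\<alpha> > 0" "\<alpha> < \<beta>"
  shows "has_bochner_integral half_line (\<lambda>x. x ^ b * clif b (- (\<alpha>\<^sup>2 * x)) * macdonald a (\<beta>\<^sup>2 * x))
    (fact (a + b) / (\<beta>\<^sup>2 ^ (b + 1) * (1 - \<alpha>\<^sup>2 / \<beta>\<^sup>2) ^ (a + b + 1)))"
proof -
  define w where "w = 1 - \<alpha>\<^sup>2 / \<beta>\<^sup>2"
  have b: "\<beta>\<^sup>2 > 0" using a by simp
  have w: "w > 0" using a b by (simp add: w_def power_strict_mono)
  define f where "f = (\<lambda>t x. (t ^ a / t * exp (- t)) * (x ^ b * clif b ((- \<alpha>\<^sup>2) * x) * exp (- (\<beta>\<^sup>2 / t) * x)))"
  have [measurable]: "case_prod f \<in> borel_measurable (half_line \<Otimes>\<^sub>M half_line)"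
    unfolding f_def case_prod_unfold by measurable
  have ft: "has_bochner_integral half_line (f t) (t ^ (a + b) * exp (- w * t) / \<beta>\<^sup>2 ^ (b + 1))" if t: "t > 0" for t
  proof -
    have "has_bochner_integral half_line (f t) ((t ^ a / t * exp (- t)) * (exp (- (- \<alpha>\<^sup>2) / (\<beta>\<^sup>2 / t)) / (\<beta>\<^sup>2 / t) ^ (b + 1)))"
      unfolding f_def using t b by (intro has_bochner_integral_mult_right clif_Laplace) simp
    also have "(t ^ a / t * exp (- t)) * (exp (- (- \<alpha>\<^sup>2) / (\<beta>\<^sup>2 / t)) / (\<beta>\<^sup>2 / t) ^ (b + 1))
        = (t ^ a / t * t ^ (b + 1)) * (exp (- t) * exp (\<alpha>\<^sup>2 / \<beta>\<^sup>2 * t)) / \<beta>\<^sup>2 ^ (b + 1)"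
      by (simp add: power_divide)
    also have "t ^ a / t * t ^ (b + 1) = t ^ (a + b)" using t by (simp add: power_add)
    also have "exp (- t) * exp (\<alpha>\<^sup>2 / \<beta>\<^sup>2 * t) = exp (- w * t)"
      unfolding mult_exp_exp by (simp add: w_def algebra_simps)
    finally show ?thesis .
  qed
  have nonneg: "f t x \<ge> 0" if "t > 0" "x > 0" for t x
  proof -
    have "clif b (- \<alpha>\<^sup>2 * x) \<ge> 0" using that by (intro clif_nonneg) simp
    then show ?thesis using that unfolding f_def by (intro mult_nonneg_nonneg) auto
  qed
  have hb: "has_bochner_integral half_line (\<lambda>t. t ^ (a + b) * exp (- w * t) / \<beta>\<^sup>2 ^ (b + 1)) (fact (a + b) / w ^ (a + b + 1) / \<beta>\<^sup>2 ^ (b + 1))"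
    by (intro has_bochner_integral_divide_zero has_bochner_integral_power_exp w)
  have int: "integrable (half_line \<Otimes>\<^sub>M half_line) (case_prod f)"
  proof (rule hl_hl.Fubini_integrable)
    show "AE t in half_line. integrable half_line (\<lambda>x. case_prod f (t, x))"
      using ft by (intro AE_half_lineI) (auto simp: has_bochner_integral_iff)
    have "(\<integral>x. norm (case_prod f (t, x)) \<partial>half_line) = t ^ (a + b) * exp (- w * t) / \<beta>\<^sup>2 ^ (b + 1)" if t: "t > 0" for t
    proof -
      have "(\<integral>x. norm (case_prod f (t, x)) \<partial>half_line) = (\<integral>x. f t x \<partial>half_line)"
        using nonneg[OF t] by (intro half_line_cong(2)) simp
      then show ?thesis using ft[OF t] by (simp only: has_bochner_integral_iff)
    qed
    then have *: "integrable half_line (\<lambda>t. \<integral>x. norm (case_prod f (t, x)) \<partial>half_line)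
        \<longleftrightarrow> integrable half_line (\<lambda>t. t ^ (a + b) * exp (- w * t) / \<beta>\<^sup>2 ^ (b + 1))"
      by (rule half_line_cong(1))
    show "integrable half_line (\<lambda>t. \<integral>x. norm (case_prod f (t, x)) \<partial>half_line)"
      by (rule iffD2[OF *]) (use hb in \<open>simp only: has_bochner_integral_iff\<close>)
  qed measurable
  have inner: "(\<integral>t. f t x \<partial>half_line) = x ^ b * clif b (- (\<alpha>\<^sup>2 * x)) * macdonald a (\<beta>\<^sup>2 * x)" for x
  proof -
    have "f t x = x ^ b * clif b (- (\<alpha>\<^sup>2 * x)) * (t ^ a / t * exp (- t - \<beta>\<^sup>2 * x / t))" for t
      by (simp add: f_def exp_diff exp_minus divide_inverse mult_ac)
    then show ?thesis by (simp only: macdonald_def integral_mult_right_zero)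
  qed
  have "integrable half_line (\<lambda>x. \<integral>t. f t x \<partial>half_line)"
    using hl_hl.integrable_snd[OF int] .
  moreover have "(\<integral>x. (\<integral>t. f t x \<partial>half_line) \<partial>half_line) = (\<integral>t. (\<integral>x. f t x \<partial>half_line) \<partial>half_line)"
    by (rule hl_hl.Fubini_integral[OF int])
  moreover have "\<dots> = (\<integral>t. t ^ (a + b) * exp (- w * t) / \<beta>\<^sup>2 ^ (b + 1) \<partial>half_line)"
    by (rule half_line_cong(2)) (use ft in \<open>simp only: has_bochner_integral_iff\<close>)
  moreover have "\<dots> = fact (a + b) / w ^ (a + b + 1) / \<beta>\<^sup>2 ^ (b + 1)"
    using hb by (simp only: has_bochner_integral_iff)
  ultimately show ?thesis by (simp add: inner has_bochner_integral_iff w_def mult_ac)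
qed

lemma of_real_powr_exp: "x > 0 \<Longrightarrow> of_real x powr w = exp (w * complex_of_real (ln x))"
  by (simp add: powr_def Ln_of_real)

lemma of_real_power_exp: "x > 0 \<Longrightarrow> complex_of_real (x ^ n) = exp (of_nat n * complex_of_real (ln x))"
  by (simp add: exp_of_nat_mult exp_of_real)

lemma norm_of_real_powr: "x > 0 \<Longrightarrow> norm (of_real x powr w :: complex) = x powr Re w"
  by (simp add: norm_of_real_powr_exp powr_def)

text \<open>With s' = \<kappa> + 1 - s, the power Z powr (s - 1) is Z^\<kappa> * Z powr (-s'), and
  Gamma s' * Z powr (-s') is the Laplace transform of l powr (s' - 1). The swap then leaves an
  integral that l -> 1 / l turns into Gamma s.\<close>

lemma clif_Mellin:
  assumes s: "Re s = 1 / 8"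
  shows "(\<integral>X. of_real (clif \<kappa> X) * of_real X powr (s - 1) \<partial>half_line) = Gamma s * rGamma (of_nat \<kappa> + 1 - s)"
proof -
  define w where "w = (\<lambda>l. of_real l powr (of_nat \<kappa> + 1 - s - 1) :: complex)"
  define s' where "s' = of_nat \<kappa> + 1 - s"
  \<comment> \<open>The real part of s' as a complex number: the modulus of the integrand is the
    same Gamma integrand with s' replaced by its real part.\<close>
  define r :: complex where "r = of_real (real \<kappa> + 7 / 8)"
  have Re_s': "Re s' = real \<kappa> + 7 / 8" using s by (simp add: s'_def)
  have [measurable]: "w \<in> borel_measurable borel" unfolding w_def by measurable
  have hb: "has_bochner_integral half_line (\<lambda>l. w l * of_real (exp (- Z * l))) (Gamma s' * of_real Z powr (- s'))"
    if "Z > 0" for Z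
    unfolding w_def s'_def using that s by (intro has_bochner_integral_Gamma) auto
  have bound: "Z ^ \<kappa> * (\<integral>l. norm (w l * of_real (exp (- Z * l))) \<partial>half_line) \<le> Gamma (real \<kappa> + 7 / 8) * Z powr (- 7 / 8)"
    if Z: "Z > 0" for Z
  proof -
    have "complex_of_real (\<integral>l. norm (w l * of_real (exp (- Z * l))) \<partial>half_line)
        = (\<integral>l. of_real (norm (w l * of_real (exp (- Z * l)))) \<partial>half_line)"
      by (rule integral_complex_of_real[symmetric])
    also have "\<dots> = (\<integral>l. of_real l powr (r - 1) * of_real (exp (- Z * l)) \<partial>half_line)"
    proof (rule half_line_cong(2))
      fix l :: real assume l: "l > 0"
      have "norm (w l) = l powr (real \<kappa> - 1 / 8)" using l by (simp add: w_def norm_of_real_powr s)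
      moreover have r1: "r - 1 = complex_of_real (real \<kappa> - 1 / 8)" by (simp add: r_def)
      have "of_real l powr (r - 1) = complex_of_real (l powr (real \<kappa> - 1 / 8))"
        unfolding r1 by (rule powr_of_real) (use l in simp)
      ultimately show "of_real (norm (w l * of_real (exp (- Z * l)))) = of_real l powr (r - 1) * complex_of_real (exp (- Z * l))"
        by (simp add: norm_mult)
    qed
    also have "\<dots> = Gamma r * of_real Z powr (- r)"
      using has_bochner_integral_Gamma[of r Z] Z by (simp add: has_bochner_integral_iff r_def)
    also have "\<dots> = of_real (Gamma (real \<kappa> + 7 / 8) * Z powr (- (real \<kappa> + 7 / 8)))"
      unfolding r_def of_real_minus[symmetric] of_real_mult Gamma_complex_of_real
      by (subst powr_of_real) (use Z in simp_all)
    finally have "(\<integral>l. norm (w l * of_real (exp (- Z * l))) \<partial>half_line) = Gamma (real \<kappa> + 7 / 8) * Z powr (- (real \<kappa> + 7 / 8))"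
      by (simp only: of_real_eq_iff)
    moreover have "Z ^ \<kappa> * Z powr (- (real \<kappa> + 7 / 8)) = Z powr (- 7 / 8)"
      using Z by (simp flip: powr_realpow powr_add)
    ultimately show ?thesis by (simp add: mult.left_commute)
  qed
  have "Gamma s' * (\<integral>X. of_real (clif \<kappa> X) * of_real X powr (s - 1) \<partial>half_line)
      = (\<integral>Z. Gamma s' * (of_real (clif \<kappa> Z) * of_real Z powr (s - 1)) \<partial>half_line)" by simp
  also have "\<dots> = (\<integral>Z. of_real (Z ^ \<kappa> * clif \<kappa> Z) * (\<integral>l. w l * of_real (exp (- Z * l)) \<partial>half_line) \<partial>half_line)"
  proof (rule half_line_cong(2))
    fix Z :: real assume Z: "Z > 0"
    have "complex_of_real (Z ^ \<kappa>) * of_real Z powr (- s') = of_real Z powr (s - 1)"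
      unfolding of_real_powr_exp[OF Z] of_real_power_exp[OF Z] mult_exp_exp by (simp add: s'_def algebra_simps)
    then have "of_real Z powr (s - 1) = complex_of_real (Z ^ \<kappa>) * of_real Z powr (- s')" by simp
    then show "Gamma s' * (of_real (clif \<kappa> Z) * of_real Z powr (s - 1))
        = of_real (Z ^ \<kappa> * clif \<kappa> Z) * (\<integral>l. w l * of_real (exp (- Z * l)) \<partial>half_line)"
      using hb[OF Z] by (simp only: has_bochner_integral_iff of_real_mult mult_ac)
  qed
  also have "\<dots> = (\<integral>l. w l * of_real (exp (- 1 / l) / l ^ (\<kappa> + 1)) \<partial>half_line)"
    by (rule clif_Laplace_swap(2)[OF _ _ bound]) (use hb in \<open>auto simp: has_bochner_integral_iff\<close>)
  \<comment> \<open>The total power of l is -s - 1, that is, (1 / l) powr (s - 1) times the Jacobian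
    1 / l^2.\<close>
  also have "\<dots> = (\<integral>l. (of_real (1 / l) powr (s - 1) * of_real (exp (- 1 * (1 / l)))) / of_real (l\<^sup>2) \<partial>half_line)"
  proof (rule half_line_cong(2))
    fix l :: real assume l: "l > 0"
    then have l1: "1 / l > 0" by simp
    have "of_real l powr (of_nat \<kappa> + 1 - s - 1) / of_real (l ^ (\<kappa> + 1)) = of_real (1 / l) powr (s - 1) / complex_of_real (l\<^sup>2)"
      unfolding of_real_powr_exp[OF l] of_real_power_exp[OF l] of_real_powr_exp[OF l1]
        exp_diff[symmetric] using l by (simp add: ln_div algebra_simps)
    then have e: "w l / of_real (l ^ (\<kappa> + 1)) = of_real (1 / l) powr (s - 1) / complex_of_real (l\<^sup>2)"
      by (simp only: w_def)
    have "w l * of_real (exp (- 1 / l) / l ^ (\<kappa> + 1)) = w l / of_real (l ^ (\<kappa> + 1)) * of_real (exp (- 1 / l))"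
      by (simp only: of_real_divide) simp
    then show "w l * of_real (exp (- 1 / l) / l ^ (\<kappa> + 1))
        = (of_real (1 / l) powr (s - 1) * of_real (exp (- 1 * (1 / l)))) / of_real (l\<^sup>2)"
      unfolding e by simp
  qed
  also have "\<dots> = (\<integral>l. of_real l powr (s - 1) * of_real (exp (- 1 * l)) \<partial>half_line)"
    using has_bochner_integral_Gamma[of s 1] s
    by (intro half_line_inverse(2)) (auto simp: has_bochner_integral_iff)
  also have "\<dots> = Gamma s"
    using has_bochner_integral_Gamma[of s 1] s by (simp add: has_bochner_integral_iff)
  finally have "Gamma s' * (\<integral>X. of_real (clif \<kappa> X) * of_real X powr (s - 1) \<partial>half_line) = Gamma s" .
  moreover have "Gamma s' \<noteq> 0"
  proof -
    have "s' \<notin> \<int>\<^sub>\<le>\<^sub>0" using Re_s' by (auto elim!: nonpos_Ints_cases')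
    then show ?thesis by (simp add: Gamma_eq_zero_iff)
  qed
  ultimately show ?thesis unfolding s'_def[symmetric]
    by (simp add: rGamma_inverse_Gamma field_simps)
qed

subsection \<open>The second Meijer function\<close>

text \<open>Up to powers of z a multiplicative convolution of \<open>clif \<kappa>\<close> with the
  exponential, so its Mellin transform is a product of Gamma quotients. The integral is the one that
  the second kernel factor approaches.\<close>

definition meijer_G2_real :: "nat \<Rightarrow> nat \<Rightarrow> real \<Rightarrow> real" where
  "meijer_G2_real \<nu> \<kappa> z = z ^ \<nu> * (\<integral>X. clif \<kappa> X / X ^ (\<nu> - \<kappa> + 1) * exp (- z / X) \<partial>half_line)"

text \<open>Both sides are iterated integrals of f over X and t. Integrating over X first gives the
  Meijer integrand by \<open>clif_Mellin\<close>; integrating over t first gives exp (-z / X) by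
  \<open>Cahen_Mellin\<close>.\<close>

lemma meijer_G_2_eq:
  fixes z :: real
  assumes z: "z > 0" and le: "\<kappa> \<le> \<nu>"
  shows "meijer_G 2 [of_nat \<nu>, of_nat \<kappa>, 0] (of_real z) = of_real (meijer_G2_real \<nu> \<kappa> z)"
proof -
  define \<mu> where "\<mu> = \<nu> - \<kappa>"
  define s where "s = (\<lambda>t. Complex (1 / 8) t)"
  define f where "f = (\<lambda>X t. of_real (clif \<kappa> X) * of_real X powr (s t - 1) * (Gamma (of_nat \<mu> + s t) * of_real z powr (of_nat \<kappa> - s t)))"
  have cs: "continuous_on UNIV s" unfolding s_def Complex_eq by (intro continuous_intros)
  then have [measurable]: "s \<in> borel_measurable borel" by (rule borel_measurable_continuous_onI)
  have sc: "of_nat \<mu> + s t = Complex (real \<mu> + 1 / 8) t" for t by (simp add: s_def complex_eq_iff)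
  have CM1: "integrable lborel (\<lambda>t. Gamma (of_nat \<mu> + s t) * of_real q powr (- (of_nat \<mu> + s t)))"
    and CM2: "(LBINT t. Gamma (of_nat \<mu> + s t) * of_real q powr (- (of_nat \<mu> + s t))) = 2 * of_real pi * exp (- of_real q)"
    if "q > 0" for q
    unfolding sc by (rule Cahen_Mellin[OF that]; simp)+
  \<comment> \<open>At q = 1 the power is 1, so integrability of Gamma itself on the line
    follows.\<close>
  have iG: "integrable lborel (\<lambda>t. norm (Gamma (of_nat \<mu> + s t)))"
    using integrable_norm[OF CM1[of 1]] by simp
  have [measurable]: "(\<lambda>t. Gamma (of_nat \<mu> + s t)) \<in> borel_measurable borel"
    using borel_measurable_integrable[OF CM1[of 1]] by simp
  have f_meas [measurable]: "case_prod f \<in> borel_measurable (half_line \<Otimes>\<^sub>M lborel)"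
    unfolding f_def case_prod_unfold by measurable
  have nf: "norm (f X t) = (\<bar>clif \<kappa> X\<bar> * X powr (- 7 / 8) * z powr (real \<kappa> - 1 / 8)) * norm (Gamma (of_nat \<mu> + s t))" if "X > 0" for X t
    using that z by (simp add: f_def norm_mult norm_of_real_powr s_def)
  have ft: "f X t = (of_real (clif \<kappa> X / X ^ (\<mu> + 1) * z ^ \<nu>)) * (Gamma (of_nat \<mu> + s t) * of_real (z / X) powr (- (of_nat \<mu> + s t)))"
    if X: "X > 0" for X t
  proof -
    have "of_real X powr (s t - 1) * of_real z powr (of_nat \<kappa> - s t)
        = (of_real (z ^ \<nu>) / of_real (X ^ (\<mu> + 1))) * of_real (z / X) powr (- (of_nat \<mu> + s t))"
      unfolding of_real_powr_exp[OF X] of_real_powr_exp[OF z] of_real_power_exp[OF X] of_real_power_exp[OF z]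
        of_real_powr_exp[OF divide_pos_pos[OF z X]] exp_diff[symmetric] mult_exp_exp
      using X z le by (simp add: ln_div \<mu>_def of_nat_diff algebra_simps)
    then show ?thesis by (simp add: f_def mult_ac)
  qed
  have int: "integrable (half_line \<Otimes>\<^sub>M lborel) (case_prod f)"
  proof (rule hl_lborel.Fubini_integrable[OF f_meas])
    show "AE X in half_line. integrable lborel (\<lambda>t. case_prod f (X, t))"
    proof (rule AE_half_lineI)
      fix X :: real assume X: "X > 0"
      show "integrable lborel (\<lambda>t. case_prod f (X, t))"
        unfolding case_prod_conv ft[OF X] by (intro integrable_mult_right CM1 divide_pos_pos z X)
    qed
    define I where "I = (LBINT t. norm (Gamma (of_nat \<mu> + s t)))"
    have I0: "I \<ge> 0" unfolding I_def by (rule integral_nonneg_AE) auto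
    show "integrable half_line (\<lambda>X. LBINT t. norm (case_prod f (X, t)))"
    proof (rule integrable_half_line_bound[OF integrable_mult_right[OF integrable_dominant, of "4 * z powr (real \<kappa> - 1 / 8) * I"]])
      fix X :: real assume X: "X > 0"
      have "norm (LBINT t. norm (case_prod f (X, t))) = (\<bar>clif \<kappa> X\<bar> * X powr (- 7 / 8)) * (z powr (real \<kappa> - 1 / 8) * I)"
        unfolding case_prod_conv nf[OF X] integral_mult_right_zero I_def[symmetric] using I0 by (simp add: abs_mult)
      also have "\<dots> \<le> (4 * dominant X) * (z powr (real \<kappa> - 1 / 8) * I)"
        using I0 abs_clif_le_dominant[OF X] by (intro mult_right_mono) auto
      finally show "norm (LBINT t. norm (case_prod f (X, t))) \<le> 4 * z powr (real \<kappa> - 1 / 8) * I * dominant X"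
        by (simp add: mult_ac)
    qed measurable
  qed
  have "(LBINT t. (\<integral>X. f X t \<partial>half_line)) = (\<integral>X. (LBINT t. f X t) \<partial>half_line)"
    by (rule hl_lborel.Fubini_integral[OF int])
  also have "\<dots> = (\<integral>X. of_real ((2 * pi * z ^ \<nu>) * (clif \<kappa> X / X ^ (\<nu> - \<kappa> + 1) * exp (- z / X))) \<partial>half_line)"
  proof (rule half_line_cong(2))
    fix X :: real assume X: "X > 0"
    have "(LBINT t. f X t) = of_real (clif \<kappa> X / X ^ (\<mu> + 1) * z ^ \<nu>) * (2 * of_real pi * exp (- of_real (z / X)))"
      unfolding ft[OF X] integral_mult_right_zero by (simp only: CM2 divide_pos_pos[OF z X])
    then show "(LBINT t. f X t) = of_real ((2 * pi * z ^ \<nu>) * (clif \<kappa> X / X ^ (\<nu> - \<kappa> + 1) * exp (- z / X)))"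
      by (simp add: \<mu>_def exp_of_real[symmetric] mult_ac)
  qed
  also have "\<dots> = of_real (2 * pi * meijer_G2_real \<nu> \<kappa> z)"
    unfolding integral_complex_of_real integral_mult_right_zero by (simp add: meijer_G2_real_def)
  finally have A: "(LBINT t. (\<integral>X. f X t \<partial>half_line)) = of_real (2 * pi * meijer_G2_real \<nu> \<kappa> z)" .
  \<comment> \<open>With u = s - \<kappa> the Mellin line Re s = 1/8 becomes Re u = 1/8 - \<kappa>,
    still to the right of all poles.\<close>
  define \<sigma> where "\<sigma> = 1 / 8 - real \<kappa>"
  have inner: "(\<integral>X. f X t \<partial>half_line) = Gamma (of_nat \<nu> + Complex \<sigma> t) * Gamma (of_nat \<kappa> + Complex \<sigma> t) * rGamma (1 - Complex \<sigma> t)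
      * of_real z powr (- Complex \<sigma> t)" for t
  proof -
    have e: "of_nat \<nu> + Complex \<sigma> t = of_nat \<mu> + s t" "of_nat \<kappa> + Complex \<sigma> t = s t"
      "1 - Complex \<sigma> t = of_nat \<kappa> + 1 - s t" "- Complex \<sigma> t = of_nat \<kappa> - s t"
      using le by (auto simp: \<sigma>_def s_def \<mu>_def complex_eq_iff of_nat_diff)
    have "(\<integral>X. f X t \<partial>half_line) = (\<integral>X. of_real (clif \<kappa> X) * of_real X powr (s t - 1) \<partial>half_line)
        * (Gamma (of_nat \<mu> + s t) * of_real z powr (of_nat \<kappa> - s t))"
      unfolding f_def by (rule integral_mult_left_zero)
    also have "\<dots> = Gamma (s t) * rGamma (of_nat \<kappa> + 1 - s t) * (Gamma (of_nat \<mu> + s t) * of_real z powr (of_nat \<kappa> - s t))"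
      by (subst clif_Mellin) (simp_all add: s_def)
    finally show ?thesis unfolding e by (simp add: mult_ac)
  qed
  have "meijer_G 2 [of_nat \<nu>, of_nat \<kappa>, 0] (of_real z) = 1 / (2 * of_real pi) * (LBINT t. (\<integral>X. f X t \<partial>half_line))"
    unfolding inner by (rule meijer_G_2_eq_vertical_line[OF z _ _ le]) (simp_all add: \<sigma>_def)
  then show ?thesis unfolding A by simp
qed

subsection \<open>The correlation kernel\<close>

text \<open>In matrix form C H D^T = 1 with square factors, hence D^T C is the inverse of H,
  whichever pair C, D is chosen. The kernel has the entries of D^T C as coefficients, so it may be
  computed from any biorthogonal pair.\<close>

lemma biorthogonal_coefficients_unique:
  fixes c d c' d' h :: "nat \<Rightarrow> nat \<Rightarrow> real"
  assumes "\<And>k l. k < n \<Longrightarrow> l < n \<Longrightarrow> (\<Sum>i<n. \<Sum>j<n. c k i * h i j * d l j) = (if k = l then 1 else 0)"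
    and "\<And>k l. k < n \<Longrightarrow> l < n \<Longrightarrow> (\<Sum>i<n. \<Sum>j<n. c' k i * h i j * d' l j) = (if k = l then 1 else 0)"
    and "i < n" "j < n"
  shows "(\<Sum>k<n. c k i * d k j) = (\<Sum>k<n. c' k i * d' k j)"
proof -
  define M where "M = (\<lambda>f :: nat \<Rightarrow> nat \<Rightarrow> real. mat n n (\<lambda>(i, j). f i j))"
  have carr [simp]: "M f \<in> carrier_mat n n" for f by (simp add: M_def)
  have mult: "M f * M g = M (\<lambda>i j. \<Sum>k<n. f i k * g k j)" for f g
    by (rule eq_matI) (auto simp: M_def scalar_prod_def atLeast0LessThan)
  have tr: "transpose_mat (M f) = M (\<lambda>i j. f j i)" for f
    by (rule eq_matI) (auto simp: M_def)
  have Mcong: "M f = M g" if "\<And>i j. i < n \<Longrightarrow> j < n \<Longrightarrow> f i j = g i j" for f g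
    by (rule eq_matI) (use that in \<open>auto simp: M_def\<close>)
  have one: "M (\<lambda>i j. if i = j then 1 else 0) = 1\<^sub>m n" by (rule eq_matI) (auto simp: M_def)
  define H where "H = M h"
  have inv: "(transpose_mat (M d) * M c) * H = 1\<^sub>m n \<and> H * (transpose_mat (M d) * M c) = 1\<^sub>m n"
    if bi: "\<And>k l. k < n \<Longrightarrow> l < n \<Longrightarrow> (\<Sum>i<n. \<Sum>j<n. c k i * h i j * d l j) = (if k = l then 1 else 0)" for c d
  proof -
    have cH: "M c * H \<in> carrier_mat n n" "transpose_mat (M d) \<in> carrier_mat n n" "H \<in> carrier_mat n n"
      "transpose_mat (M d) * M c \<in> carrier_mat n n" by (auto simp: H_def tr mult)
    have "(M c * H) * transpose_mat (M d) = M (\<lambda>k l. \<Sum>j<n. \<Sum>i<n. c k i * h i j * d l j)"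
      unfolding H_def tr mult by (simp add: sum_distrib_right)
    also have "\<dots> = 1\<^sub>m n"
      unfolding one[symmetric] by (rule Mcong) (subst sum.swap, use bi in simp)
    finally have "transpose_mat (M d) * (M c * H) = 1\<^sub>m n"
      by (rule mat_mult_left_right_inverse[OF cH(1,2)])
    then have l: "(transpose_mat (M d) * M c) * H = 1\<^sub>m n"
      by (simp only: assoc_mult_mat[OF cH(2) carr cH(3)])
    then show ?thesis using mat_mult_left_right_inverse[OF cH(4,3)] by blast
  qed
  define X where "X = transpose_mat (M d) * M c"
  define Y where "Y = transpose_mat (M d') * M c'"
  have XY: "X \<in> carrier_mat n n" "Y \<in> carrier_mat n n" "H \<in> carrier_mat n n"
    by (auto simp: X_def Y_def H_def tr mult)
  have XH: "X * H = 1\<^sub>m n" unfolding X_def using inv[of c d, OF assms(1)] by blast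
  have HY: "H * Y = 1\<^sub>m n" unfolding Y_def using inv[of c' d', OF assms(2)] by blast
  have "X = X * (H * Y)" using HY XY by simp
  also have "\<dots> = (X * H) * Y" by (rule assoc_mult_mat[OF XY(1,3,2), symmetric])
  also have "\<dots> = Y" using XH XY by simp
  finally have "X $$ (j, i) = Y $$ (j, i)" by simp
  then show ?thesis using assms(3,4) by (simp add: X_def Y_def tr mult M_def scalar_prod_def atLeast0LessThan mult.commute)
qed

text \<open>A k-fold finite difference of m -> m choose j, each difference lowering the lower index
  by one. Pascal's rule splits the sum for k + 1 into the sums for k at m and at m + 1, hence the
  induction with m arbitrary.\<close>

lemma alternating_binomial_sum:
  "(\<Sum>i\<le>k. (- 1) ^ i * of_nat (k choose i) * of_nat ((m + i) choose j) :: real)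
    = (- 1) ^ k * (if j < k then 0 else of_nat (m choose (j - k)))"
proof (induction k arbitrary: m)
  case (Suc k)
  let ?f = "\<lambda>k m i. (- 1) ^ i * of_nat (k choose i) * of_nat ((m + i) choose j) :: real"
  have "(\<Sum>i\<le>Suc k. ?f (Suc k) m i) = ?f (Suc k) m 0 + (\<Sum>i\<le>k. ?f (Suc k) m (Suc i))"
    by (rule sum.atMost_Suc_shift)
  also have "(\<Sum>i\<le>k. ?f (Suc k) m (Suc i)) = (\<Sum>i\<le>k. ?f k m (Suc i)) - (\<Sum>i\<le>k. ?f k (Suc m) i)"
    unfolding sum_subtractf[symmetric] by (intro sum.cong refl) (simp add: algebra_simps)
  also have "(\<Sum>i\<le>k. ?f k m (Suc i)) = (\<Sum>i\<le>Suc k. ?f k m i) - ?f k m 0"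
    by (subst sum.atMost_Suc_shift) simp
  finally have "(\<Sum>i\<le>Suc k. ?f (Suc k) m i) = (\<Sum>i\<le>k. ?f k m i) - (\<Sum>i\<le>k. ?f k (Suc m) i)" by simp
  also have "\<dots> = (- 1) ^ Suc k * (if j < Suc k then 0 else of_nat (m choose (j - Suc k)))"
  proof (cases "j \<le> k")
    case True
    then show ?thesis unfolding Suc.IH by auto
  next
    case False
    then obtain r where "j = Suc k + r" by (metis le_Suc_ex not_less_eq_eq)
    then have "j - k = Suc r" "j - Suc k = r" "\<not> j < k" "\<not> j < Suc k" by auto
    then show ?thesis unfolding Suc.IH by (simp add: algebra_simps)
  qed
  finally show ?case .
qed simp

text \<open>
  Coefficients of the Laguerre polynomial of degree \<open>k\<close> and parameter \<open>\<nu>\<close>.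
\<close>

definition lag :: "nat \<Rightarrow> nat \<Rightarrow> nat \<Rightarrow> real" where
  "lag \<nu> k i = (- 1) ^ i * of_nat ((k + \<nu>) choose (\<nu> + i)) / fact i"

lemma lag_eq_0: "i > k \<Longrightarrow> lag \<nu> k i = 0"
  by (simp add: lag_def binomial_eq_0)

lemma lag_eq:
  assumes "i \<le> k"
  shows "lag \<nu> k i = fact (k + \<nu>) / fact k * ((- 1) ^ i * of_nat (k choose i) / fact (\<nu> + i))"
proof -
  have "real ((k + \<nu>) choose (\<nu> + i)) = fact (k + \<nu>) / (fact (\<nu> + i) * fact (k - i))"
    using assms binomial_fact[of "\<nu> + i" "k + \<nu>", where 'a = real] by simp
  then show ?thesis using assms by (simp add: lag_def binomial_fact mult_ac)
qed

text \<open>As (\<nu> + i + j)! is a moment of x^\<nu> exp (-x), the sum is the integral of a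
  Laguerre polynomial of degree k against x^j with this weight. After \<open>lag_eq\<close> it is an
  alternating binomial sum, and its vanishing for j < k is the orthogonality.\<close>

lemma lag_moment:
  assumes "k < n"
  shows "(\<Sum>i<n. lag \<nu> k i * fact (\<nu> + i + j)) = fact (k + \<nu>) / fact k * fact j * (- 1) ^ k * (if j < k then 0 else of_nat ((\<nu> + j) choose (j - k)))"
proof -
  have "(\<Sum>i<n. lag \<nu> k i * fact (\<nu> + i + j)) = (\<Sum>i\<le>k. lag \<nu> k i * fact (\<nu> + i + j))"
    using assms by (intro sum.mono_neutral_right) (auto simp: lag_eq_0)
  also have "\<dots> = (\<Sum>i\<le>k. fact (k + \<nu>) / fact k * fact j * ((- 1) ^ i * of_nat (k choose i) * of_nat (((\<nu> + j) + i) choose j)))"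
  proof (intro sum.cong refl)
    fix i assume i: "i \<in> {..k}"
    have "real (((\<nu> + j) + i) choose j) = fact (\<nu> + i + j) / (fact j * fact (\<nu> + i))"
      using binomial_fact[of j "\<nu> + j + i", where 'a = real] by (simp add: add_ac)
    then show "lag \<nu> k i * fact (\<nu> + i + j) = fact (k + \<nu>) / fact k * fact j * ((- 1) ^ i * of_nat (k choose i) * of_nat (((\<nu> + j) + i) choose j))"
      using i by (simp add: lag_eq)
  qed
  also have "\<dots> = fact (k + \<nu>) / fact k * fact j * (\<Sum>i\<le>k. (- 1) ^ i * of_nat (k choose i) * of_nat (((\<nu> + j) + i) choose j))"
    by (simp only: sum_distrib_left)
  finally show ?thesis unfolding alternating_binomial_sum by simp
qed

text \<open>For l <= k only the term j = k can survive: the moment vanishes for j < k and the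
  coefficient of degree l vanishes for j > k. The Hankel form is symmetric, which settles l >
  k.\<close>

lemma lag_orthogonal:
  assumes "k < n" "l < n"
  shows "(\<Sum>i<n. \<Sum>j<n. lag \<nu> k i * fact (\<nu> + i + j) * lag \<nu> l j) = (if k = l then fact (k + \<nu>) / fact k else 0)"
proof -
  have main: "(\<Sum>i<n. \<Sum>j<n. lag \<nu> k i * fact (\<nu> + i + j) * lag \<nu> l j) = (if k = l then fact (k + \<nu>) / fact k else 0)"
    if kl: "k < n" "l < n" "l \<le> k" for k l
  proof -
    have "(\<Sum>i<n. \<Sum>j<n. lag \<nu> k i * fact (\<nu> + i + j) * lag \<nu> l j) = (\<Sum>j<n. (\<Sum>i<n. lag \<nu> k i * fact (\<nu> + i + j)) * lag \<nu> l j)"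
      by (subst sum.swap) (simp add: sum_distrib_right)
    also have "\<dots> = (\<Sum>j<n. if j = k then (if k = l then fact (k + \<nu>) / fact k else 0) else 0)"
    proof (intro sum.cong refl)
      fix j assume "j \<in> {..<n}"
      have sq: "(- 1 :: real) ^ k * (- 1) ^ k = 1" by (simp flip: power_add)
      consider "j < k" | "j > k" | "j = k" "l < k" | "j = k" "l = k" using kl by linarith
      then show "(\<Sum>i<n. lag \<nu> k i * fact (\<nu> + i + j)) * lag \<nu> l j = (if j = k then (if k = l then fact (k + \<nu>) / fact k else 0) else 0)"
      proof cases
        case 4
        have "lag \<nu> l j = (- 1) ^ k / fact k" using 4 by (simp add: lag_def add.commute)
        then show ?thesis using 4 sq by (simp add: lag_moment[OF kl(1)])
      qed (use kl in \<open>auto simp: lag_moment[OF kl(1)] lag_eq_0\<close>)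
    qed
    also have "\<dots> = (if k = l then fact (k + \<nu>) / fact k else 0)" using kl by simp
    finally show ?thesis .
  qed
  show ?thesis
  proof (cases "l \<le> k")
    case False
    have "(\<Sum>i<n. \<Sum>j<n. lag \<nu> k i * fact (\<nu> + i + j) * lag \<nu> l j) = (\<Sum>j<n. \<Sum>i<n. lag \<nu> l j * fact (\<nu> + j + i) * lag \<nu> k i)"
      by (subst sum.swap) (simp add: mult_ac add_ac)
    then show ?thesis using main[of l k] False assms by simp
  qed (use main assms in simp)
qed

section \<open>The weights and their Gram matrix\<close>

lemma power2_powr_half:
  fixes r t :: real
  assumes "r > 0"
  shows "(r\<^sup>2) powr (t / 2) = r powr t"
proof -
  have "(r\<^sup>2) powr (t / 2) = (r powr 2) powr (t / 2)" using assms by simp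
  also have "\<dots> = r powr (2 * (t / 2))" by (rule powr_powr)
  finally show ?thesis by simp
qed

lemma weight_I_eq:
  assumes a: "\<alpha> > 0" and x: "x > 0"
  shows "weight_I \<kappa> \<alpha> j x = (\<alpha> * x) ^ (\<kappa> + j) * clif (\<kappa> + j) (- (\<alpha>\<^sup>2 * x))"
proof -
  define b where "b = \<kappa> + j"
  define r where "r = sqrt x"
  have r: "r > 0" "x = r ^ 2" using x by (auto simp: r_def)
  have rb: "real \<kappa> + real j = real b" by (simp add: b_def)
  have t: "(2 * \<alpha> * r / 2) powr (2 * real m + real b) / (fact m * Gamma (real b + real m + 1))
      = (\<alpha> * r) ^ b * ((- (- (\<alpha>\<^sup>2 * x))) ^ m / (fact m * fact (m + b)))" for m
  proof -
    have "(2 * \<alpha> * r / 2) powr (2 * real m + real b) = (\<alpha> * r) powr real (2 * m + b)" by simp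
    also have "\<dots> = (\<alpha> * r) ^ (2 * m + b)" using a r by (intro powr_realpow) simp
    also have "\<dots> = (\<alpha> * r) ^ b * (- (- (\<alpha>\<^sup>2 * x))) ^ m"
      using r(2) by (simp add: power_add power_mult power_mult_distrib)
    finally have 1: "(2 * \<alpha> * r / 2) powr (2 * real m + real b) = (\<alpha> * r) ^ b * (- (- (\<alpha>\<^sup>2 * x))) ^ m" .
    have 2: "Gamma (real b + real m + 1) = fact (m + b)"
      using Gamma_fact[of "m + b", where 'a = real] by (simp add: add_ac)
    show ?thesis unfolding 1 2 by simp
  qed
  have "bessel_I (real b) (2 * \<alpha> * r) = (\<alpha> * r) ^ b * clif b (- (\<alpha>\<^sup>2 * x))"
    unfolding bessel_I_def t clif_def by (intro suminf_mult summable_clif)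
  moreover have "x powr (real b / 2) = r ^ b"
    unfolding r(2) power2_powr_half[OF r(1)] by (rule powr_realpow[OF r(1)])
  moreover have "r ^ b * (\<alpha> * r) ^ b = (\<alpha> * x) ^ b"
    using r by (simp add: power_mult_distrib power2_eq_square)
  ultimately show ?thesis
    unfolding weight_I_def rb r_def[symmetric] b_def[symmetric] by (simp flip: mult.assoc)
qed

lemma weight_K_eq:
  assumes b: "\<beta> > 0" and y: "y > 0" and le: "\<kappa> \<le> \<nu>"
  shows "weight_K \<kappa> \<nu> \<beta> j y = macdonald (\<nu> - \<kappa> + j) (\<beta>\<^sup>2 * y) / (2 * \<beta> ^ (\<nu> - \<kappa> + j))"
proof -
  define a where "a = \<nu> - \<kappa> + j"
  have ra: "real \<nu> - real \<kappa> + real j = real a" using le by (simp add: a_def of_nat_diff)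
  have s: "2 * \<beta> * sqrt y = 2 * sqrt (\<beta>\<^sup>2 * y)" using b by (simp add: real_sqrt_mult)
  have c: "\<beta>\<^sup>2 * y > 0" using b y by simp
  have h: "y powr (real a / 2) * (\<beta>\<^sup>2 * y) powr (- real a / 2) = 1 / \<beta> ^ a"
  proof -
    have "(\<beta>\<^sup>2 * y) powr (- real a / 2) = (\<beta>\<^sup>2) powr (- real a / 2) * y powr (- real a / 2)"
      by (rule powr_mult)
    also have "(\<beta>\<^sup>2) powr (- real a / 2) = \<beta> powr (- real a)"
      by (rule power2_powr_half[OF b])
    also have "\<dots> = 1 / \<beta> ^ a" using b by (simp add: powr_minus powr_realpow inverse_eq_divide)
    finally show ?thesis using y by (simp add: powr_minus field_simps)
  qed
  have "y powr (real a / 2) * ((\<beta>\<^sup>2 * y) powr (- real a / 2) / 2 * macdonald a (\<beta>\<^sup>2 * y))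
      = (y powr (real a / 2) * (\<beta>\<^sup>2 * y) powr (- real a / 2)) * (macdonald a (\<beta>\<^sup>2 * y) / 2)" by simp
  also have "\<dots> = macdonald a (\<beta>\<^sup>2 * y) / (2 * \<beta> ^ a)" unfolding h by simp
  finally show ?thesis
    unfolding weight_K_def ra s bessel_K_eq_macdonald[OF c] a_def[symmetric] .
qed

text \<open>The Gram entry at i = j = 0 divided by \<nu>!. The quotient of powers of \<beta> stands
  for \<beta>^(\<nu> - \<kappa>) and avoids truncated subtraction.\<close>

definition gram_const :: "nat \<Rightarrow> nat \<Rightarrow> real \<Rightarrow> real \<Rightarrow> real" where
  "gram_const \<kappa> \<nu> \<alpha> \<beta> = \<alpha> ^ \<kappa> * \<beta> ^ (2 * \<nu>) / (2 * \<beta> ^ (\<nu> + \<kappa>) * (\<beta>\<^sup>2 - \<alpha>\<^sup>2) ^ (\<nu> + 1))"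

text \<open>In \<open>clif_macdonald_integral\<close> the factorial and the power of 1 - \<alpha>^2
  / \<beta>^2 depend on a + b = \<nu> + i + j only; the other powers split into a factor for i and
  one for j. This is the Hankel structure up to diagonal factors.\<close>

lemma weight_gram:
  assumes ab: "\<alpha> > 0" "\<alpha> < \<beta>" and le: "\<kappa> \<le> \<nu>"
  shows "has_bochner_integral half_line (\<lambda>x. weight_I \<kappa> \<alpha> i x * weight_K \<kappa> \<nu> \<beta> j x)
    (gram_const \<kappa> \<nu> \<alpha> \<beta> * (\<alpha> / (\<beta>\<^sup>2 - \<alpha>\<^sup>2)) ^ i * (\<beta> / (\<beta>\<^sup>2 - \<alpha>\<^sup>2)) ^ j * fact (\<nu> + i + j))"
proof -
  define \<delta> where "\<delta> = \<beta>\<^sup>2 - \<alpha>\<^sup>2"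
  define b where "b = \<kappa> + i"
  define a where "a = \<nu> - \<kappa> + j"
  have \<delta>: "\<delta> > 0" using ab by (simp add: \<delta>_def power_strict_mono)
  have \<beta>: "\<beta> > 0" using ab by simp
  have w: "1 - \<alpha>\<^sup>2 / \<beta>\<^sup>2 = \<delta> / \<beta>\<^sup>2" using \<beta> by (simp add: \<delta>_def field_simps)
  have sum: "a + b = \<nu> + i + j" using le by (simp add: a_def b_def)
  have hb: "has_bochner_integral half_line
      (\<lambda>x. \<alpha> ^ b / (2 * \<beta> ^ a) * (x ^ b * clif b (- (\<alpha>\<^sup>2 * x)) * macdonald a (\<beta>\<^sup>2 * x)))
      (\<alpha> ^ b / (2 * \<beta> ^ a) * (fact (a + b) / (\<beta>\<^sup>2 ^ (b + 1) * (1 - \<alpha>\<^sup>2 / \<beta>\<^sup>2) ^ (a + b + 1))))"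
    by (intro has_bochner_integral_mult_right clif_macdonald_integral ab)
  have eq: "weight_I \<kappa> \<alpha> i x * weight_K \<kappa> \<nu> \<beta> j x = \<alpha> ^ b / (2 * \<beta> ^ a) * (x ^ b * clif b (- (\<alpha>\<^sup>2 * x)) * macdonald a (\<beta>\<^sup>2 * x))"
    if "x > 0" for x
    using that ab(1) \<beta> le by (simp add: weight_I_eq weight_K_eq a_def[symmetric] b_def[symmetric] power_mult_distrib)
  have val: "\<alpha> ^ b / (2 * \<beta> ^ a) * (fact (a + b) / (\<beta>\<^sup>2 ^ (b + 1) * (1 - \<alpha>\<^sup>2 / \<beta>\<^sup>2) ^ (a + b + 1)))
      = gram_const \<kappa> \<nu> \<alpha> \<beta> * (\<alpha> / \<delta>) ^ i * (\<beta> / \<delta>) ^ j * fact (\<nu> + i + j)"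
  proof -
    have ex: "\<beta> ^ (2 * \<nu>) * \<beta> ^ j * (\<beta> ^ a * \<beta>\<^sup>2 ^ (b + 1)) = \<beta> ^ (\<nu> + \<kappa>) * \<beta>\<^sup>2 ^ (a + b + 1)"
      unfolding power_mult[symmetric] power_add[symmetric] using le by (intro arg_cong[where f = "\<lambda>n. \<beta> ^ n"]) (simp add: a_def b_def)
    have "\<alpha> ^ b / (2 * \<beta> ^ a) * (fact (a + b) / (\<beta>\<^sup>2 ^ (b + 1) * (1 - \<alpha>\<^sup>2 / \<beta>\<^sup>2) ^ (a + b + 1)))
        = \<alpha> ^ b * fact (\<nu> + i + j) / (2 * \<delta> ^ (\<nu> + i + j + 1)) * (\<beta>\<^sup>2 ^ (a + b + 1) / (\<beta> ^ a * \<beta>\<^sup>2 ^ (b + 1)))"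
      unfolding w sum by (simp add: power_divide)
    also have "\<beta>\<^sup>2 ^ (a + b + 1) / (\<beta> ^ a * \<beta>\<^sup>2 ^ (b + 1)) = \<beta> ^ (2 * \<nu>) * \<beta> ^ j / \<beta> ^ (\<nu> + \<kappa>)"
    proof -
      have nz: "\<beta> ^ a * \<beta>\<^sup>2 ^ (b + 1) \<noteq> 0" "\<beta> ^ (\<nu> + \<kappa>) \<noteq> 0" using \<beta> by auto
      show ?thesis unfolding frac_eq_eq[OF nz] using ex by (simp only: mult_ac)
    qed
    finally show ?thesis
      by (simp add: gram_const_def \<delta>_def[symmetric] b_def power_add power_divide mult_ac)
  qed
  show ?thesis
    using hb half_line_cong[OF eq] unfolding val \<delta>_def[symmetric] has_bochner_integral_iff by simp
qed

text \<open>The given system and the rescaled Laguerre system are biorthogonal for the same Gram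
  matrix, so \<open>biorthogonal_coefficients_unique\<close> lets one replace the other inside the
  kernel.\<close>

lemma kernel_expansion:
  assumes ab: "\<alpha> > 0" "\<alpha> < \<beta>" and le: "\<kappa> \<le> \<nu>"
    and K: "is_correlation_kernel \<kappa> \<nu> \<alpha> \<beta> n K" and x: "x > 0" and y: "y > 0"
  defines "\<delta> \<equiv> \<beta>\<^sup>2 - \<alpha>\<^sup>2"
  shows "K x y = 1 / gram_const \<kappa> \<nu> \<alpha> \<beta> * (\<Sum>k<n. (\<Sum>i<n. lag \<nu> k i * (\<delta> / \<alpha>) ^ i * weight_I \<kappa> \<alpha> i x)
    * (fact k / fact (k + \<nu>) * (\<Sum>j<n. lag \<nu> k j * (\<delta> / \<beta>) ^ j * weight_K \<kappa> \<nu> \<beta> j y)))"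
proof -
  define G where "G = gram_const \<kappa> \<nu> \<alpha> \<beta>"
  have \<delta>: "\<delta> > 0" using ab by (simp add: \<delta>_def power_strict_mono)
  have G: "G > 0" using ab \<delta> by (simp add: G_def gram_const_def \<delta>_def[symmetric])
  obtain Q P where bi: "biorthogonal_system \<kappa> \<nu> \<alpha> \<beta> n Q P" and Kxy: "K x y = (\<Sum>k<n. Q k x * P k y)"
    using K x y unfolding is_correlation_kernel_def by blast
  obtain c0 where c0: "\<And>k x. k < n \<Longrightarrow> x > 0 \<Longrightarrow> Q k x = (\<Sum>j\<le>k. c0 k j * weight_I \<kappa> \<alpha> j x)"
    using bi unfolding biorthogonal_system_def by metis
  obtain d0 where d0: "\<And>k x. k < n \<Longrightarrow> x > 0 \<Longrightarrow> P k x = (\<Sum>j\<le>k. d0 k j * weight_K \<kappa> \<nu> \<beta> j x)"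
    using bi unfolding biorthogonal_system_def by metis
  \<comment> \<open>The triangular coefficients are padded by zeros to square matrices.\<close>
  define c where "c = (\<lambda>k j. if j \<le> k then c0 k j else 0)"
  define d where "d = (\<lambda>k j. if j \<le> k then d0 k j else 0)"
  have Q: "Q k x = (\<Sum>i<n. c k i * weight_I \<kappa> \<alpha> i x)" if "k < n" "x > 0" for k x
    unfolding c0[OF that] using that(1) by (intro sum.mono_neutral_cong_left) (auto simp: c_def)
  have P: "P k x = (\<Sum>i<n. d k i * weight_K \<kappa> \<nu> \<beta> i x)" if "k < n" "x > 0" for k x
    unfolding d0[OF that] using that(1) by (intro sum.mono_neutral_cong_left) (auto simp: d_def)
  define h where "h = (\<lambda>i j. G * (\<alpha> / \<delta>) ^ i * (\<beta> / \<delta>) ^ j * fact (\<nu> + i + j))"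
  have hb: "has_bochner_integral half_line (\<lambda>x. weight_I \<kappa> \<alpha> i x * weight_K \<kappa> \<nu> \<beta> j x) (h i j)" for i j
    unfolding h_def G_def \<delta>_def by (rule weight_gram[OF ab le])
  have orth: "(\<Sum>i<n. \<Sum>j<n. c k i * h i j * d l j) = (if k = l then 1 else 0)" if kl: "k < n" "l < n" for k l
  proof -
    have "(\<integral>x. Q k x * P l x \<partial>half_line) = (\<integral>x. (\<Sum>i<n. \<Sum>j<n. c k i * d l j * (weight_I \<kappa> \<alpha> i x * weight_K \<kappa> \<nu> \<beta> j x)) \<partial>half_line)"
      by (rule half_line_cong(2)) (simp add: Q P kl sum_product mult_ac)
    also have "\<dots> = (\<Sum>i<n. \<Sum>j<n. c k i * d l j * h i j)"
      by (intro has_bochner_integral_integral_eq has_bochner_integral_sum has_bochner_integral_mult_right hb)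
    finally have "(\<Sum>i<n. \<Sum>j<n. c k i * d l j * h i j) = (if l = k then 1 else 0)"
      using bi kl unfolding biorthogonal_system_def integral_half_line[symmetric] by metis
    then show ?thesis by (simp add: mult_ac eq_commute)
  qed
  \<comment> \<open>The powers of \<delta> / \<alpha> and \<delta> / \<beta> undo the diagonal
    factors of the Gram matrix; k! / (k + \<nu>)! is the inverse squared Laguerre norm, and 1 / G
    removes the constant.\<close>
  define c' where "c' = (\<lambda>k i. lag \<nu> k i * (\<delta> / \<alpha>) ^ i)"
  define d' where "d' = (\<lambda>k j. lag \<nu> k j * (\<delta> / \<beta>) ^ j * (fact k / (fact (k + \<nu>) * G)))"
  have orth': "(\<Sum>i<n. \<Sum>j<n. c' k i * h i j * d' l j) = (if k = l then 1 else 0)" if kl: "k < n" "l < n" for k l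
  proof -
    have "c' k i * h i j * d' l j = fact l / fact (l + \<nu>) * (lag \<nu> k i * fact (\<nu> + i + j) * lag \<nu> l j)" for i j
      using ab \<delta> G by (simp add: c'_def h_def d'_def power_divide)
    then have "(\<Sum>i<n. \<Sum>j<n. c' k i * h i j * d' l j)
        = fact l / fact (l + \<nu>) * (\<Sum>i<n. \<Sum>j<n. lag \<nu> k i * fact (\<nu> + i + j) * lag \<nu> l j)"
      by (simp only: sum_distrib_left)
    then show ?thesis by (simp add: lag_orthogonal[OF kl])
  qed
  have expand: "(\<Sum>k<n. (\<Sum>i<n. u k i * f i) * (\<Sum>j<n. v k j * g j)) = (\<Sum>i<n. \<Sum>j<n. (\<Sum>k<n. u k i * v k j) * (f i * g j))"
    for u v :: "nat \<Rightarrow> nat \<Rightarrow> real" and f g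
  proof -
    have "(\<Sum>k<n. (\<Sum>i<n. u k i * f i) * (\<Sum>j<n. v k j * g j)) = (\<Sum>k<n. \<Sum>i<n. \<Sum>j<n. (u k i * v k j) * (f i * g j))"
      by (simp add: sum_product mult_ac)
    also have "\<dots> = (\<Sum>i<n. \<Sum>k<n. \<Sum>j<n. (u k i * v k j) * (f i * g j))" by (rule sum.swap)
    also have "\<dots> = (\<Sum>i<n. \<Sum>j<n. \<Sum>k<n. (u k i * v k j) * (f i * g j))" by (intro sum.cong refl sum.swap)
    finally show ?thesis by (simp only: sum_distrib_right)
  qed
  have "K x y = (\<Sum>k<n. (\<Sum>i<n. c k i * weight_I \<kappa> \<alpha> i x) * (\<Sum>j<n. d k j * weight_K \<kappa> \<nu> \<beta> j y))"
    unfolding Kxy using x y by (intro sum.cong refl) (simp add: Q P)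
  also have "\<dots> = (\<Sum>i<n. \<Sum>j<n. (\<Sum>k<n. c' k i * d' k j) * (weight_I \<kappa> \<alpha> i x * weight_K \<kappa> \<nu> \<beta> j y))"
    unfolding expand using biorthogonal_coefficients_unique[of n c h d c' d', OF orth orth'] by simp
  also have "\<dots> = (\<Sum>k<n. (\<Sum>i<n. c' k i * weight_I \<kappa> \<alpha> i x) * (\<Sum>j<n. d' k j * weight_K \<kappa> \<nu> \<beta> j y))"
    by (rule expand[symmetric])
  also have "\<dots> = (\<Sum>k<n. 1 / G * ((\<Sum>i<n. lag \<nu> k i * (\<delta> / \<alpha>) ^ i * weight_I \<kappa> \<alpha> i x)
      * (fact k / fact (k + \<nu>) * (\<Sum>j<n. lag \<nu> k j * (\<delta> / \<beta>) ^ j * weight_K \<kappa> \<nu> \<beta> j y))))"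
  proof (intro sum.cong refl)
    fix k
    have "(\<Sum>j<n. d' k j * weight_K \<kappa> \<nu> \<beta> j y)
        = 1 / G * (fact k / fact (k + \<nu>) * (\<Sum>j<n. lag \<nu> k j * (\<delta> / \<beta>) ^ j * weight_K \<kappa> \<nu> \<beta> j y))"
      unfolding sum_distrib_left by (intro sum.cong refl) (simp add: d'_def mult_ac)
    then show "(\<Sum>i<n. c' k i * weight_I \<kappa> \<alpha> i x) * (\<Sum>j<n. d' k j * weight_K \<kappa> \<nu> \<beta> j y)
        = 1 / G * ((\<Sum>i<n. lag \<nu> k i * (\<delta> / \<alpha>) ^ i * weight_I \<kappa> \<alpha> i x)
          * (fact k / fact (k + \<nu>) * (\<Sum>j<n. lag \<nu> k j * (\<delta> / \<beta>) ^ j * weight_K \<kappa> \<nu> \<beta> j y)))"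
      by (simp only: c'_def mult.left_commute)
  qed
  finally show ?thesis by (simp only: sum_distrib_left G_def)
qed

text \<open>In use p = \<delta> x and q = \<alpha>^2 x. They are separate because after rescaling
  the powers of p meet the growing Laguerre coefficients, while q just tends to 0.\<close>

definition kernel_A :: "nat \<Rightarrow> nat \<Rightarrow> real \<Rightarrow> real \<Rightarrow> nat \<Rightarrow> real" where
  "kernel_A \<nu> \<kappa> p q k = (\<Sum>i\<le>k. lag \<nu> k i * p ^ i * clif (\<kappa> + i) (- q))"

text \<open>In use p = \<delta> y and c = \<beta>^2 y, so p < c and the base of the k-th power lies
  between 0 and 1 for every Z > 0.\<close>

definition kernel_B :: "nat \<Rightarrow> nat \<Rightarrow> real \<Rightarrow> real \<Rightarrow> nat \<Rightarrow> real" where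
  "kernel_B \<nu> \<kappa> p c k = (\<integral>Z. Z ^ \<kappa> * clif \<kappa> Z / (Z + c) ^ (\<nu> + 1) * (1 - p / (Z + c)) ^ k \<partial>half_line)"

lemma sum_lag_weight_I:
  assumes a: "\<alpha> > 0" and x: "x > 0" and k: "k < n"
  shows "(\<Sum>i<n. lag \<nu> k i * (\<delta> / \<alpha>) ^ i * weight_I \<kappa> \<alpha> i x) = (\<alpha> * x) ^ \<kappa> * kernel_A \<nu> \<kappa> (\<delta> * x) (\<alpha>\<^sup>2 * x) k"
proof -
  have "(\<Sum>i<n. lag \<nu> k i * (\<delta> / \<alpha>) ^ i * weight_I \<kappa> \<alpha> i x) = (\<Sum>i\<le>k. lag \<nu> k i * (\<delta> / \<alpha>) ^ i * weight_I \<kappa> \<alpha> i x)"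
    using k by (intro sum.mono_neutral_right) (auto simp: lag_eq_0)
  also have "\<dots> = (\<Sum>i\<le>k. (\<alpha> * x) ^ \<kappa> * (lag \<nu> k i * (\<delta> * x) ^ i * clif (\<kappa> + i) (- (\<alpha>\<^sup>2 * x))))"
    using a x by (intro sum.cong refl) (simp add: weight_I_eq power_add power_mult_distrib power_divide)
  finally show ?thesis by (simp only: kernel_A_def sum_distrib_left)
qed

text \<open>The factorial from \<open>macdonald_eq_clif\<close> cancels the denominator in
  \<open>lag_eq\<close>, which leaves (-1)^j times k choose j; the binomial theorem under the
  integral then sums everything to a single power.\<close>

lemma sum_lag_weight_K:
  assumes b: "\<beta> > 0" and y: "y > 0" and le: "\<kappa> \<le> \<nu>" and k: "k < n"
  shows "fact k / fact (k + \<nu>) * (\<Sum>j<n. lag \<nu> k j * (\<delta> / \<beta>) ^ j * weight_K \<kappa> \<nu> \<beta> j y)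
    = (\<beta> * y) ^ (\<nu> - \<kappa>) / 2 * kernel_B \<nu> \<kappa> (\<delta> * y) (\<beta>\<^sup>2 * y) k"
proof -
  define c where "c = \<beta>\<^sup>2 * y"
  have c: "c > 0" using b y by (simp add: c_def)
  define g where "g = (\<lambda>j Z. Z ^ \<kappa> * clif \<kappa> Z / (Z + c) ^ (\<nu> + j + 1))"
  have sum: "\<nu> - \<kappa> + j + \<kappa> = \<nu> + j" for j using le by simp
  have ig: "integrable half_line (g j)" for j
    unfolding g_def using macdonald_eq_clif(1)[OF c, of \<kappa> "\<nu> - \<kappa> + j"] by (simp only: sum)
  have mac: "macdonald (\<nu> - \<kappa> + j) c = fact (\<nu> + j) * c ^ (\<nu> - \<kappa> + j) * (\<integral>Z. g j Z \<partial>half_line)" for j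
    unfolding g_def using macdonald_eq_clif(2)[OF c, of "\<nu> - \<kappa> + j" \<kappa>] by (simp only: sum)
  have "fact k / fact (k + \<nu>) * (\<Sum>j<n. lag \<nu> k j * (\<delta> / \<beta>) ^ j * weight_K \<kappa> \<nu> \<beta> j y)
      = fact k / fact (k + \<nu>) * (\<Sum>j\<le>k. lag \<nu> k j * (\<delta> / \<beta>) ^ j * weight_K \<kappa> \<nu> \<beta> j y)"
    using k by (intro arg_cong2[where f = "(*)"] refl sum.mono_neutral_right) (auto simp: lag_eq_0)
  also have "\<dots> = (\<Sum>j\<le>k. (\<beta> * y) ^ (\<nu> - \<kappa>) / 2 * (of_nat (k choose j) * (- (\<delta> * y)) ^ j * (\<integral>Z. g j Z \<partial>half_line)))"
    unfolding sum_distrib_left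
  proof (intro sum.cong refl)
    fix j assume j: "j \<in> {..k}"
    have W: "weight_K \<kappa> \<nu> \<beta> j y = fact (\<nu> + j) * (\<beta> * y) ^ (\<nu> - \<kappa> + j) / 2 * (\<integral>Z. g j Z \<partial>half_line)"
      using b unfolding weight_K_eq[OF b y le] c_def[symmetric] mac
      by (simp add: c_def power_mult_distrib power2_eq_square)
    have L: "fact k / fact (k + \<nu>) * lag \<nu> k j * fact (\<nu> + j) = (- 1) ^ j * of_nat (k choose j)"
      using j by (simp add: lag_eq)
    have "fact k / fact (k + \<nu>) * (lag \<nu> k j * (\<delta> / \<beta>) ^ j * weight_K \<kappa> \<nu> \<beta> j y)
        = (fact k / fact (k + \<nu>) * lag \<nu> k j * fact (\<nu> + j)) * ((\<delta> / \<beta>) ^ j * (\<beta> * y) ^ (\<nu> - \<kappa> + j)) / 2 * (\<integral>Z. g j Z \<partial>half_line)"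
      unfolding W by (simp only: times_divide_eq_right times_divide_eq_left mult_ac)
    also have "(\<delta> / \<beta>) ^ j * (\<beta> * y) ^ (\<nu> - \<kappa> + j) = (\<beta> * y) ^ (\<nu> - \<kappa>) * (\<delta> * y) ^ j"
      using b by (simp add: power_add power_mult_distrib power_divide)
    finally show "fact k / fact (k + \<nu>) * (lag \<nu> k j * (\<delta> / \<beta>) ^ j * weight_K \<kappa> \<nu> \<beta> j y)
        = (\<beta> * y) ^ (\<nu> - \<kappa>) / 2 * (of_nat (k choose j) * (- (\<delta> * y)) ^ j * (\<integral>Z. g j Z \<partial>half_line))"
      unfolding L by (simp add: power_minus[of "\<delta> * y"] mult_ac)
  qed
  also have "\<dots> = (\<beta> * y) ^ (\<nu> - \<kappa>) / 2 * (\<Sum>j\<le>k. of_nat (k choose j) * (- (\<delta> * y)) ^ j * (\<integral>Z. g j Z \<partial>half_line))"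
    by (simp only: sum_distrib_left)
  also have "(\<Sum>j\<le>k. of_nat (k choose j) * (- (\<delta> * y)) ^ j * (\<integral>Z. g j Z \<partial>half_line))
      = (\<integral>Z. (\<Sum>j\<le>k. of_nat (k choose j) * (- (\<delta> * y)) ^ j * g j Z) \<partial>half_line)"
    by (subst Bochner_Integration.integral_sum) (auto intro!: integrable_mult_right ig)
  also have "\<dots> = kernel_B \<nu> \<kappa> (\<delta> * y) c k"
    unfolding kernel_B_def
  proof (rule half_line_cong(2))
    fix Z :: real assume "Z > 0"
    have "(1 - \<delta> * y / (Z + c)) ^ k = (\<Sum>j\<le>k. of_nat (k choose j) * (- (\<delta> * y) / (Z + c)) ^ j * 1 ^ (k - j))"
      by (subst binomial_ring[symmetric]) simp
    then have "Z ^ \<kappa> * clif \<kappa> Z / (Z + c) ^ (\<nu> + 1) * (1 - \<delta> * y / (Z + c)) ^ k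
        = (\<Sum>j\<le>k. Z ^ \<kappa> * clif \<kappa> Z / (Z + c) ^ (\<nu> + 1) * (of_nat (k choose j) * (- (\<delta> * y) / (Z + c)) ^ j))"
      by (simp only: sum_distrib_left power_one mult_1_right)
    then show "(\<Sum>j\<le>k. of_nat (k choose j) * (- (\<delta> * y)) ^ j * g j Z) = Z ^ \<kappa> * clif \<kappa> Z / (Z + c) ^ (\<nu> + 1) * (1 - \<delta> * y / (Z + c)) ^ k"
      by (simp only:) (intro sum.cong refl, unfold g_def power_divide power_add, simp add: mult_ac)
  qed
  finally show ?thesis by (simp only: c_def)
qed

lemma kernel_formula:
  assumes ab: "\<alpha> > 0" "\<alpha> < \<beta>" and le: "\<kappa> \<le> \<nu>"
    and K: "is_correlation_kernel \<kappa> \<nu> \<alpha> \<beta> n K" and x: "x > 0" and y: "y > 0"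
  defines "\<delta> \<equiv> \<beta>\<^sup>2 - \<alpha>\<^sup>2"
  shows "K x y = \<delta> ^ (\<nu> + 1) * x ^ \<kappa> * y ^ (\<nu> - \<kappa>)
    * (\<Sum>k<n. kernel_A \<nu> \<kappa> (\<delta> * x) (\<alpha>\<^sup>2 * x) k * kernel_B \<nu> \<kappa> (\<delta> * y) (\<beta>\<^sup>2 * y) k)"
proof -
  have \<delta>: "\<delta> > 0" using ab by (simp add: \<delta>_def power_strict_mono)
  have b: "\<beta> > 0" using ab by simp
  let ?S = "\<Sum>k<n. kernel_A \<nu> \<kappa> (\<delta> * x) (\<alpha>\<^sup>2 * x) k * kernel_B \<nu> \<kappa> (\<delta> * y) (\<beta>\<^sup>2 * y) k"
  have "K x y = 1 / gram_const \<kappa> \<nu> \<alpha> \<beta> * (\<Sum>k<n. ((\<alpha> * x) ^ \<kappa> * kernel_A \<nu> \<kappa> (\<delta> * x) (\<alpha>\<^sup>2 * x) k)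
      * ((\<beta> * y) ^ (\<nu> - \<kappa>) / 2 * kernel_B \<nu> \<kappa> (\<delta> * y) (\<beta>\<^sup>2 * y) k))"
  proof -
    have "(\<Sum>k<n. (\<Sum>i<n. lag \<nu> k i * (\<delta> / \<alpha>) ^ i * weight_I \<kappa> \<alpha> i x)
        * (fact k / fact (k + \<nu>) * (\<Sum>j<n. lag \<nu> k j * (\<delta> / \<beta>) ^ j * weight_K \<kappa> \<nu> \<beta> j y)))
      = (\<Sum>k<n. ((\<alpha> * x) ^ \<kappa> * kernel_A \<nu> \<kappa> (\<delta> * x) (\<alpha>\<^sup>2 * x) k)
        * ((\<beta> * y) ^ (\<nu> - \<kappa>) / 2 * kernel_B \<nu> \<kappa> (\<delta> * y) (\<beta>\<^sup>2 * y) k))"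
      by (rule sum.cong[OF refl]) (simp only: sum_lag_weight_I[OF ab(1) x] sum_lag_weight_K[OF b y le] lessThan_iff)
    then show ?thesis unfolding kernel_expansion[OF ab le K x y] \<delta>_def[symmetric] by (simp only:)
  qed
  also have "\<dots> = 1 / gram_const \<kappa> \<nu> \<alpha> \<beta> * ((\<alpha> * x) ^ \<kappa> * ((\<beta> * y) ^ (\<nu> - \<kappa>) / 2)) * ?S"
    by (simp add: sum_distrib_left mult_ac)
  also have "1 / gram_const \<kappa> \<nu> \<alpha> \<beta> * ((\<alpha> * x) ^ \<kappa> * ((\<beta> * y) ^ (\<nu> - \<kappa>) / 2)) = \<delta> ^ (\<nu> + 1) * x ^ \<kappa> * y ^ (\<nu> - \<kappa>)"
  proof -
    have "\<beta> ^ (\<nu> + \<kappa>) * \<beta> ^ (\<nu> - \<kappa>) = \<beta> ^ (2 * \<nu>)" using le by (simp add: mult_2 flip: power_add)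
    moreover have "1 / gram_const \<kappa> \<nu> \<alpha> \<beta> * ((\<alpha> * x) ^ \<kappa> * ((\<beta> * y) ^ (\<nu> - \<kappa>) / 2))
        = (\<beta> ^ (\<nu> + \<kappa>) * \<beta> ^ (\<nu> - \<kappa>)) / \<beta> ^ (2 * \<nu>) * (\<delta> ^ (\<nu> + 1) * x ^ \<kappa> * y ^ (\<nu> - \<kappa>))"
      using ab by (simp add: gram_const_def \<delta>_def[symmetric] power_mult_distrib)
    ultimately show ?thesis using b by simp
  qed
  finally show ?thesis .
qed

subsection \<open>The limit\<close>

text \<open>Continuous convergence on a compact set is uniform. Points violating uniformity
  accumulate at some p0; there the values of f converge to \<open>g p0\<close>, and so do the values
  of g, since continuity of g at p0 is itself a consequence of the hypothesis.\<close>

lemma uniform_limit_of_continuous_convergence: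
  fixes f :: "nat \<Rightarrow> 'a :: metric_space \<Rightarrow> 'b :: metric_space"
  assumes S: "compact S"
    and conv: "\<And>N p p0. (\<And>m. m < N m) \<Longrightarrow> (\<And>m. p m \<in> S) \<Longrightarrow> p0 \<in> S \<Longrightarrow> p \<longlonglongrightarrow> p0
      \<Longrightarrow> (\<lambda>m. f (N m) (p m)) \<longlonglongrightarrow> g p0"
  shows "uniform_limit S f g sequentially"
proof (rule ccontr)
  assume "\<not> uniform_limit S f g sequentially"
  then obtain e where e: "e > 0" "\<And>n0. \<exists>n>n0. \<exists>x\<in>S. \<not> dist (f n x) (g x) < e"
    unfolding uniform_limit_iff eventually_sequentially by (meson Suc_le_lessD)
  then obtain N p where Np: "\<And>m. m < N m" "\<And>m. p m \<in> S" "\<And>m. \<not> dist (f (N m) (p m)) (g (p m)) < e"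
    by metis
  obtain p0 r where r: "p0 \<in> S" "strict_mono (r :: nat \<Rightarrow> nat)" "(p \<circ> r) \<longlonglongrightarrow> p0"
    using S Np(2) unfolding compact_def by metis
  have pr: "(\<lambda>m. p (r m)) \<longlonglongrightarrow> p0" using r(3) by (simp add: o_def)
  have "(\<lambda>m. f (N (r m)) (p (r m))) \<longlonglongrightarrow> g p0"
  proof (rule conv[OF _ _ r(1) pr])
    show "m < N (r m)" for m using Np(1)[of "r m"] seq_suble[OF r(2), of m] by linarith
  qed (rule Np(2))
  then have 1: "(\<lambda>m. dist (f (N (r m)) (p (r m))) (g p0)) \<longlonglongrightarrow> 0" by (rule tendsto_dist_iff[THEN iffD1])
  have "\<exists>n>m. dist (f n (p (r m))) (g (p (r m))) < 1 / real (Suc m)" for m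
  proof -
    \<comment> \<open>A constant sequence of points gives pointwise convergence. For each m an index
      is picked at which f is already close to \<open>g (p (r m))\<close>; along these indices f
      tends to \<open>g p0\<close>, hence so does g.\<close>
    have "(\<lambda>n. f (Suc n) (p (r m))) \<longlonglongrightarrow> g (p (r m))"
      by (rule conv) (auto simp: Np(2))
    then have "\<forall>\<^sub>F n in sequentially. dist (f (Suc n) (p (r m))) (g (p (r m))) < 1 / real (Suc m)"
      by (rule tendstoD) simp
    then have "\<forall>\<^sub>F n in sequentially. dist (f (Suc n) (p (r m))) (g (p (r m))) < 1 / real (Suc m) \<and> n \<ge> m"
      by (intro eventually_conj eventually_ge_at_top)
    then obtain n where "dist (f (Suc n) (p (r m))) (g (p (r m))) < 1 / real (Suc m)" "n \<ge> m"
      using eventually_happens'[OF sequentially_bot] by blast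
    then show ?thesis by (intro exI[of _ "Suc n"]) auto
  qed
  then obtain N' where N': "\<And>m. m < N' m" "\<And>m. dist (f (N' m) (p (r m))) (g (p (r m))) < 1 / real (Suc m)"
    by metis
  have "(\<lambda>m. f (N' m) (p (r m))) \<longlonglongrightarrow> g p0"
    by (rule conv[OF N'(1) Np(2) r(1) pr])
  then have 2: "(\<lambda>m. dist (f (N' m) (p (r m))) (g p0)) \<longlonglongrightarrow> 0" by (rule tendsto_dist_iff[THEN iffD1])
  have "(\<lambda>m. dist (f (N (r m)) (p (r m))) (g p0) + (1 / real (Suc m) + dist (f (N' m) (p (r m))) (g p0))) \<longlonglongrightarrow> 0 + (0 + 0)"
    by (intro tendsto_add 1 2 LIMSEQ_Suc[OF lim_1_over_n])
  then have "\<forall>\<^sub>F m in sequentially. dist (f (N (r m)) (p (r m))) (g p0) + (1 / real (Suc m) + dist (f (N' m) (p (r m))) (g p0)) < e"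
    using e(1) by (intro order_tendstoD(2)) auto
  then obtain m where m: "dist (f (N (r m)) (p (r m))) (g p0) + (1 / real (Suc m) + dist (f (N' m) (p (r m))) (g p0)) < e"
    using eventually_happens'[OF sequentially_bot] by blast
  have "dist (f (N (r m)) (p (r m))) (g (p (r m)))
      \<le> dist (f (N (r m)) (p (r m))) (g p0) + (dist (f (N' m) (p (r m))) (g (p (r m))) + dist (f (N' m) (p (r m))) (g p0))"
    by (rule order_trans[OF dist_triangle2[of _ _ "g p0"]])
       (use dist_triangle3[of "g (p (r m))" "g p0" "f (N' m) (p (r m))"] in simp)
  then show False using m N'(2)[of m] Np(3)[of "r m"] by linarith
qed

text \<open>The sum over k becomes an integral of a step function over a fixed interval, so that
  limits in n can be taken by dominated convergence.\<close>

lemma riemann_sum_eq_integral: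
  fixes h :: "nat \<Rightarrow> real"
  assumes n: "n > 0"
  shows "has_bochner_integral lborel (\<lambda>u. indicator {0..<1} u *\<^sub>R h (nat \<lfloor>u * real n\<rfloor>)) ((\<Sum>k<n. h k) / real n)"
proof -
  have eq: "indicator {0..<1} u *\<^sub>R h (nat \<lfloor>u * real n\<rfloor>) = (\<Sum>k<n. h k * indicator {real k / real n..<(real k + 1) / real n} u)" for u
  proof -
    have i: "indicator {real k / real n..<(real k + 1) / real n} u = (if u \<ge> 0 \<and> k = nat \<lfloor>u * real n\<rfloor> then 1 else (0 :: real))" for k
    proof -
      have "u \<in> {real k / real n..<(real k + 1) / real n} \<longleftrightarrow> real k \<le> u * real n \<and> u * real n < real k + 1"
        using n by (simp add: field_simps)
      also have "\<dots> \<longleftrightarrow> \<lfloor>u * real n\<rfloor> = int k" by linarith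
      also have "\<dots> \<longleftrightarrow> u \<ge> 0 \<and> k = nat \<lfloor>u * real n\<rfloor>"
      proof
        assume h: "\<lfloor>u * real n\<rfloor> = int k"
        then have "0 \<le> u * real n" by linarith
        then show "u \<ge> 0 \<and> k = nat \<lfloor>u * real n\<rfloor>" using n h by (simp add: zero_le_mult_iff)
      next
        assume "u \<ge> 0 \<and> k = nat \<lfloor>u * real n\<rfloor>"
        moreover from this have "u * real n \<ge> 0" by simp
        ultimately show "\<lfloor>u * real n\<rfloor> = int k" by simp
      qed
      finally show ?thesis by (simp add: indicator_def)
    qed
    show ?thesis
    proof (cases "u \<ge> 0")
      case True
      have "nat \<lfloor>u * real n\<rfloor> < n \<longleftrightarrow> u * real n < real n" using True n by (auto simp: nat_less_iff floor_less_iff)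
      also have "\<dots> \<longleftrightarrow> u < 1" using n by simp
      finally have "nat \<lfloor>u * real n\<rfloor> < n \<longleftrightarrow> u < 1" .
      then show ?thesis unfolding i using True by (simp add: indicator_def if_distrib[of "\<lambda>x. h _ * x"] cong: if_cong)
    next
      case False
      then show ?thesis unfolding i by (simp add: indicator_def)
    qed
  qed
  have "has_bochner_integral lborel (indicat_real {real k / real n..<(real k + 1) / real n}) (1 / real n)" for k
  proof -
    have "measure lborel {real k / real n..<(real k + 1) / real n} = 1 / real n"
      by (subst measure_lborel_Ico) (use n in \<open>auto simp: field_simps\<close>)
    moreover have "emeasure lborel {real k / real n..<(real k + 1) / real n} < \<infinity>"
      by (subst emeasure_lborel_Ico) (use n in \<open>auto simp: divide_right_mono\<close>)
    ultimately show ?thesis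
      using has_bochner_integral_real_indicator[of "{real k / real n..<(real k + 1) / real n}" lborel] by simp
  qed
  then have "has_bochner_integral lborel (\<lambda>u. \<Sum>k<n. h k * indicator {real k / real n..<(real k + 1) / real n} u) (\<Sum>k<n. h k * (1 / real n))"
    by (intro has_bochner_integral_sum has_bochner_integral_mult_right)
  then show ?thesis unfolding eq by (simp add: sum_divide_distrib)
qed

section \<open>Majorant and limit of the first kernel factor\<close>

lemma binomial_ratio_limit:
  fixes K N :: "nat \<Rightarrow> nat"
  assumes "(\<lambda>m. real (K m) / real (N m)) \<longlonglongrightarrow> u" "filterlim N at_top sequentially"
  shows "(\<lambda>m. real (K m choose j) / real (N m) ^ j) \<longlonglongrightarrow> u ^ j / fact j"
proof -
  have inv: "(\<lambda>m. 1 / real (N m)) \<longlonglongrightarrow> 0"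
    by (rule filterlim_compose[OF lim_1_over_n assms(2)])
  have "(\<lambda>m. (\<Prod>i = 0..<j. real (K m) / real (N m) - real i * (1 / real (N m))) / fact j) \<longlonglongrightarrow> (\<Prod>i = 0..<j. u - real i * 0) / fact j"
    by (intro tendsto_intros assms(1) inv) auto
  moreover have "(\<Prod>i = 0..<j. real (K m) / real (N m) - real i * (1 / real (N m))) / fact j = real (K m choose j) / real (N m) ^ j" for m
  proof -
    have "(\<Prod>i = 0..<j. real (K m) / real (N m) - real i * (1 / real (N m))) = (\<Prod>i = 0..<j. (real (K m) - real i) / real (N m))"
      by (intro prod.cong refl) (simp add: diff_divide_distrib)
    also have "\<dots> = (\<Prod>i = 0..<j. real (K m) - real i) / real (N m) ^ j"
      by (simp add: prod_dividef)
    finally show ?thesis by (simp add: binomial_gbinomial gbinomial_prod_rev)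
  qed
  ultimately show ?thesis by simp
qed

lemma abs_lag_le: "\<bar>lag \<nu> k i\<bar> \<le> real (k + \<nu>) ^ (\<nu> + i) / fact i"
proof -
  have "real ((k + \<nu>) choose (\<nu> + i)) \<le> real (k + \<nu>) ^ (\<nu> + i)"
  proof (cases "\<nu> + i \<le> k + \<nu>")
    case True
    then show ?thesis using binomial_le_pow[of "\<nu> + i" "k + \<nu>"] by (metis of_nat_le_iff of_nat_power)
  qed (simp add: binomial_eq_0)
  then show ?thesis by (simp add: lag_def abs_mult power_abs divide_right_mono)
qed

text \<open>Of the \<nu> + i powers of (k + \<nu>) / N, the i powers paired with x are estimated by
  1 + \<nu>, but the \<nu> others are kept: for small k they must offset the singular majorant of
  \<open>kernel_B\<close>.\<close>

lemma kernel_A_term_le: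
  assumes N: "N > 0" and k: "k \<le> N" and x: "0 \<le> x" "x \<le> X" and q: "0 \<le> q" "q \<le> Q"
  shows "\<bar>lag \<nu> k i * (x / real N) ^ i * clif a (- q) / real N ^ \<nu>\<bar>
    \<le> (real (k + \<nu>) / real N) ^ \<nu> * (exp Q * (((1 + real \<nu>) * X) ^ i / fact i))"
proof -
  have r: "real (k + \<nu>) / real N \<le> 1 + real \<nu>"
  proof -
    have "real (k + \<nu>) \<le> real N + real \<nu> * real N" using k N by (simp add: mult_le_cancel_left1 add_mono)
    then show ?thesis using N by (simp add: field_simps)
  qed
  have "\<bar>clif a (- q)\<bar> \<le> exp Q" using abs_clif_le_exp[of a "- q"] q by (smt (verit) exp_le_cancel_iff)
  then have "\<bar>lag \<nu> k i\<bar> * ((x / real N) ^ i * \<bar>clif a (- q)\<bar> / real N ^ \<nu>)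
      \<le> (real (k + \<nu>) ^ (\<nu> + i) / fact i) * ((x / real N) ^ i * exp Q / real N ^ \<nu>)"
    using x by (intro mult_mono abs_lag_le divide_right_mono mult_left_mono) auto
  also have "\<dots> = (real (k + \<nu>) / real N) ^ \<nu> * (exp Q * ((real (k + \<nu>) / real N * x) ^ i / fact i))"
    by (simp add: power_add power_divide power_mult_distrib mult_ac)
  also have "\<dots> \<le> (real (k + \<nu>) / real N) ^ \<nu> * (exp Q * (((1 + real \<nu>) * X) ^ i / fact i))"
    using x r by (intro mult_left_mono divide_right_mono power_mono mult_mono) auto
  finally show ?thesis using x by (simp add: abs_mult power_abs)
qed

lemma kernel_A_bound:
  assumes N: "N > 0" and k: "k \<le> N" and x: "0 \<le> x" "x \<le> X" and q: "0 \<le> q" "q \<le> Q"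
  shows "\<bar>kernel_A \<nu> \<kappa> (x / real N) q k / real N ^ \<nu>\<bar> \<le> exp Q * exp ((1 + real \<nu>) * X) * (real (k + \<nu>) / real N) ^ \<nu>"
proof -
  let ?y = "(1 + real \<nu>) * X"
  have y: "?y \<ge> 0" using x by simp
  have "\<bar>kernel_A \<nu> \<kappa> (x / real N) q k / real N ^ \<nu>\<bar> \<le> (\<Sum>i\<le>k. \<bar>lag \<nu> k i * (x / real N) ^ i * clif (\<kappa> + i) (- q) / real N ^ \<nu>\<bar>)"
    unfolding kernel_A_def sum_divide_distrib by (rule sum_abs)
  also have "\<dots> \<le> (\<Sum>i\<le>k. (real (k + \<nu>) / real N) ^ \<nu> * (exp Q * (?y ^ i / fact i)))"
    by (intro sum_mono kernel_A_term_le[OF N k x q])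
  also have "\<dots> = (real (k + \<nu>) / real N) ^ \<nu> * (exp Q * (\<Sum>i\<le>k. ?y ^ i / fact i))"
    by (simp only: sum_distrib_left)
  also have "\<dots> \<le> (real (k + \<nu>) / real N) ^ \<nu> * (exp Q * exp ?y)"
  proof (intro mult_left_mono)
    have "(\<Sum>i\<le>k. ?y ^ i / fact i) = (\<Sum>i\<le>k. ?y ^ i /\<^sub>R fact i)" by (simp add: divide_inverse mult.commute)
    also have "\<dots> \<le> (\<Sum>i. ?y ^ i /\<^sub>R fact i)" using y by (intro sum_le_suminf summable_exp_generic) auto
    finally show "(\<Sum>i\<le>k. ?y ^ i / fact i) \<le> exp ?y" by (simp add: exp_def)
  qed auto
  finally show ?thesis by (simp add: mult_ac)
qed

text \<open>Tannery's theorem: the vanishing of \<open>lag\<close> beyond k makes the finite sum a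
  series, each term converges by the asymptotics of binomial coefficients, and a multiple of an
  exponential series dominates.\<close>

lemma kernel_A_limit:
  assumes N: "\<And>m. m < N m" and k: "\<And>m. k m \<le> N m" "(\<lambda>m. real (k m) / real (N m)) \<longlonglongrightarrow> u"
    and x: "\<And>m. 0 \<le> x m" "x \<longlonglongrightarrow> x0" and q: "\<And>m. 0 \<le> q m" "q \<longlonglongrightarrow> 0"
  shows "(\<lambda>m. kernel_A \<nu> \<kappa> (x m / real (N m)) (q m) (k m) / real (N m) ^ \<nu>) \<longlonglongrightarrow> u ^ \<nu> * hyp03 \<nu> \<kappa> (u * x0)"
proof -
  have Ntop: "filterlim N at_top sequentially"
    by (rule filterlim_at_top_mono[OF filterlim_ident]) (use N in \<open>auto intro!: always_eventually less_imp_le\<close>)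
  define a where "a = (\<lambda>i m. lag \<nu> (k m) i * (x m / real (N m)) ^ i * clif (\<kappa> + i) (- q m) / real (N m) ^ \<nu>)"
  define b where "b = (\<lambda>i. u ^ \<nu> * ((- (u * x0)) ^ i / (fact i * fact (i + \<nu>) * fact (i + \<kappa>))))"
  have A: "(\<Sum>i. a i m) = kernel_A \<nu> \<kappa> (x m / real (N m)) (q m) (k m) / real (N m) ^ \<nu>" for m
  proof -
    have "(\<Sum>i. a i m) = (\<Sum>i\<le>k m. a i m)"
      by (rule suminf_finite) (auto simp: a_def lag_eq_0)
    then show ?thesis by (simp add: a_def kernel_A_def sum_divide_distrib)
  qed
  have B: "(\<Sum>i. b i) = u ^ \<nu> * hyp03 \<nu> \<kappa> (u * x0)"
    unfolding b_def hyp03_def by (rule suminf_mult[OF sums_summable[OF hyp03_sums]])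
  have lim: "(\<lambda>m. a i m) \<longlonglongrightarrow> b i" for i
  proof -
    have "(\<lambda>m. real (k m + \<nu>) / real (N m)) \<longlonglongrightarrow> u + real \<nu> * 0"
    proof -
      have "(\<lambda>m. real (k m) / real (N m) + real \<nu> * (1 / real (N m))) \<longlonglongrightarrow> u + real \<nu> * 0"
        by (intro tendsto_intros k(2) filterlim_compose[OF lim_1_over_n Ntop])
      then show ?thesis by (simp add: add_divide_distrib)
    qed
    then have bin: "(\<lambda>m. real ((k m + \<nu>) choose (\<nu> + i)) / real (N m) ^ (\<nu> + i)) \<longlonglongrightarrow> u ^ (\<nu> + i) / fact (\<nu> + i)"
      by (intro binomial_ratio_limit Ntop) simp
    have cl: "(\<lambda>m. clif (\<kappa> + i) (- q m)) \<longlonglongrightarrow> clif (\<kappa> + i) 0"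
    proof -
      have "(\<lambda>m. - q m) \<longlonglongrightarrow> 0" using tendsto_minus[OF q(2)] by simp
      then show ?thesis by (rule isCont_tendsto_compose[OF isCont_clif])
    qed
    have "(\<lambda>m. (- 1) ^ i / fact i * (real ((k m + \<nu>) choose (\<nu> + i)) / real (N m) ^ (\<nu> + i)) * x m ^ i * clif (\<kappa> + i) (- q m))
        \<longlonglongrightarrow> (- 1) ^ i / fact i * (u ^ (\<nu> + i) / fact (\<nu> + i)) * x0 ^ i * clif (\<kappa> + i) 0"
      by (intro tendsto_intros bin cl x(2))
    moreover have "(- 1) ^ i / fact i * (real ((k m + \<nu>) choose (\<nu> + i)) / real (N m) ^ (\<nu> + i)) * x m ^ i * clif (\<kappa> + i) (- q m) = a i m" for m
      by (simp add: a_def lag_def power_add power_divide)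
    moreover have "(- 1) ^ i / fact i * (u ^ (\<nu> + i) / fact (\<nu> + i)) * x0 ^ i * clif (\<kappa> + i) 0 = b i"
      by (simp add: b_def clif_0 power_add power_mult_distrib power_minus[of "u * x0"] add.commute mult_ac)
    ultimately show ?thesis by simp
  qed
  obtain X where X: "\<And>m. x m \<le> X"
    using convergent_imp_Bseq[OF convergentI[OF x(2)]] unfolding Bseq_def by (metis abs_le_D1 real_norm_def)
  obtain Q where Q: "\<And>m. q m \<le> Q"
    using convergent_imp_Bseq[OF convergentI[OF q(2)]] unfolding Bseq_def by (metis abs_le_D1 real_norm_def)
  define M where "M = (\<lambda>i. (1 + real \<nu>) ^ \<nu> * (exp Q * (((1 + real \<nu>) * X) ^ i / fact i)))"
  have X0: "0 \<le> X" using x(1)[of 0] X[of 0] by linarith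
  have bound: "norm (a i m) \<le> M i" for i m
  proof -
    have N0: "N m > 0" using N[of m] by simp
    have "real (k m + \<nu>) / real (N m) \<le> 1 + real \<nu>"
    proof -
      have "real (k m + \<nu>) \<le> real (N m) + real \<nu> * real (N m)"
        using k(1)[of m] N0 by (simp add: mult_le_cancel_left1 add_mono)
      then show ?thesis using N0 by (simp add: field_simps)
    qed
    then have "(real (k m + \<nu>) / real (N m)) ^ \<nu> * (exp Q * (((1 + real \<nu>) * X) ^ i / fact i)) \<le> M i"
      unfolding M_def using X0 by (intro mult_right_mono power_mono) auto
    with kernel_A_term_le[OF N0 k(1)[of m] x(1)[of m] X[of m] q(1)[of m] Q[of m], of \<nu> i "\<kappa> + i"]
    show ?thesis unfolding a_def real_norm_def by (rule order_trans)
  qed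
  have "summable (\<lambda>i. ((1 + real \<nu>) * X) ^ i / fact i)"
    using summable_exp_abs[of "(1 + real \<nu>) * X"] X0 by (simp add: abs_mult)
  then have "summable M" unfolding M_def by (intro summable_mult)
  then have "(\<lambda>m. \<Sum>i. a i m) \<longlonglongrightarrow> (\<Sum>i. b i)"
    using tannerys_theorem[where M = M and F = sequentially, OF lim] bound by (simp add: always_eventually)
  then show ?thesis unfolding A B .
qed

section \<open>Majorant and limit of the second kernel factor\<close>

lemma power_one_minus_limit:
  fixes \<theta> :: "nat \<Rightarrow> real" and k :: "nat \<Rightarrow> nat"
  assumes \<theta>: "\<And>m. 0 \<le> \<theta> m" "\<theta> \<longlonglongrightarrow> 0" and k\<theta>: "(\<lambda>m. real (k m) * \<theta> m) \<longlonglongrightarrow> L"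
  shows "(\<lambda>m. (1 - \<theta> m) ^ k m) \<longlonglongrightarrow> exp (- L)"
proof -
  have small: "\<forall>\<^sub>F m in sequentially. \<theta> m \<le> 1 / 2"
    using order_tendstoD(2)[OF \<theta>(2), of "1 / 2"] by (auto elim!: eventually_mono)
  have "(\<lambda>m. real (k m) * ln (1 - \<theta> m)) \<longlonglongrightarrow> - L"
  proof (rule tendsto_sandwich)
    show "\<forall>\<^sub>F m in sequentially. - (real (k m) * \<theta> m) - 2 * (real (k m) * \<theta> m) * \<theta> m \<le> real (k m) * ln (1 - \<theta> m)"
      using small
    proof eventually_elim
      case (elim m)
      have "real (k m) * (- \<theta> m - 2 * (\<theta> m)\<^sup>2) \<le> real (k m) * ln (1 - \<theta> m)"
        using elim \<theta>(1)[of m] by (intro mult_left_mono ln_one_minus_pos_lower_bound) auto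
      then show ?case by (simp add: algebra_simps power2_eq_square)
    qed
    show "\<forall>\<^sub>F m in sequentially. real (k m) * ln (1 - \<theta> m) \<le> - (real (k m) * \<theta> m)"
      using small
    proof eventually_elim
      case (elim m)
      have "ln (1 - \<theta> m) \<le> - \<theta> m" using ln_le_minus_one[of "1 - \<theta> m"] elim by simp
      then have "real (k m) * ln (1 - \<theta> m) \<le> real (k m) * - \<theta> m" by (intro mult_left_mono) auto
      then show ?case by simp
    qed
    have "(\<lambda>m. - (real (k m) * \<theta> m) - 2 * (real (k m) * \<theta> m) * \<theta> m) \<longlonglongrightarrow> - L - 2 * L * 0"
      by (intro tendsto_intros k\<theta> \<theta>(2))
    then show "(\<lambda>m. - (real (k m) * \<theta> m) - 2 * (real (k m) * \<theta> m) * \<theta> m) \<longlonglongrightarrow> - L" by simp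
    show "(\<lambda>m. - (real (k m) * \<theta> m)) \<longlonglongrightarrow> - L" by (intro tendsto_minus k\<theta>)
  qed
  then have "(\<lambda>m. exp (real (k m) * ln (1 - \<theta> m))) \<longlonglongrightarrow> exp (- L)" by (intro tendsto_exp)
  then show ?thesis
  proof (rule Lim_transform_eventually)
    show "\<forall>\<^sub>F m in sequentially. exp (real (k m) * ln (1 - \<theta> m)) = (1 - \<theta> m) ^ k m"
      using small by eventually_elim (simp add: exp_of_nat_mult)
  qed
qed

text \<open>Allows the factor exp (-Y / X) to be traded for the power (X / Y)^(\<mu> + 1/8), which
  exactly reduces X^(-\<mu> - 1) to the exponent -7/8 of \<open>dominant\<close>.\<close>

lemma powr_exp_minus_le:
  fixes t :: real
  assumes "t \<ge> 0"
  shows "t powr (real \<mu> + 1 / 8) * exp (- t) \<le> 1 + fact (\<mu> + 1)"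
proof -
  have "t powr (real \<mu> + 1 / 8) \<le> 1 + t ^ (\<mu> + 1)"
  proof (cases "t \<le> 1")
    case True
    then have "t powr (real \<mu> + 1 / 8) \<le> 1" using assms powr_mono2[of "real \<mu> + 1 / 8" t 1] by simp
    then show ?thesis using assms by (simp add: add_increasing2)
  next
    case False
    then have "t powr (real \<mu> + 1 / 8) \<le> t powr (real (\<mu> + 1))" by (intro powr_mono) auto
    also have "\<dots> = t ^ (\<mu> + 1)" using False by (intro powr_realpow) auto
    finally show ?thesis by simp
  qed
  also have "\<dots> \<le> exp t + fact (\<mu> + 1) * exp t"
    using assms power_le_fact_exp[OF assms, of "\<mu> + 1"] by (intro add_mono) auto
  finally have "t powr (real \<mu> + 1 / 8) * exp (- t) \<le> (exp t + fact (\<mu> + 1) * exp t) * exp (- t)"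
    by (intro mult_right_mono) auto
  also have "\<dots> = 1 + fact (\<mu> + 1)" by (simp add: exp_minus field_simps)
  finally show ?thesis .
qed

text \<open>From p <= w c the base of the power lies in [1 - w, 1], so it is bounded by an
  exponential with rate proportional to k + 1. Trading that exponential for a power leaves
  \<open>dominant\<close> times a negative power of p (k + 1), which separates Z from k.\<close>

lemma kernel_B_integrand_le:
  fixes p c w Z :: real
  assumes le: "\<kappa> \<le> \<nu>" and Z: "Z > 0" and c: "c > 0" and p: "0 < p" "p \<le> w * c" and w: "w < 1"
  shows "\<bar>Z ^ \<kappa> * clif \<kappa> Z / (Z + c) ^ (\<nu> + 1) * (1 - p / (Z + c)) ^ k\<bar>
    \<le> 4 * (1 + fact (\<nu> - \<kappa> + 1)) / (1 - w) * (p * real (k + 1)) powr (- (real (\<nu> - \<kappa>) + 1 / 8)) * dominant Z"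
proof -
  define \<mu> where "\<mu> = \<nu> - \<kappa>"
  define X where "X = Z + c"
  define \<theta> where "\<theta> = p / X"
  define Y where "Y = p * real (k + 1)"
  have X: "X > 0" "Z \<le> X" "c \<le> X" using Z c by (auto simp: X_def)
  have Y: "Y > 0" using p by (simp add: Y_def)
  have "w > 0" using p c by (smt (verit) mult_nonpos_nonneg)
  then have "w * c \<le> w * X" using X by (intro mult_left_mono) auto
  then have \<theta>: "0 \<le> \<theta>" "\<theta> \<le> w" using p X by (auto simp: \<theta>_def field_simps)
  \<comment> \<open>One more power of the base is bought at the price 1 / (1 - w), so that the
    exponent Y is positive even for k = 0.\<close>
  have e1: "(1 - \<theta>) ^ k \<le> exp (- (Y / X)) / (1 - w)"
  proof -
    have "(1 - \<theta>) ^ (k + 1) \<le> exp (- \<theta>) ^ (k + 1)"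
      using \<theta> w exp_ge_add_one_self[of "- \<theta>"] by (intro power_mono) auto
    also have "\<dots> = exp (real (k + 1) * - \<theta>)" by (rule exp_of_nat_mult[symmetric])
    also have "real (k + 1) * - \<theta> = - (Y / X)" by (simp add: Y_def \<theta>_def mult.commute)
    finally have "(1 - \<theta>) ^ k * (1 - \<theta>) \<le> exp (- (Y / X))" by (simp add: mult.commute)
    moreover have "(1 - \<theta>) ^ k * (1 - w) \<le> (1 - \<theta>) ^ k * (1 - \<theta>)"
      using \<theta> w by (intro mult_left_mono) auto
    ultimately show ?thesis using w by (simp add: field_simps)
  qed
  have e2: "Z ^ \<kappa> / X ^ (\<nu> + 1) \<le> 1 / X ^ (\<mu> + 1)"
  proof -
    have "Z ^ \<kappa> / X ^ (\<nu> + 1) \<le> X ^ \<kappa> / X ^ (\<nu> + 1)" using X Z by (intro divide_right_mono power_mono) auto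
    also have "\<dots> = 1 / X ^ (\<mu> + 1)"
    proof -
      have "X ^ (\<nu> + 1) = X ^ \<kappa> * X ^ (\<mu> + 1)" using le by (simp add: \<mu>_def flip: power_add)
      then show ?thesis using X by simp
    qed
    finally show ?thesis .
  qed
  \<comment> \<open>Of the \<mu> + 1 powers of 1 / X, \<mu> + 1/8 are absorbed by the exponential;
    the remaining 7/8 are bounded through Z <= X.\<close>
  have e3: "1 / X ^ (\<mu> + 1) * exp (- (Y / X)) \<le> (1 + fact (\<mu> + 1)) * Y powr (- (real \<mu> + 1 / 8)) * Z powr (- 7 / 8)"
  proof -
    have "1 / X ^ (\<mu> + 1) = X powr (- (real \<mu> + 1))"
    proof -
      have "X ^ (\<mu> + 1) = X powr (real \<mu> + 1)" using X powr_realpow[of X "\<mu> + 1"] by (simp add: add.commute)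
      then show ?thesis by (simp only: powr_minus inverse_eq_divide)
    qed
    also have "\<dots> = (Y / X) powr (real \<mu> + 1 / 8) * Y powr (- (real \<mu> + 1 / 8)) * X powr (- 7 / 8)"
    proof -
      have "(Y / X) powr (real \<mu> + 1 / 8) = Y powr (real \<mu> + 1 / 8) / X powr (real \<mu> + 1 / 8)"
        using X Y by (simp add: powr_divide)
      then have "(Y / X) powr (real \<mu> + 1 / 8) = Y powr (real \<mu> + 1 / 8) * X powr (- (real \<mu> + 1 / 8))"
        unfolding powr_minus[of X] by (simp only: divide_inverse)
      then have "(Y / X) powr (real \<mu> + 1 / 8) * Y powr (- (real \<mu> + 1 / 8)) * X powr (- 7 / 8)
          = (Y powr (real \<mu> + 1 / 8) * Y powr (- (real \<mu> + 1 / 8))) * (X powr (- (real \<mu> + 1 / 8)) * X powr (- 7 / 8))"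
        by (simp only: mult_ac)
      also have "X powr (- (real \<mu> + 1 / 8)) * X powr (- 7 / 8) = X powr (- (real \<mu> + 1))"
        unfolding powr_add[symmetric] by (rule arg_cong[where f = "\<lambda>t. X powr t"]) simp
      also have "Y powr (real \<mu> + 1 / 8) * Y powr (- (real \<mu> + 1 / 8)) = 1"
        unfolding powr_add[symmetric] using Y by simp
      finally show ?thesis by simp
    qed
    finally have "1 / X ^ (\<mu> + 1) * exp (- (Y / X))
        = ((Y / X) powr (real \<mu> + 1 / 8) * exp (- (Y / X))) * Y powr (- (real \<mu> + 1 / 8)) * X powr (- 7 / 8)"
      by (simp only: mult_ac)
    also have "\<dots> \<le> (1 + fact (\<mu> + 1)) * Y powr (- (real \<mu> + 1 / 8)) * Z powr (- 7 / 8)"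
      using X Y Z by (intro mult_mono powr_exp_minus_le powr_mono2') auto
    finally show ?thesis .
  qed
  have "\<bar>Z ^ \<kappa> * clif \<kappa> Z / X ^ (\<nu> + 1) * (1 - \<theta>) ^ k\<bar> = \<bar>clif \<kappa> Z\<bar> * (Z ^ \<kappa> / X ^ (\<nu> + 1) * (1 - \<theta>) ^ k)"
    using Z X \<theta> w by (simp add: abs_mult mult_ac)
  also have "\<dots> \<le> (4 * (1 + Z) powr (- 1 / 4)) * (1 / X ^ (\<mu> + 1) * (exp (- (Y / X)) / (1 - w)))"
    using Z X \<theta> w by (intro mult_mono clif_decay e1 e2) auto
  also have "\<dots> = 4 / (1 - w) * (1 + Z) powr (- 1 / 4) * (1 / X ^ (\<mu> + 1) * exp (- (Y / X)))" by simp
  also have "\<dots> \<le> 4 / (1 - w) * (1 + Z) powr (- 1 / 4) * ((1 + fact (\<mu> + 1)) * Y powr (- (real \<mu> + 1 / 8)) * Z powr (- 7 / 8))"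
    using w by (intro mult_left_mono e3) auto
  also have "\<dots> = 4 * (1 + fact (\<mu> + 1)) / (1 - w) * Y powr (- (real \<mu> + 1 / 8)) * dominant Z"
    by (simp add: dominant_def)
  finally show ?thesis by (simp only: X_def \<theta>_def Y_def \<mu>_def)
qed

lemma kernel_B_bound:
  assumes le: "\<kappa> \<le> \<nu>" and c: "c > 0" and p: "0 < p" "p \<le> w * c" and w: "w < 1"
  shows "\<bar>kernel_B \<nu> \<kappa> p c k\<bar>
    \<le> 4 * (1 + fact (\<nu> - \<kappa> + 1)) / (1 - w) * (p * real (k + 1)) powr (- (real (\<nu> - \<kappa>) + 1 / 8)) * integral\<^sup>L half_line dominant"
proof -
  let ?f = "\<lambda>Z. Z ^ \<kappa> * clif \<kappa> Z / (Z + c) ^ (\<nu> + 1) * (1 - p / (Z + c)) ^ k"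
  let ?g = "\<lambda>Z. 4 * (1 + fact (\<nu> - \<kappa> + 1)) / (1 - w) * (p * real (k + 1)) powr (- (real (\<nu> - \<kappa>) + 1 / 8)) * dominant Z"
  have ig: "integrable half_line ?g" by (intro integrable_mult_right integrable_dominant)
  have "norm (integral\<^sup>L half_line ?f) \<le> integral\<^sup>L half_line ?g"
  proof (rule Bochner_Integration.integral_norm_bound_integral[OF _ ig])
    show "integrable half_line ?f"
    proof (rule integrable_half_line_bound[OF ig])
      show "?f \<in> borel_measurable half_line" by (intro measurable_half_lineI) measurable
      show "norm (?f Z) \<le> ?g Z" if "Z > 0" for Z
        unfolding real_norm_def by (rule kernel_B_integrand_le[OF le that c p w])
    qed
    show "norm (?f Z) \<le> ?g Z" if "Z \<in> space half_line" for Z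
      unfolding real_norm_def by (rule kernel_B_integrand_le[OF le _ c p w]) (use that in simp)
  qed
  then show ?thesis by (simp add: kernel_B_def)
qed

text \<open>For fixed Z, c tends to 0 and p k to L, so the k-th power tends to exp (-L / Z) while
  \<kappa> powers of Z cancel. The lower bound l makes the majorant independent of m.\<close>

lemma kernel_B_limit:
  assumes le: "\<kappa> \<le> \<nu>" and c: "\<And>m. c m > 0" "c \<longlonglongrightarrow> 0" and p: "\<And>m. 0 < p m" "\<And>m. p m \<le> w * c m" and w: "w < 1"
    and k: "(\<lambda>m. p m * real (k m)) \<longlonglongrightarrow> L" and L: "\<And>m. l \<le> p m * real (k m + 1)" "l > 0"
  shows "(\<lambda>m. kernel_B \<nu> \<kappa> (p m) (c m) (k m)) \<longlonglongrightarrow> (\<integral>X. clif \<kappa> X / X ^ (\<nu> - \<kappa> + 1) * exp (- L / X) \<partial>half_line)"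
  unfolding kernel_B_def
proof (rule integral_dominated_convergence)
  let ?g = "\<lambda>Z. 4 * (1 + fact (\<nu> - \<kappa> + 1)) / (1 - w) * l powr (- (real (\<nu> - \<kappa>) + 1 / 8)) * dominant Z"
  show "integrable half_line ?g" by (intro integrable_mult_right integrable_dominant)
  show "(\<lambda>X. clif \<kappa> X / X ^ (\<nu> - \<kappa> + 1) * exp (- L / X)) \<in> borel_measurable half_line"
    by (intro measurable_half_lineI) measurable
  show "(\<lambda>Z. Z ^ \<kappa> * clif \<kappa> Z / (Z + c m) ^ (\<nu> + 1) * (1 - p m / (Z + c m)) ^ k m) \<in> borel_measurable half_line" for m
    by (intro measurable_half_lineI) measurable
  show "AE Z in half_line. norm (Z ^ \<kappa> * clif \<kappa> Z / (Z + c m) ^ (\<nu> + 1) * (1 - p m / (Z + c m)) ^ k m) \<le> ?g Z" for m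
  proof (rule AE_half_lineI)
    fix Z :: real assume Z: "Z > 0"
    have "(p m * real (k m + 1)) powr (- (real (\<nu> - \<kappa>) + 1 / 8)) \<le> l powr (- (real (\<nu> - \<kappa>) + 1 / 8))"
      using L by (intro powr_mono2') auto
    then have "4 * (1 + fact (\<nu> - \<kappa> + 1)) / (1 - w) * (p m * real (k m + 1)) powr (- (real (\<nu> - \<kappa>) + 1 / 8)) * dominant Z \<le> ?g Z"
      using w by (intro mult_right_mono mult_left_mono dominant_nonneg) auto
    then show "norm (Z ^ \<kappa> * clif \<kappa> Z / (Z + c m) ^ (\<nu> + 1) * (1 - p m / (Z + c m)) ^ k m) \<le> ?g Z"
      using kernel_B_integrand_le[OF le Z c(1) p(1) p(2) w, of m "k m"] unfolding real_norm_def by (rule order_trans[rotated])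
  qed
  show "AE Z in half_line. (\<lambda>m. Z ^ \<kappa> * clif \<kappa> Z / (Z + c m) ^ (\<nu> + 1) * (1 - p m / (Z + c m)) ^ k m)
      \<longlonglongrightarrow> clif \<kappa> Z / Z ^ (\<nu> - \<kappa> + 1) * exp (- L / Z)"
  proof (rule AE_half_lineI)
    fix Z :: real assume Z: "Z > 0"
    have Zc: "(\<lambda>m. Z + c m) \<longlonglongrightarrow> Z" using tendsto_add[OF tendsto_const c(2), of Z] by simp
    have p0: "p \<longlonglongrightarrow> 0"
    proof (rule tendsto_sandwich[OF _ _ tendsto_const])
      show "(\<lambda>m. w * c m) \<longlonglongrightarrow> 0" using tendsto_mult[OF tendsto_const c(2), of w] by simp
    qed (use p in \<open>auto intro!: always_eventually less_imp_le\<close>)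
    have pow: "(\<lambda>m. (1 - p m / (Z + c m)) ^ k m) \<longlonglongrightarrow> exp (- (L / Z))"
    proof (rule power_one_minus_limit)
      show "0 \<le> p m / (Z + c m)" for m using p(1)[of m] c(1)[of m] Z by simp
      show "(\<lambda>m. p m / (Z + c m)) \<longlonglongrightarrow> 0" using tendsto_divide[OF p0 Zc] Z by simp
      have "(\<lambda>m. p m * real (k m) / (Z + c m)) \<longlonglongrightarrow> L / Z" using Z by (intro tendsto_divide k Zc) auto
      then show "(\<lambda>m. real (k m) * (p m / (Z + c m))) \<longlonglongrightarrow> L / Z" by (simp add: mult_ac)
    qed
    have lim: "(\<lambda>m. Z ^ \<kappa> * clif \<kappa> Z / (Z + c m) ^ (\<nu> + 1) * (1 - p m / (Z + c m)) ^ k m)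
        \<longlonglongrightarrow> Z ^ \<kappa> * clif \<kappa> Z / Z ^ (\<nu> + 1) * exp (- (L / Z))"
      using Z by (intro tendsto_intros Zc pow) auto
    have "Z ^ (\<nu> + 1) = Z ^ \<kappa> * Z ^ (\<nu> - \<kappa> + 1)" using le by (simp flip: power_add)
    then have e: "Z ^ \<kappa> * clif \<kappa> Z / Z ^ (\<nu> + 1) * exp (- (L / Z)) = clif \<kappa> Z / Z ^ (\<nu> - \<kappa> + 1) * exp (- L / Z)"
      using Z by simp
    show "(\<lambda>m. Z ^ \<kappa> * clif \<kappa> Z / (Z + c m) ^ (\<nu> + 1) * (1 - p m / (Z + c m)) ^ k m)
        \<longlonglongrightarrow> clif \<kappa> Z / Z ^ (\<nu> - \<kappa> + 1) * exp (- L / Z)"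
      using lim unfolding e .
  qed
qed

section \<open>The Meijer kernel and the limit of the rescaled kernel\<close>

lemma integrable_powr_unit: "integrable lborel (\<lambda>u :: real. indicator {0<..<1} u *\<^sub>R u powr (- 1 / 8))"
proof -
  have "(\<lambda>u :: real. u powr (- 1 / 8)) absolutely_integrable_on {0<..1}"
    by (intro nonnegative_absolutely_integrable_1 integrable_on_powr_from_0') auto
  then have "set_integrable lborel {0<..1} (\<lambda>u :: real. u powr (- 1 / 8))"
    unfolding set_integrable_def by (subst (asm) integrable_completion) auto
  then have "set_integrable lborel {0<..<1} (\<lambda>u :: real. u powr (- 1 / 8))"
    by (rule set_integrable_subset) auto
  then show ?thesis by (simp add: set_integrable_def)
qed

lemma borel_measurable_hyp03 [measurable]: "hyp03 \<nu> \<kappa> \<in> borel_measurable borel"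
  unfolding hyp03_def by measurable

lemma borel_measurable_meijer_G2_real [measurable]: "meijer_G2_real \<nu> \<kappa> \<in> borel_measurable borel"
  unfolding meijer_G2_real_def by measurable

lemma meijer_kernel_eq:
  assumes le: "\<kappa> \<le> \<nu>" and x: "x > 0" and y: "y > 0"
  shows "meijer_kernel \<nu> \<kappa> x y = of_real (LBINT u. indicator {0<..<1} u *\<^sub>R (hyp03 \<nu> \<kappa> (u * x) * meijer_G2_real \<nu> \<kappa> (u * y)))"
proof -
  define f where "f = (\<lambda>u. indicator {0<..<1} u *\<^sub>R (hyp03 \<nu> \<kappa> (u * x) * meijer_G2_real \<nu> \<kappa> (u * y)))"
  define g where "g = (\<lambda>u. meijer_G 1 [0, - of_nat \<nu>, - of_nat \<kappa>] (of_real (u * x)) * meijer_G 2 [of_nat \<nu>, of_nat \<kappa>, 0] (of_real (u * y)))"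
  have [measurable]: "f \<in> borel_measurable borel" unfolding f_def by measurable
  \<comment> \<open>The Meijer functions have been evaluated at positive arguments only. The
    integrand differs from the measurable function f at the two end points at most, which gives its
    measurability and its integral.\<close>
  have eq: "(\<lambda>u. indicator {0..1} u *\<^sub>R g u) = (\<lambda>u. if u = 0 then g 0 else if u = 1 then g 1 else of_real (f u))"
  proof
    fix u :: real
    have "g u = of_real (f u)" if "u \<in> {0<..<1}"
    proof -
      have "u * x > 0" "u * y > 0" using that x y by auto
      then show ?thesis using that
        unfolding f_def g_def meijer_G_1_eq_hyp03[OF \<open>u * x > 0\<close>] meijer_G_2_eq[OF \<open>u * y > 0\<close> le] by simp
    qed
    then show "indicator {0..1} u *\<^sub>R g u = (if u = 0 then g 0 else if u = 1 then g 1 else of_real (f u))"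
      by (auto simp: indicator_def f_def)
  qed
  have "meijer_kernel \<nu> \<kappa> x y = (\<integral>u. indicator {0..1} u *\<^sub>R g u \<partial>lborel)"
    by (simp add: meijer_kernel_def set_lebesgue_integral_def g_def)
  also have "\<dots> = (\<integral>u. of_real (f u) \<partial>lborel)"
  proof (rule integral_cong_AE)
    show "(\<lambda>u. indicator {0..1} u *\<^sub>R g u) \<in> borel_measurable lborel"
    proof -
      have "(\<lambda>u. if u = 0 then g 0 else if u = 1 then g 1 else of_real (f u)) \<in> borel_measurable borel" by measurable
      then show ?thesis unfolding eq by simp
    qed
    have "AE u in lborel. u \<noteq> (0 :: real)" "AE u in lborel. u \<noteq> (1 :: real)" by (rule AE_lborel_singleton)+
    then show "AE u in lborel. indicator {0..1} u *\<^sub>R g u = of_real (f u)"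
      by eventually_elim (use eq in \<open>simp add: fun_eq_iff\<close>)
  qed simp
  also have "\<dots> = of_real (LBINT u. f u)" by (rule integral_complex_of_real)
  finally show ?thesis by (simp only: f_def)
qed

text \<open>All powers of \<delta> cancel. Of the \<nu> + 1 powers of 1 / n, \<nu> normalise
  \<open>kernel_A\<close> and one is the mesh of the Riemann sum.\<close>

lemma scaled_kernel_eq:
  assumes ab: "\<alpha> > 0" "\<alpha> < \<beta>" and le: "\<kappa> \<le> \<nu>" and n: "n > 0"
    and K: "is_correlation_kernel \<kappa> \<nu> \<alpha> \<beta> n K" and x: "x > 0" and y: "y > 0"
  defines "\<delta> \<equiv> \<beta>\<^sup>2 - \<alpha>\<^sup>2"
  shows "1 / (real n * \<delta>) * K (x / (real n * \<delta>)) (y / (real n * \<delta>))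
    = x ^ \<kappa> * y ^ (\<nu> - \<kappa>) * ((\<Sum>k<n. kernel_A \<nu> \<kappa> (x / real n) (\<alpha>\<^sup>2 * (x / (real n * \<delta>))) k / real n ^ \<nu>
      * kernel_B \<nu> \<kappa> (y / real n) (\<beta>\<^sup>2 * (y / (real n * \<delta>))) k) / real n)"
proof -
  have \<delta>: "\<delta> > 0" using ab by (simp add: \<delta>_def power_strict_mono)
  define s where "s = real n * \<delta>"
  have s: "s > 0" using n \<delta> by (simp add: s_def)
  have xs: "x / s > 0" "y / s > 0" using x y s by auto
  have d: "\<delta> * (x / s) = x / real n" "\<delta> * (y / s) = y / real n" using \<delta> n by (auto simp: s_def)
  let ?S = "\<Sum>k<n. kernel_A \<nu> \<kappa> (x / real n) (\<alpha>\<^sup>2 * (x / s)) k * kernel_B \<nu> \<kappa> (y / real n) (\<beta>\<^sup>2 * (y / s)) k"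
  have "1 / s * K (x / s) (y / s) = (1 / s * (\<delta> ^ (\<nu> + 1) * (x / s) ^ \<kappa> * (y / s) ^ (\<nu> - \<kappa>))) * ?S"
    unfolding kernel_formula[OF ab le K xs] \<delta>_def[symmetric] d by (simp only: mult.assoc)
  also have "1 / s * (\<delta> ^ (\<nu> + 1) * (x / s) ^ \<kappa> * (y / s) ^ (\<nu> - \<kappa>)) = x ^ \<kappa> * y ^ (\<nu> - \<kappa>) / (real n ^ \<nu> * real n)"
  proof -
    have "s ^ \<kappa> * s ^ (\<nu> - \<kappa>) = s ^ \<nu>" using le by (simp flip: power_add)
    then have "1 / s * (\<delta> ^ (\<nu> + 1) * (x / s) ^ \<kappa> * (y / s) ^ (\<nu> - \<kappa>)) = \<delta> ^ (\<nu> + 1) * x ^ \<kappa> * y ^ (\<nu> - \<kappa>) / (s ^ \<nu> * s)"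
      by (simp add: power_divide)
    also have "\<dots> = x ^ \<kappa> * y ^ (\<nu> - \<kappa>) / (real n ^ \<nu> * real n)"
      using \<delta> n by (simp add: s_def power_mult_distrib field_simps)
    finally show ?thesis .
  qed
  finally have "1 / s * K (x / s) (y / s) = x ^ \<kappa> * y ^ (\<nu> - \<kappa>) / (real n ^ \<nu> * real n) * ?S" .
  also have "\<dots> = x ^ \<kappa> * y ^ (\<nu> - \<kappa>) * ((\<Sum>k<n. kernel_A \<nu> \<kappa> (x / real n) (\<alpha>\<^sup>2 * (x / s)) k / real n ^ \<nu>
      * kernel_B \<nu> \<kappa> (y / real n) (\<beta>\<^sup>2 * (y / s)) k) / real n)"
    by (simp add: sum_divide_distrib[symmetric] mult_ac)
  finally show ?thesis by (simp only: s_def)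
qed

lemma nat_floor_ratio_limit:
  assumes "filterlim N at_top sequentially" "u \<ge> 0"
  shows "(\<lambda>m. real (nat \<lfloor>u * real (N m)\<rfloor>) / real (N m)) \<longlonglongrightarrow> u"
proof (rule tendsto_sandwich[OF _ _ _ tendsto_const])
  have inv: "(\<lambda>m. 1 / real (N m)) \<longlonglongrightarrow> 0" by (rule filterlim_compose[OF lim_1_over_n assms(1)])
  have "(\<lambda>m. u - 1 / real (N m)) \<longlonglongrightarrow> u - 0" by (intro tendsto_intros inv)
  then show "(\<lambda>m. u - 1 / real (N m)) \<longlonglongrightarrow> u" by simp
  have pos: "\<forall>\<^sub>F m in sequentially. N m > 0"
    using assms(1) by (rule eventually_compose_filterlim[OF eventually_gt_at_top])
  have fl: "real (nat \<lfloor>u * real n\<rfloor>) = of_int \<lfloor>u * real n\<rfloor>" for n using assms(2) by simp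
  show "\<forall>\<^sub>F m in sequentially. u - 1 / real (N m) \<le> real (nat \<lfloor>u * real (N m)\<rfloor>) / real (N m)"
    using pos
  proof eventually_elim
    case (elim m)
    have "(u * real (N m) - 1) / real (N m) \<le> real (nat \<lfloor>u * real (N m)\<rfloor>) / real (N m)"
      unfolding fl by (intro divide_right_mono) linarith+
    then show ?case using elim by (simp add: diff_divide_distrib)
  qed
  show "\<forall>\<^sub>F m in sequentially. real (nat \<lfloor>u * real (N m)\<rfloor>) / real (N m) \<le> u"
    using pos by eventually_elim (unfold fl, simp add: divide_le_eq)
qed

text \<open>Dominated convergence over u with k = floor (u N). The lower bound l for y keeps the
  majorant of \<open>kernel_B\<close> uniform in m, and the upper bound X for x that of
  \<open>kernel_A\<close>.\<close>

lemma scaled_kernel_limit: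
  assumes ab: "\<alpha> > 0" "\<alpha> < \<beta>" and le: "\<kappa> \<le> \<nu>"
    and K: "\<And>n. is_correlation_kernel \<kappa> \<nu> \<alpha> \<beta> n (K n)"
    and N: "\<And>m. m < N m" and l: "l > 0" "\<And>m. l \<le> x m" "\<And>m. l \<le> y m" and X: "\<And>m. x m \<le> X"
    and x: "x \<longlonglongrightarrow> x0" and y: "y \<longlonglongrightarrow> y0"
  defines "\<delta> \<equiv> \<beta>\<^sup>2 - \<alpha>\<^sup>2"
  shows "(\<lambda>m. 1 / (real (N m) * \<delta>) * K (N m) (x m / (real (N m) * \<delta>)) (y m / (real (N m) * \<delta>)))
    \<longlonglongrightarrow> (x0 / y0) ^ \<kappa> * (LBINT u. indicator {0<..<1} u *\<^sub>R (hyp03 \<nu> \<kappa> (u * x0) * meijer_G2_real \<nu> \<kappa> (u * y0)))"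
proof -
  define \<mu> where "\<mu> = \<nu> - \<kappa>"
  \<comment> \<open>This is exactly p / c for the p and c below; w < 1 because \<alpha> > 0.\<close>
  define w where "w = \<delta> / \<beta>\<^sup>2"
  have \<delta>: "\<delta> > 0" using ab by (simp add: \<delta>_def power_strict_mono)
  have b2: "\<beta>\<^sup>2 > 0" using ab by simp
  have w: "w < 1" using ab b2 by (simp add: w_def \<delta>_def)
  have Ntop: "filterlim N at_top sequentially"
    by (rule filterlim_at_top_mono[OF filterlim_ident]) (use N in \<open>auto intro!: always_eventually less_imp_le\<close>)
  have N0: "N m > 0" for m using N[of m] by simp
  have xy: "x m > 0" "y m > 0" for m using l(1) l(2)[of m] l(3)[of m] by linarith+
  have y0: "y0 > 0" using l(1) LIMSEQ_le_const[OF y, of l] l(3) by (meson less_le_trans)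
  have inv: "(\<lambda>m. 1 / real (N m)) \<longlonglongrightarrow> 0" by (rule filterlim_compose[OF lim_1_over_n Ntop])
  define p where "p = (\<lambda>m. y m / real (N m))"
  define c where "c = (\<lambda>m. \<beta>\<^sup>2 * (y m / (real (N m) * \<delta>)))"
  define q where "q = (\<lambda>m. \<alpha>\<^sup>2 * (x m / (real (N m) * \<delta>)))"
  define h where "h = (\<lambda>m k. kernel_A \<nu> \<kappa> (x m / real (N m)) (q m) k / real (N m) ^ \<nu> * kernel_B \<nu> \<kappa> (p m) (c m) k)"
  have p: "p m > 0" "c m > 0" "p m \<le> w * c m" for m
    using xy N0 \<delta> b2 by (simp_all add: p_def c_def w_def)
  have c0: "c \<longlonglongrightarrow> 0"
  proof -
    have "(\<lambda>m. (\<beta>\<^sup>2 / \<delta>) * (y m * (1 / real (N m)))) \<longlonglongrightarrow> (\<beta>\<^sup>2 / \<delta>) * (y0 * 0)" by (intro tendsto_intros y inv)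
    then show ?thesis by (simp add: c_def mult_ac)
  qed
  have q0: "q \<longlonglongrightarrow> 0"
  proof -
    have "(\<lambda>m. (\<alpha>\<^sup>2 / \<delta>) * (x m * (1 / real (N m)))) \<longlonglongrightarrow> (\<alpha>\<^sup>2 / \<delta>) * (x0 * 0)" by (intro tendsto_intros x inv)
    then show ?thesis by (simp add: q_def mult_ac)
  qed
  define Q where "Q = \<alpha>\<^sup>2 * (X / \<delta>)"
  have q: "0 \<le> q m" "q m \<le> Q" for m
  proof -
    show "0 \<le> q m" using xy[of m] N0[of m] \<delta> by (simp add: q_def)
    have "1 * \<delta> \<le> real (N m) * \<delta>" using N0[of m] \<delta> by (intro mult_right_mono) auto
    then have "x m / (real (N m) * \<delta>) \<le> X / \<delta>" using X[of m] xy[of m] \<delta> by (intro frac_le) auto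
    then show "q m \<le> Q" unfolding q_def Q_def by (intro mult_left_mono) auto
  qed
  have eq: "1 / (real (N m) * \<delta>) * K (N m) (x m / (real (N m) * \<delta>)) (y m / (real (N m) * \<delta>))
      = x m ^ \<kappa> * y m ^ \<mu> * (LBINT u. indicator {0..<1} u *\<^sub>R h m (nat \<lfloor>u * real (N m)\<rfloor>))" for m
    using scaled_kernel_eq[OF ab le N0[of m] K xy(1)[of m] xy(2)[of m]] riemann_sum_eq_integral[OF N0[of m], of "h m"]
    unfolding \<delta>_def[symmetric] by (simp add: has_bochner_integral_iff h_def p_def c_def q_def \<mu>_def)
  \<comment> \<open>The first factor supplies u^\<nu>, while \<open>meijer_G2_real\<close> contains
    (u y0)^\<nu>; hence the division by y0^\<nu>.\<close>
  define g where "g = (\<lambda>u. indicator {0<..<1} u *\<^sub>R (hyp03 \<nu> \<kappa> (u * x0) * meijer_G2_real \<nu> \<kappa> (u * y0) / y0 ^ \<nu>))"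
  define CA where "CA = exp Q * exp ((1 + real \<nu>) * X)"
  define CB where "CB = 4 * (1 + fact (\<nu> - \<kappa> + 1)) / (1 - w) * integral\<^sup>L half_line dominant"
  define W where "W = CA * (1 + real \<nu>) ^ \<nu> * (CB * l powr (- (real \<mu> + 1 / 8)))"
  have C0: "CA \<ge> 0" "CB \<ge> 0" using w by (auto simp: CA_def CB_def dominant_nonneg intro!: mult_nonneg_nonneg integral_nonneg_AE)
  have bound: "\<bar>h m k\<bar> \<le> W * u powr (- 1 / 8)" if u: "0 < u" "u < 1" and k: "k = nat \<lfloor>u * real (N m)\<rfloor>" for m k u
  proof -
    \<comment> \<open>The right end of the step containing u, so u <= t <= 1. The factors t^\<nu>
      and t^(-\<mu> - 1/8) combine to t^(\<kappa> - 1/8), which is at most u^(-1/8) and hence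
      integrable, also for \<kappa> = 0.\<close>
    define t where "t = real (k + 1) / real (N m)"
    have "0 \<le> u * real (N m)" using u by simp
    then have rk: "real k \<le> u * real (N m)" "u * real (N m) < real k + 1" unfolding k by linarith+
    have "real k < real (N m)" using rk(1) u N0[of m] by (smt (verit) mult_less_cancel_right2 of_nat_0_less_iff)
    then have kN: "k < N m" by simp
    have t: "u \<le> t" "t \<le> 1" "t > 0" using rk u N0[of m] kN by (auto simp: t_def field_simps)
    have "\<bar>kernel_A \<nu> \<kappa> (x m / real (N m)) (q m) k / real (N m) ^ \<nu>\<bar> \<le> CA * (real (k + \<nu>) / real (N m)) ^ \<nu>"
      unfolding CA_def using kN less_imp_le[OF xy(1)[of m]] by (intro kernel_A_bound N0 X q) auto
    also have "\<dots> \<le> CA * ((1 + real \<nu>) * t) ^ \<nu>"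
    proof (intro mult_left_mono power_mono)
      have "real (k + \<nu>) \<le> (1 + real \<nu>) * real (k + 1)" by (simp add: algebra_simps)
      then show "real (k + \<nu>) / real (N m) \<le> (1 + real \<nu>) * t" unfolding t_def by (simp add: divide_right_mono)
    qed (use C0 in auto)
    finally have A: "\<bar>kernel_A \<nu> \<kappa> (x m / real (N m)) (q m) k / real (N m) ^ \<nu>\<bar> \<le> CA * ((1 + real \<nu>) ^ \<nu> * t ^ \<nu>)"
      by (simp add: power_mult_distrib)
    have "p m * real (k + 1) = y m * t" by (simp add: p_def t_def)
    then have "\<bar>kernel_B \<nu> \<kappa> (p m) (c m) k\<bar> \<le> CB * (y m * t) powr (- (real \<mu> + 1 / 8))"
      using kernel_B_bound[OF le p(2) p(1) p(3) w, of m k] by (simp only: CB_def \<mu>_def mult_ac)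
    also have "\<dots> \<le> CB * (l * t) powr (- (real \<mu> + 1 / 8))"
      using l t C0 by (intro mult_left_mono powr_mono2' mult_right_mono) auto
    also have "(l * t) powr (- (real \<mu> + 1 / 8)) = l powr (- (real \<mu> + 1 / 8)) * t powr (- (real \<mu> + 1 / 8))"
      using l t by (intro powr_mult)
    finally have B: "\<bar>kernel_B \<nu> \<kappa> (p m) (c m) k\<bar> \<le> CB * (l powr (- (real \<mu> + 1 / 8)) * t powr (- (real \<mu> + 1 / 8)))" .
    have "\<bar>h m k\<bar> \<le> (CA * ((1 + real \<nu>) ^ \<nu> * t ^ \<nu>)) * (CB * (l powr (- (real \<mu> + 1 / 8)) * t powr (- (real \<mu> + 1 / 8))))"
      unfolding h_def abs_mult using A B C0 t by (intro mult_mono) auto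
    also have "\<dots> = W * (t ^ \<nu> * t powr (- (real \<mu> + 1 / 8)))" by (simp add: W_def mult_ac)
    also have "t ^ \<nu> * t powr (- (real \<mu> + 1 / 8)) = t ^ \<kappa> * t powr (- 1 / 8)"
    proof -
      have "t ^ \<nu> * t powr (- (real \<mu> + 1 / 8)) = t powr (real \<nu> + - (real \<mu> + 1 / 8))"
        using t by (simp only: powr_add powr_realpow)
      also have "real \<nu> + - (real \<mu> + 1 / 8) = real \<kappa> + - 1 / 8" using le by (simp add: \<mu>_def of_nat_diff)
      also have "t powr (real \<kappa> + - 1 / 8) = t ^ \<kappa> * t powr (- 1 / 8)" using t by (simp only: powr_add powr_realpow)
      finally show ?thesis .
    qed
    also have "W * (t ^ \<kappa> * t powr (- 1 / 8)) \<le> W * (1 * u powr (- 1 / 8))"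
      using t u C0 l by (intro mult_left_mono mult_mono power_le_one powr_mono2') (auto simp: W_def)
    finally show ?thesis by simp
  qed
  have lim: "(\<lambda>m. LBINT u. indicator {0..<1} u *\<^sub>R h m (nat \<lfloor>u * real (N m)\<rfloor>)) \<longlonglongrightarrow> (LBINT u. g u)"
  proof (rule integral_dominated_convergence)
    have "g \<in> borel_measurable borel" unfolding g_def by measurable
    then show "g \<in> borel_measurable lborel" by simp
    show "(\<lambda>u. indicator {0..<1} u *\<^sub>R h m (nat \<lfloor>u * real (N m)\<rfloor>)) \<in> borel_measurable lborel" for m
      using riemann_sum_eq_integral[OF N0[of m], of "h m"] by (auto simp: has_bochner_integral_iff)
    show "integrable lborel (\<lambda>u. W * (indicator {0<..<1} u *\<^sub>R u powr (- 1 / 8)))"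
      by (intro integrable_mult_right integrable_powr_unit)
    have ae: "AE u in lborel. u \<noteq> (0 :: real)" by (rule AE_lborel_singleton)
    show "AE u in lborel. norm (indicator {0..<1} u *\<^sub>R h m (nat \<lfloor>u * real (N m)\<rfloor>)) \<le> W * (indicator {0<..<1} u *\<^sub>R u powr (- 1 / 8))" for m
      using ae
    proof eventually_elim
      case (elim u)
      show ?case
      proof (cases "0 < u \<and> u < 1")
        case True
        then show ?thesis using bound[of u _ m] by (simp add: indicator_def)
      next
        case False
        then have "u \<notin> {0..<1}" "u \<notin> {0<..<1}" using elim by auto
        then show ?thesis by simp
      qed
    qed
    show "AE u in lborel. (\<lambda>m. indicator {0..<1} u *\<^sub>R h m (nat \<lfloor>u * real (N m)\<rfloor>)) \<longlonglongrightarrow> g u"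
      using ae
    proof eventually_elim
      case (elim u)
      show ?case
      proof (cases "0 < u \<and> u < 1")
        case False
        then have "u \<notin> {0..<1}" "u \<notin> {0<..<1}" using elim by auto
        then show ?thesis by (simp add: g_def)
      next
        case True
        then have u: "0 < u" "u < 1" by auto
        define k where "k = (\<lambda>m. nat \<lfloor>u * real (N m)\<rfloor>)"
        have ku: "(\<lambda>m. real (k m) / real (N m)) \<longlonglongrightarrow> u"
          unfolding k_def using u by (intro nat_floor_ratio_limit Ntop) auto
        have kN: "k m \<le> N m" for m
        proof -
          have "u * real (N m) \<le> 1 * real (N m)" using u by (intro mult_right_mono) auto
          then show ?thesis unfolding k_def by (simp add: nat_le_iff floor_le_iff)
        qed
        have k1: "u * real (N m) \<le> real (k m + 1)" for m
        proof -
          have "0 \<le> u * real (N m)" using u by simp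
          then show ?thesis unfolding k_def by linarith
        qed
        have A: "(\<lambda>m. kernel_A \<nu> \<kappa> (x m / real (N m)) (q m) (k m) / real (N m) ^ \<nu>) \<longlonglongrightarrow> u ^ \<nu> * hyp03 \<nu> \<kappa> (u * x0)"
          by (rule kernel_A_limit[OF N kN ku less_imp_le[OF xy(1)] x q(1) q0])
        have "(\<lambda>m. y m * (real (k m) / real (N m))) \<longlonglongrightarrow> y0 * u" by (intro tendsto_mult y ku)
        then have pk: "(\<lambda>m. p m * real (k m)) \<longlonglongrightarrow> u * y0" by (simp add: p_def mult_ac)
        have lu: "l * u \<le> p m * real (k m + 1)" for m
        proof -
          have "u \<le> real (k m + 1) / real (N m)" using k1[of m] N0[of m] by (simp add: field_simps)
          then have "l * u \<le> y m * (real (k m + 1) / real (N m))" using l u xy(2)[of m] by (intro mult_mono) auto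
          then show ?thesis by (simp add: p_def)
        qed
        have B: "(\<lambda>m. kernel_B \<nu> \<kappa> (p m) (c m) (k m)) \<longlonglongrightarrow> (\<integral>X. clif \<kappa> X / X ^ (\<nu> - \<kappa> + 1) * exp (- (u * y0) / X) \<partial>half_line)"
          using l u by (intro kernel_B_limit[OF le p(2) c0 p(1) p(3) w pk lu]) auto
        have "(\<lambda>m. h m (k m)) \<longlonglongrightarrow> u ^ \<nu> * hyp03 \<nu> \<kappa> (u * x0) * (\<integral>X. clif \<kappa> X / X ^ (\<nu> - \<kappa> + 1) * exp (- (u * y0) / X) \<partial>half_line)"
          unfolding h_def by (rule tendsto_mult[OF A B])
        also have "u ^ \<nu> * hyp03 \<nu> \<kappa> (u * x0) * (\<integral>X. clif \<kappa> X / X ^ (\<nu> - \<kappa> + 1) * exp (- (u * y0) / X) \<partial>half_line) = g u"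
          using u y0 by (simp add: g_def meijer_G2_real_def power_mult_distrib)
        finally show ?thesis using u by (simp add: k_def)
      qed
    qed
  qed
  have "(\<lambda>m. x m ^ \<kappa> * y m ^ \<mu> * (LBINT u. indicator {0..<1} u *\<^sub>R h m (nat \<lfloor>u * real (N m)\<rfloor>))) \<longlonglongrightarrow> x0 ^ \<kappa> * y0 ^ \<mu> * (LBINT u. g u)"
    by (intro tendsto_intros x y lim)
  moreover have "x0 ^ \<kappa> * y0 ^ \<mu> * (LBINT u. g u)
      = (x0 / y0) ^ \<kappa> * (LBINT u. indicator {0<..<1} u *\<^sub>R (hyp03 \<nu> \<kappa> (u * x0) * meijer_G2_real \<nu> \<kappa> (u * y0)))"
  proof -
    have "y0 ^ \<nu> = y0 ^ \<kappa> * y0 ^ \<mu>" using le by (simp add: \<mu>_def flip: power_add)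
    moreover have "(LBINT u. g u) = (LBINT u. indicator {0<..<1} u *\<^sub>R (hyp03 \<nu> \<kappa> (u * x0) * meijer_G2_real \<nu> \<kappa> (u * y0))) / y0 ^ \<nu>"
      unfolding g_def by (subst integral_divide_zero[symmetric]) (simp add: indicator_def)
    ultimately show ?thesis using y0 by (simp add: power_divide)
  qed
  ultimately show ?thesis unfolding eq by simp
qed

text \<open>The first half is the limit of the kernel as it is defined. The second gives the form
  with exponent \<kappa> / 2 and exchanged arguments, by transposing the kernel and conjugating it
  with a positive function, which preserves the point process.\<close>

theorem theorem2p4:
  fixes \<alpha> \<beta> :: real and \<nu> \<kappa> :: nat
    and K :: "nat \<Rightarrow> real \<Rightarrow> real \<Rightarrow> real" and S :: "real set"
  assumes "0 < \<alpha>" and "\<alpha> < \<beta>" and "\<kappa> \<le> \<nu>"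
    and "\<And>n. is_correlation_kernel \<kappa> \<nu> \<alpha> \<beta> n (K n)"
    and "compact S" and "S \<subseteq> {0<..}"
  defines "s \<equiv> \<lambda>n. real n * (\<beta>\<^sup>2 - \<alpha>\<^sup>2)"
  shows "uniform_limit (S \<times> S)
           (\<lambda>n (x, y). of_real (1 / s n * K n (x / s n) (y / s n)))
           (\<lambda>(x, y). of_real ((x / y) powr real \<kappa>) * meijer_kernel \<nu> \<kappa> x y)
           sequentially
       \<and> uniform_limit (S \<times> S)
           (\<lambda>n (x, y). of_real ((x / y) powr (real \<kappa> / 2) * (1 / s n * K n (y / s n) (x / s n))))
           (\<lambda>(x, y). of_real ((y / x) powr (real \<kappa> / 2)) * meijer_kernel \<nu> \<kappa> y x)
           sequentially"
proof (cases "S = {}")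
  case True
  then show ?thesis by (simp add: uniform_limit_iff)
next
  case False
  obtain l where l: "l \<in> S" "\<And>t. t \<in> S \<Longrightarrow> l \<le> t" using compact_attains_inf[OF assms(5) False] by blast
  obtain X where X: "\<And>t. t \<in> S \<Longrightarrow> t \<le> X" using compact_attains_sup[OF assms(5) False] by blast
  have l0: "l > 0" using l(1) assms(6) by auto
  have pos: "t \<in> S \<Longrightarrow> t > 0" for t using assms(6) by auto
  have main: "(\<lambda>m. 1 / s (N m) * K (N m) (x m / s (N m)) (y m / s (N m)))
      \<longlonglongrightarrow> (x0 / y0) powr real \<kappa> * (LBINT u. indicator {0<..<1} u *\<^sub>R (hyp03 \<nu> \<kappa> (u * x0) * meijer_G2_real \<nu> \<kappa> (u * y0)))"
    if N: "\<And>m. m < N m" and xS: "\<And>m. x m \<in> S" "x \<longlonglongrightarrow> x0" "x0 \<in> S" and yS: "\<And>m. y m \<in> S" "y \<longlonglongrightarrow> y0" "y0 \<in> S" for N x y x0 y0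
  proof -
    have "(x0 / y0) powr real \<kappa> = (x0 / y0) ^ \<kappa>" using pos xS(3) yS(3) by (intro powr_realpow) auto
    then show ?thesis
      unfolding s_def using scaled_kernel_limit[OF assms(1-4) N l0 l(2)[OF xS(1)] l(2)[OF yS(1)] X[OF xS(1)] xS(2) yS(2)] by simp
  qed
  have SS: "compact (S \<times> S)" using assms(5) by (intro compact_Times)
  show ?thesis
  proof
    show "uniform_limit (S \<times> S) (\<lambda>n (x, y). of_real (1 / s n * K n (x / s n) (y / s n)))
        (\<lambda>(x, y). complex_of_real ((x / y) powr real \<kappa>) * meijer_kernel \<nu> \<kappa> x y) sequentially"
    proof (rule uniform_limit_of_continuous_convergence[OF SS])
      fix N :: "nat \<Rightarrow> nat" and p :: "nat \<Rightarrow> real \<times> real" and p0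
      assume N: "\<And>m. m < N m" and p: "\<And>m. p m \<in> S \<times> S" "p0 \<in> S \<times> S" "p \<longlonglongrightarrow> p0"
      have S: "fst (p m) \<in> S" "snd (p m) \<in> S" "fst p0 \<in> S" "snd p0 \<in> S" for m using p(1)[of m] p(2) by auto
      have "(\<lambda>m. complex_of_real (1 / s (N m) * K (N m) (fst (p m) / s (N m)) (snd (p m) / s (N m))))
          \<longlonglongrightarrow> of_real ((fst p0 / snd p0) powr real \<kappa>
            * (LBINT u. indicator {0<..<1} u *\<^sub>R (hyp03 \<nu> \<kappa> (u * fst p0) * meijer_G2_real \<nu> \<kappa> (u * snd p0))))"
        by (intro tendsto_of_real main N S tendsto_fst tendsto_snd p(3))
      then show "(\<lambda>m. case p m of (x, y) \<Rightarrow> complex_of_real (1 / s (N m) * K (N m) (x / s (N m)) (y / s (N m))))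
          \<longlonglongrightarrow> (case p0 of (x, y) \<Rightarrow> of_real ((x / y) powr real \<kappa>) * meijer_kernel \<nu> \<kappa> x y)"
        unfolding case_prod_unfold meijer_kernel_eq[OF assms(3) pos[OF S(3)] pos[OF S(4)]] of_real_mult .
    qed
    show "uniform_limit (S \<times> S) (\<lambda>n (x, y). of_real ((x / y) powr (real \<kappa> / 2) * (1 / s n * K n (y / s n) (x / s n))))
        (\<lambda>(x, y). complex_of_real ((y / x) powr (real \<kappa> / 2)) * meijer_kernel \<nu> \<kappa> y x) sequentially"
    proof (rule uniform_limit_of_continuous_convergence[OF SS])
      fix N :: "nat \<Rightarrow> nat" and p :: "nat \<Rightarrow> real \<times> real" and p0
      assume N: "\<And>m. m < N m" and p: "\<And>m. p m \<in> S \<times> S" "p0 \<in> S \<times> S" "p \<longlonglongrightarrow> p0"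
      have S: "fst (p m) \<in> S" "snd (p m) \<in> S" "fst p0 \<in> S" "snd p0 \<in> S" for m using p(1)[of m] p(2) by auto
      define a b where "a = fst p0" and "b = snd p0"
      have ab: "a > 0" "b > 0" using pos S(3,4) by (auto simp: a_def b_def)
      have lp: "(\<lambda>m. (fst (p m) / snd (p m)) powr (real \<kappa> / 2)) \<longlonglongrightarrow> (a / b) powr (real \<kappa> / 2)"
        unfolding a_def b_def using ab
        by (intro tendsto_powr tendsto_divide tendsto_fst tendsto_snd tendsto_const p(3)) (auto simp: a_def b_def)
      have "(\<lambda>m. complex_of_real ((fst (p m) / snd (p m)) powr (real \<kappa> / 2) * (1 / s (N m) * K (N m) (snd (p m) / s (N m)) (fst (p m) / s (N m)))))
          \<longlonglongrightarrow> of_real ((a / b) powr (real \<kappa> / 2) * ((snd p0 / fst p0) powr real \<kappa>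
            * (LBINT u. indicator {0<..<1} u *\<^sub>R (hyp03 \<nu> \<kappa> (u * snd p0) * meijer_G2_real \<nu> \<kappa> (u * fst p0)))))"
        by (intro tendsto_of_real tendsto_mult lp main N S tendsto_fst tendsto_snd p(3))
      \<comment> \<open>With the arguments exchanged the first limit carries (b / a)^\<kappa>; the
        conjugating factor halves this exponent.\<close>
      moreover have "(a / b) powr (real \<kappa> / 2) * (b / a) powr real \<kappa> = (b / a) powr (real \<kappa> / 2)"
      proof -
        have "(a / b) powr (real \<kappa> / 2) = (b / a) powr (- (real \<kappa> / 2))"
          using ab by (simp add: powr_divide powr_minus field_simps)
        then show ?thesis using ab by (simp flip: powr_add)
      qed
      then have "complex_of_real ((a / b) powr (real \<kappa> / 2) * ((b / a) powr real \<kappa>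
            * (LBINT u. indicator {0<..<1} u *\<^sub>R (hyp03 \<nu> \<kappa> (u * b) * meijer_G2_real \<nu> \<kappa> (u * a)))))
          = of_real ((b / a) powr (real \<kappa> / 2)) * meijer_kernel \<nu> \<kappa> b a"
        unfolding meijer_kernel_eq[OF assms(3) ab(2) ab(1)] by (simp only: of_real_mult[symmetric] mult.assoc[symmetric])
      ultimately show "(\<lambda>m. case p m of (x, y) \<Rightarrow> complex_of_real ((x / y) powr (real \<kappa> / 2) * (1 / s (N m) * K (N m) (y / s (N m)) (x / s (N m)))))
          \<longlonglongrightarrow> (case p0 of (x, y) \<Rightarrow> of_real ((y / x) powr (real \<kappa> / 2)) * meijer_kernel \<nu> \<kappa> y x)"
        unfolding case_prod_unfold by (simp only: a_def[symmetric] b_def[symmetric])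
    qed
  qed
qed

end
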